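(* If $a_1=0$ and $\mathbb{K}$ has characteristic not two, then $M$ is Symmetrically Gorenstein and the Hilbert function of $M$ is symmetric.
   Context: Let $\mathbb{K}$ be an algebraically closed field, $R=\mathbb{K}[x,y,z]$ with the standard grading, $n>0$ an integer, and $a_1\le a_2\le\cdots\le a_n$, $b_1\le b_2\le\cdots\le b_{n+2}$ integers. Let $\varphi:\bigoplus_{j=1}^{n+2}R(-b_j)\to\bigoplus_{i=1}^nR(-a_i)$ be a degree-zero graded $R$-linear map with matrix $(\varphi_{i,j})$, such that each entry $\varphi_{i,j}$ is either $0$ or homogeneous of positive degree (necessarily equal to $b_j-a_i$). Let $I\subset R$ be the ideal generated by the $n\times n$ minors of $\varphi$, and assume that $I$ has codimension $3$. Let $M=\operatorname{coker}(\varphi)$; it is a graded $R$-module of finite length. For a graded Artinian (finite length) module $N$ over a standard graded polynomial ring $S$ over $\mathbb{K}$, the graded dual $N^\vee=\operatorname{Hom}_{\mathbb{K}}(N,\mathbb{K})$ is the graded $S$-module with $N^\vee_j=\operatorname{Hom}_{\mathbb{K}}(N_{-j},\mathbb{K})$ and action $(af)(\lambda)=f(a\lambda)$. $N$ is Symmetrically Gorenstein if, for some integer $s$, there is a graded isomorphism of $S$-modules $\tau:N\to \operatorname{Hom}_{\mathbb{K}}(N,\mathbb{K})(-s)$ such that $\tau=\operatorname{Hom}_{\mathbb{K}}(\tau,\mathbb{K})(-s)$ (under the canonical identification of $N$ with its double dual). For a nonnegatively graded finite length module $N=N_0\oplus\cdots\oplus N_c$ with $N_0,N_c\ne0$, the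 Hilbert function is symmetric if $\dim_{\mathbb{K}}N_j=\dim_{\mathbb{K}}N_{c-j}$ for all $j$. *)

theory Defs
  imports
    "HOL-Library.Poly_Mapping"
    "HOL-Library.Numeral_Type"
    "HOL-Library.Extended_Nat"
    "HOL-Algebra.Ideal"
    "Jordan_Normal_Form.VS_Connect"
    "Jordan_Normal_Form.DL_Submatrix"
begin

hide_const (open) Multiset.mult Polynomial.smult Modules.module

section \<open>The standard graded polynomial ring in three variables\<close>

text \<open>A monomial is its exponent vector, indexed by the three-element type. As a ring in the
  sense of HOL-Algebra, the polynomial ring is \<open>class_ring\<close> at this type.\<close>

type_synonym 'k poly3 = "(3 \<Rightarrow>\<^sub>0 nat) \<Rightarrow>\<^sub>0 'k"

definition monom_degree :: "(3 \<Rightarrow>\<^sub>0 nat) \<Rightarrow> nat" where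
  "monom_degree m = (\<Sum>i\<in>UNIV. Poly_Mapping.lookup m i)"

text \<open>The component of degree \<open>d\<close>; it contains \<open>0\<close>, and it is \<open>{0}\<close> for negative \<open>d\<close>.\<close>

definition homogeneous :: "int \<Rightarrow> 'k::zero poly3 set" where
  "homogeneous d = {p. \<forall>m\<in>Poly_Mapping.keys p. int (monom_degree m) = d}"

definition Const :: "'k::zero \<Rightarrow> 'k poly3" where
  "Const c = Poly_Mapping.single 0 c"


section \<open>Codimension of an ideal\<close>

definition height :: "('a, 'b) ring_scheme \<Rightarrow> 'a set \<Rightarrow> enat" where
  "height R P = Sup {enat l | l. \<exists>C :: nat \<Rightarrow> 'a set.
     (\<forall>i\<le>l. primeideal (C i) R) \<and> (\<forall>i<l. C i \<subset> C (Suc i)) \<and> C l = P}"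

definition codim :: "('a, 'b) ring_scheme \<Rightarrow> 'a set \<Rightarrow> enat" where
  "codim R I = Inf {height R P | P. primeideal P R \<and> I \<subseteq> P}"

definition maximal_minors_ideal :: "'r::comm_ring_1 mat \<Rightarrow> 'r set" where
  "maximal_minors_ideal A = genideal class_ring
     {det (submatrix A UNIV J) | J. J \<subseteq> {..<dim_col A} \<and> card J = dim_row A}"


section \<open>Graded modules\<close>

text \<open>\<open>component N j\<close> is the subgroup \<open>N\<^sub>j\<close>. As for every module in HOL-Algebra, the
  fields \<open>mult\<close> and \<open>one\<close> inherited from rings carry no meaning.\<close>

record ('r, 'm) gmodule = "('r, 'm) module" +
  component :: "int \<Rightarrow> 'm set"

locale graded_module =
  fixes N :: "('k::field poly3, 'm, 'z) gmodule_scheme" (structure)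
  assumes module: "module class_ring N"
    and component_subgroup: "additive_subgroup (component N j) N"
    and smult_component:
      "p \<in> homogeneous d \<Longrightarrow> x \<in> component N j \<Longrightarrow> p \<odot> x \<in> component N (d + j)"
    and direct_sum:
      "x \<in> carrier N \<Longrightarrow> \<exists>!c :: int \<Rightarrow> 'm. (\<forall>j. c j \<in> component N j) \<and>
         finite {j. c j \<noteq> \<zero>} \<and> x = finsum N c {j. c j \<noteq> \<zero>}"

text \<open>The length of a module is the supremum of the lengths of strict chains of submodules.\<close>

definition finite_length ::
  "('r, 'a) ring_scheme \<Rightarrow> ('r, 'm, 'z) module_scheme \<Rightarrow> bool" where
  "finite_length R N \<longleftrightarrow> (\<exists>B::nat. \<forall>l. \<forall>C :: nat \<Rightarrow> 'm set.
     (\<forall>i\<le>l. submodule R (C i) N) \<and> (\<forall>i<l. C i \<subset> C (Suc i)) \<longrightarrow> l \<le> B)"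

text \<open>Homomorphisms and isomorphisms of graded modules, of degree zero.\<close>

definition graded_hom ::
  "('k::field poly3, 'm, 'z) gmodule_scheme \<Rightarrow> ('k poly3, 'p, 'y) gmodule_scheme \<Rightarrow>
     ('m \<Rightarrow> 'p) \<Rightarrow> bool" where
  "graded_hom N P \<tau> \<longleftrightarrow> \<tau> \<in> module_hom class_ring N P \<and>
     (\<forall>j. \<tau> ` component N j \<subseteq> component P j)"

definition graded_iso ::
  "('k::field poly3, 'm, 'z) gmodule_scheme \<Rightarrow> ('k poly3, 'p, 'y) gmodule_scheme \<Rightarrow>
     ('m \<Rightarrow> 'p) \<Rightarrow> bool" where
  "graded_iso N P \<tau> \<longleftrightarrow> graded_hom N P \<tau> \<and> bij_betw \<tau> (carrier N) (carrier P)"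

text \<open>The twist \<open>N(d)\<close>, with \<open>N(d)\<^sub>j = N\<^sub>d\<^sub>+\<^sub>j\<close>.\<close>

definition twist ::
  "('r, 'm, 'z) gmodule_scheme \<Rightarrow> int \<Rightarrow> ('r, 'm, 'z) gmodule_scheme" where
  "twist N d = N\<lparr>component := (\<lambda>j. component N (d + j))\<rparr>"

text \<open>The direct sum of the \<open>R(-a\<^sub>i)\<close> for \<open>i < n\<close>; its module structure is that of
  \<open>module_vec\<close>.\<close>

definition graded_free :: "nat \<Rightarrow> (nat \<Rightarrow> int) \<Rightarrow> ('k::field poly3, 'k poly3 vec) gmodule" where
  "graded_free n a = \<lparr>carrier = carrier_vec n, mult = undefined, one = undefined,
     zero = 0\<^sub>v n, add = (+), smult = (\<cdot>\<^sub>v),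
     component = (\<lambda>j. {v \<in> carrier_vec n. \<forall>i<n. v $ i \<in> homogeneous (j - a i)})\<rparr>"

definition graded_quotient ::
  "('r, 'm, 'z) gmodule_scheme \<Rightarrow> 'm set \<Rightarrow> ('r, 'm set) gmodule" where
  "graded_quotient N W = \<lparr>carrier = a_rcosets\<^bsub>N\<^esub> W, mult = undefined, one = undefined,
     zero = W, add = set_add N,
     smult = (\<lambda>p X. \<Union>x\<in>X. W +>\<^bsub>N\<^esub> (p \<odot>\<^bsub>N\<^esub> x)),
     component = (\<lambda>j. {W +>\<^bsub>N\<^esub> x | x. x \<in> component N j})\<rparr>"

definition graded_coker ::
  "('r, 'm, 'z) gmodule_scheme \<Rightarrow> ('r, 'p, 'y) gmodule_scheme \<Rightarrow> ('m \<Rightarrow> 'p) \<Rightarrow>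
     ('r, 'p set) gmodule" where
  "graded_coker N P f = graded_quotient P (f ` carrier N)"


section \<open>Hilbert functions\<close>

definition component_space ::
  "('k::field poly3, 'm, 'z) gmodule_scheme \<Rightarrow> int \<Rightarrow> ('k, 'm) module" where
  "component_space N j = \<lparr>carrier = component N j, mult = undefined, one = undefined,
     zero = \<zero>\<^bsub>N\<^esub>, add = add N, smult = (\<lambda>c x. Const c \<odot>\<^bsub>N\<^esub> x)\<rparr>"

text \<open>Meaningful only if the components are finite-dimensional, for instance for modules of
  finite length.\<close>

definition hilbert_function :: "('k::field poly3, 'm, 'z) gmodule_scheme \<Rightarrow> int \<Rightarrow> nat" where
  "hilbert_function N j = vectorspace.dim (class_ring :: 'k ring) (component_space N j)"

definition symmetric_hilbert_function ::
  "('k::field poly3, 'm, 'z) gmodule_scheme \<Rightarrow> bool" where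
  "symmetric_hilbert_function N \<longleftrightarrow>
     graded_module N \<and> finite_length (class_ring :: 'k poly3 ring) N \<and>
     (\<exists>c\<ge>0. (\<forall>j. j < 0 \<or> c < j \<longrightarrow> component N j = {\<zero>\<^bsub>N\<^esub>}) \<and>
        component N 0 \<noteq> {\<zero>\<^bsub>N\<^esub>} \<and> component N c \<noteq> {\<zero>\<^bsub>N\<^esub>} \<and>
        (\<forall>j. hilbert_function N j = hilbert_function N (c - j)))"


section \<open>Graded duals\<close>

text \<open>Functionals are \<open>undefined\<close> outside the carrier, so that equality in the dual is equality
  of functions. All linear functionals are admitted, as \<open>N\<close> is of finite length; the component of
  degree \<open>j\<close> is \<open>Hom(N\<^sub>-\<^sub>j, K)\<close>, each functional being extended by zero to the other components
  of \<open>N\<close>.\<close>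

definition graded_dual ::
  "('k::field poly3, 'm, 'z) gmodule_scheme \<Rightarrow> ('k poly3, 'm \<Rightarrow> 'k) gmodule" where
  "graded_dual N =
     (let D = {f \<in> extensional (carrier N).
        (\<forall>x\<in>carrier N. \<forall>y\<in>carrier N. f (x \<oplus>\<^bsub>N\<^esub> y) = f x + f y) \<and>
        (\<forall>c. \<forall>x\<in>carrier N. f (Const c \<odot>\<^bsub>N\<^esub> x) = c * f x)}
      in \<lparr>carrier = D, mult = undefined, one = undefined,
        zero = (\<lambda>x\<in>carrier N. 0), add = (\<lambda>f g. \<lambda>x\<in>carrier N. f x + g x),
        smult = (\<lambda>p f. \<lambda>x\<in>carrier N. f (p \<odot>\<^bsub>N\<^esub> x)),
        component = (\<lambda>j. {f \<in> D. \<forall>i. i \<noteq> - j \<longrightarrow> (\<forall>x\<in>component N i. f x = 0)})\<rparr>)"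

text \<open>The map \<open>Hom(\<tau>, K)\<close> from the dual of the target of \<open>\<tau>\<close> to the dual of its source \<open>N\<close>.\<close>

definition dual_map ::
  "('k::field poly3, 'm, 'z) gmodule_scheme \<Rightarrow> ('m \<Rightarrow> 'p) \<Rightarrow> ('p \<Rightarrow> 'k) \<Rightarrow> ('m \<Rightarrow> 'k)" where
  "dual_map N \<tau> g = (\<lambda>x\<in>carrier N. g (\<tau> x))"

text \<open>The canonical identification of \<open>N\<close> with its double dual.\<close>

definition double_dual_map ::
  "('k::field poly3, 'm, 'z) gmodule_scheme \<Rightarrow> 'm \<Rightarrow> (('m \<Rightarrow> 'k) \<Rightarrow> 'k)" where
  "double_dual_map N x = (\<lambda>f\<in>carrier (graded_dual N). f x)"

text \<open>Twists do not change the underlying functions, so no twist appears in the last equation: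
  it is \<open>\<tau> = Hom(\<tau>, K)(-s)\<close>.\<close>

definition symmetrically_gorenstein ::
  "('k::field poly3, 'm, 'z) gmodule_scheme \<Rightarrow> bool" where
  "symmetrically_gorenstein N \<longleftrightarrow>
     graded_module N \<and> finite_length (class_ring :: 'k poly3 ring) N \<and>
     (\<exists>s \<tau>. graded_iso N (twist (graded_dual N) (- s)) \<tau> \<and>
        (\<forall>x\<in>carrier N. \<tau> x = dual_map N \<tau> (double_dual_map N x)))"

end

theory Submission
  imports Defs
begin

text \<open>The symmetric form on \<open>M\<close> is found by chasing the Buchsbaum--Rim resolution
  \<open>0 \<rightarrow> G\<^sup>* \<rightarrow> F\<^sup>* \<rightarrow> F \<rightarrow> G \<rightarrow> M \<rightarrow> 0\<close>, which is self-dual with alternating middle map, through the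
  Cech complex of \<open>x, y, z\<close>. By dimension theory the powers \<open>X = x\<^sup>N\<close>, \<open>Y = y\<^sup>N\<close>, \<open>Z = z\<^sup>N\<close> annihilate
  \<open>M\<close>, so there are homogeneous maps \<open>\<sigma>\<^sub>x, \<sigma>\<^sub>y, \<sigma>\<^sub>z\<close> from \<open>G\<close> to \<open>F\<close> with \<open>\<phi> \<sigma>\<^sub>x = X\<close>, \<open>\<phi> \<sigma>\<^sub>y = Y\<close>,
  \<open>\<phi> \<sigma>\<^sub>z = Z\<close>. The chase ends in the class of \<open>det [\<sigma>\<^sub>x h, \<sigma>\<^sub>z g, \<sigma>\<^sub>y] / (X Y\<^sup>n Z)\<close> in \<open>H\<^sup>3\<close>, and its
  residue is the value of the form at \<open>g\<close> and \<open>h\<close>. That it is symmetric, vanishes on the image of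
  \<open>\<phi>\<close> and is nondegenerate on \<open>M\<close> follows from identities between such determinants modulo
  \<open>(X, Y\<^sup>n, Z)\<close>; exactness of the resolution is not needed.\<close>

text \<open>The kernel of \<open>P\<close> has rank two, so any two alternating forms on it are
  proportional. \<open>det2_change_section\<close> computes the factor between the forms given by
  two sections, and this factor is the source of the powers of \<open>Y\<close> that make the
  pairing well defined. Its exponent \<open>n\<close> is the number of rows of a section. This
  explains the lopsided ideal (X, Y^n, Z): the determinant contains all \<open>n\<close> rows of
  \<open>Sy\<close>, but only one vector from each of \<open>Sx\<close> and \<open>Sz\<close>. Cech
  cochains never occur as objects. Their denominators are cleared, and cancelling a monomial amounts
  to lowering exponents in an ideal generated by powers of the variables.\<close>

declare add_2_eq_Suc [simp del] add_2_eq_Suc' [simp del]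


section \<open>Bordered determinants\<close>

lemma mult_mat_smult_vec:
  fixes A :: "'a::comm_ring_1 mat"
  assumes "A \<in> carrier_mat m n" "v \<in> carrier_vec n"
  shows "A *\<^sub>v (c \<cdot>\<^sub>v v) = c \<cdot>\<^sub>v (A *\<^sub>v v)"
  by (rule eq_vecI) (use assms in \<open>auto simp: scalar_prod_def sum_distrib_left mult_ac\<close>)

lemma smult_one_mat_mult_vec:
  fixes v :: "'a::comm_ring_1 vec"
  assumes "v \<in> carrier_vec n"
  shows "(c \<cdot>\<^sub>m 1\<^sub>m n) *\<^sub>v v = c \<cdot>\<^sub>v v"
  by (rule eq_vecI)
    (use assms in \<open>auto simp: scalar_prod_def if_distrib if_distribR cong: if_cong\<close>)

text \<open>In the intended case \<open>A\<close> has two more columns than rows. Then the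
  determinant is the wedge product of \<open>f\<close>, \<open>g\<close> and all rows of
  \<open>A\<close>, an alternating form in \<open>f\<close> and \<open>g\<close> that vanishes on
  the span of the rows.\<close>

definition bordered :: "'a::comm_ring_1 mat \<Rightarrow> 'a vec \<Rightarrow> 'a vec \<Rightarrow> 'a mat" where
  "bordered A f g = mat (dim_row A + 2) (dim_row A + 2)
     (\<lambda>(i, j). if i = 0 then f $ j else if i = 1 then g $ j else A $$ (i - 2, j))"

definition det2 :: "'a::comm_ring_1 mat \<Rightarrow> 'a vec \<Rightarrow> 'a vec \<Rightarrow> 'a" where
  "det2 A f g = det (bordered A f g)"

lemma bordered_carrier [simp]: "bordered A f g \<in> carrier_mat (dim_row A + 2) (dim_row A + 2)"
  by (simp add: bordered_def)

text \<open>The cofactors along the top row do not see that row, so they may be computed with 0 on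
  top and recovered by putting unit vectors there. Linearity in either argument is read off from
  this expansion.\<close>

lemma det2_expand_left:
  "det2 A f g = (\<Sum>j<dim_row A + 2. f $ j * det2 A (unit_vec (dim_row A + 2) j) g)"
proof -
  let ?m = "dim_row A + 2"
  define c where "c j = cofactor (bordered A (0\<^sub>v ?m) g) 0 j" for j
  have "mat_delete (bordered A h g) 0 j = mat_delete (bordered A (0\<^sub>v ?m) g) 0 j" for h j
    by (rule eq_matI) (auto simp: mat_delete_def bordered_def)
  then have cof: "cofactor (bordered A h g) 0 j = c j" for h j
    by (metis c_def cofactor_def)
  have expand: "det2 A h g = (\<Sum>j<?m. h $ j * c j)" for h
  proof -
    have "det2 A h g = (\<Sum>j<?m. bordered A h g $$ (0, j) * cofactor (bordered A h g) 0 j)"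
      unfolding det2_def by (rule laplace_expansion_row) auto
    also have "\<dots> = (\<Sum>j<?m. h $ j * c j)"
      by (rule sum.cong[OF refl], unfold cof) (simp add: bordered_def)
    finally show ?thesis .
  qed
  have "det2 A (unit_vec ?m j) g = c j" if "j < ?m" for j
  proof -
    have "det2 A (unit_vec ?m j) g = (\<Sum>l<?m. if l = j then c j else 0)"
      unfolding expand by (rule sum.cong) (use that in auto)
    then show ?thesis
      using that by simp
  qed
  then show ?thesis
    by (subst expand) simp
qed

lemma det2_swap: "det2 A g f = - det2 A f g"
proof -
  have "swaprows 0 1 (bordered A f g) = bordered A g f"
    by (rule eq_matI) (auto simp: bordered_def)
  then show ?thesis
    using det_swaprows[of 0 "dim_row A + 2" 1 "bordered A f g"] by (simp add: det2_def)
qed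

lemma det2_expand_right:
  "det2 A f g = (\<Sum>j<dim_row A + 2. g $ j * det2 A f (unit_vec (dim_row A + 2) j))"
proof -
  have "det2 A f g = - (\<Sum>j<dim_row A + 2. g $ j * det2 A (unit_vec (dim_row A + 2) j) f)"
    by (subst det2_swap) (simp flip: det2_expand_left)
  also have "\<dots> = (\<Sum>j<dim_row A + 2. g $ j * det2 A f (unit_vec (dim_row A + 2) j))"
    unfolding sum_negf[symmetric]
    by (intro sum.cong refl) (subst det2_swap, simp)
  finally show ?thesis .
qed

context
  fixes A :: "'a::comm_ring_1 mat" and n
  assumes dim: "dim_row A = n"
begin

lemma det2_add_left:
  "f \<in> carrier_vec (n + 2) \<Longrightarrow> f' \<in> carrier_vec (n + 2) \<Longrightarrow>
     det2 A (f + f') g = det2 A f g + det2 A f' g"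
  by (subst (1 2 3) det2_expand_left) (simp add: dim distrib_right sum.distrib)

lemma det2_diff_left:
  "f \<in> carrier_vec (n + 2) \<Longrightarrow> f' \<in> carrier_vec (n + 2) \<Longrightarrow>
     det2 A (f - f') g = det2 A f g - det2 A f' g"
  by (subst (1 2 3) det2_expand_left) (simp add: dim left_diff_distrib sum_subtractf)

lemma det2_smult_left:
  "f \<in> carrier_vec (n + 2) \<Longrightarrow> det2 A (c \<cdot>\<^sub>v f) g = c * det2 A f g"
  by (subst (1 2) det2_expand_left) (simp add: dim sum_distrib_left mult.assoc)

lemma det2_add_right:
  "g \<in> carrier_vec (n + 2) \<Longrightarrow> g' \<in> carrier_vec (n + 2) \<Longrightarrow>
     det2 A f (g + g') = det2 A f g + det2 A f g'"
  by (subst (1 2 3) det2_expand_right) (simp add: dim distrib_right sum.distrib)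

lemma det2_diff_right:
  "g \<in> carrier_vec (n + 2) \<Longrightarrow> g' \<in> carrier_vec (n + 2) \<Longrightarrow>
     det2 A f (g - g') = det2 A f g - det2 A f g'"
  by (subst (1 2 3) det2_expand_right) (simp add: dim left_diff_distrib sum_subtractf)

lemma det2_smult_right:
  "g \<in> carrier_vec (n + 2) \<Longrightarrow> det2 A f (c \<cdot>\<^sub>v g) = c * det2 A f g"
  by (subst (1 2) det2_expand_right) (simp add: dim sum_distrib_left mult.assoc)

lemma det2_row:
  assumes "A \<in> carrier_mat n (n + 2)" "i < n"
  shows "det2 A f (row A i) = 0"
proof -
  have "row (bordered A f (row A i)) 1 = row (bordered A f (row A i)) (i + 2)"
    by (rule eq_vecI) (use assms in \<open>auto simp: bordered_def\<close>)
  then show ?thesis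
    using det_identical_rows[of "bordered A f (row A i)" "n + 2" 1 "i + 2"] assms
    by (simp add: det2_def dim bordered_def)
qed

lemma det2_rows:
  assumes A: "A \<in> carrier_mat n (n + 2)" and h: "h \<in> carrier_vec n"
  shows "det2 A f (A\<^sup>T *\<^sub>v h) = 0"
proof -
  have "det2 A f (A\<^sup>T *\<^sub>v h) = (\<Sum>j<n + 2. (\<Sum>i<n. h $ i * A $$ (i, j)) * det2 A f (unit_vec (n + 2) j))"
    by (subst det2_expand_right, unfold dim, rule sum.cong)
      (use A h in \<open>auto simp: scalar_prod_def mult.commute atLeast0LessThan\<close>)
  also have "\<dots> = (\<Sum>i<n. h $ i * (\<Sum>j<n + 2. row A i $ j * det2 A f (unit_vec (n + 2) j)))"
    unfolding sum_distrib_right sum_distrib_left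
    by (subst sum.swap) (use A in \<open>auto intro!: sum.cong simp: mult.assoc\<close>)
  also have "\<dots> = (\<Sum>i<n. h $ i * det2 A f (row A i))"
    by (subst (2) det2_expand_right) (simp add: dim)
  also have "\<dots> = 0"
    by (simp add: det2_row[OF A])
  finally show ?thesis .
qed

lemma det2_rows_left:
  assumes "A \<in> carrier_mat n (n + 2)" "h \<in> carrier_vec n"
  shows "det2 A (A\<^sup>T *\<^sub>v h) f = 0"
  using det2_rows[OF assms] by (subst det2_swap) simp

end

section \<open>Products of bordered determinants and change of section\<close>

lemma mat_2_det:
  assumes "A \<in> carrier_mat 2 2"
  shows "det A = A $$ (0, 0) * A $$ (1, 1) - A $$ (0, 1) * A $$ (1, 0)"
proof -
  have "det A = (\<Sum>j<2. A $$ (0, j) * cofactor A 0 j)"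
    using assms by (rule laplace_expansion_row) simp
  also have "\<dots> = A $$ (0, 0) * det (mat_delete A 0 0) - A $$ (0, 1) * det (mat_delete A 0 1)"
    by (simp add: lessThan_nat_numeral numeral_2_eq_2 cofactor_def)
  also have "det (mat_delete A 0 0) = A $$ (1, 1)"
    using assms by (subst det_single) (auto simp: mat_delete_def)
  also have "det (mat_delete A 0 1) = A $$ (1, 0)"
    using assms by (subst det_single) (auto simp: mat_delete_def)
  finally show ?thesis .
qed

text \<open>One bordered matrix times the transpose of the other is block upper triangular: the
  kernel conditions produce the zero block and the section equation the block \<open>D\<close> times
  the identity. The remaining 2 x 2 block consists of the scalar products.\<close>

lemma det2_mult:
  fixes P S :: "'a::idom mat"
  assumes P: "P \<in> carrier_mat n (n + 2)" and S: "S \<in> carrier_mat n (n + 2)"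
    and sec: "P * S\<^sup>T = D \<cdot>\<^sub>m 1\<^sub>m n"
    and vec: "\<alpha> \<in> carrier_vec (n + 2)" "\<beta> \<in> carrier_vec (n + 2)"
      "w \<in> carrier_vec (n + 2)" "v \<in> carrier_vec (n + 2)"
    and ker: "P *\<^sub>v w = 0\<^sub>v n" "P *\<^sub>v v = 0\<^sub>v n"
  shows "det2 P \<alpha> \<beta> * det2 S w v = D ^ n * ((\<alpha> \<bullet> w) * (\<beta> \<bullet> v) - (\<alpha> \<bullet> v) * (\<beta> \<bullet> w))"
proof -
  let ?B = "bordered P \<alpha> \<beta>" and ?C = "bordered S w v"
  have B: "?B \<in> carrier_mat (n + 2) (n + 2)" and C: "?C \<in> carrier_mat (n + 2) (n + 2)"
    using bordered_carrier[of P] bordered_carrier[of S] P S by auto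
  define U where "U = mat 2 2 (\<lambda>(i, j). (if i = 0 then \<alpha> else \<beta>) \<bullet> (if j = 0 then w else v))"
  define V where "V = mat 2 n (\<lambda>(i, j). (if i = 0 then \<alpha> else \<beta>) \<bullet> row S j)"
  have rowB: "row ?B i = (if i = 0 then \<alpha> else if i = 1 then \<beta> else row P (i - 2))" if "i < n + 2" for i
    by (rule eq_vecI) (use that P vec in \<open>auto simp: bordered_def\<close>)
  have rowC: "row ?C i = (if i = 0 then w else if i = 1 then v else row S (i - 2))" if "i < n + 2" for i
    by (rule eq_vecI) (use that S vec in \<open>auto simp: bordered_def\<close>)
  have PS: "row P i \<bullet> row S j = (if i = j then D else 0)" if "i < n" "j < n" for i j
  proof -
    have "(P * S\<^sup>T) $$ (i, j) = row P i \<bullet> row S j"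
      using P S that by simp
    then show ?thesis
      unfolding sec using that by (cases "i = j") auto
  qed
  have Pk: "row P i \<bullet> w = 0" "row P i \<bullet> v = 0" if "i < n" for i
    using that P arg_cong[OF ker(1), of "\<lambda>u. u $ i"] arg_cong[OF ker(2), of "\<lambda>u. u $ i"] by auto
  have "?B * ?C\<^sup>T = four_block_mat U V (0\<^sub>m n 2) (D \<cdot>\<^sub>m 1\<^sub>m n)"
  proof (rule eq_matI)
    fix i j
    assume "i < dim_row (four_block_mat U V (0\<^sub>m n 2) (D \<cdot>\<^sub>m 1\<^sub>m n))"
      and "j < dim_col (four_block_mat U V (0\<^sub>m n 2) (D \<cdot>\<^sub>m 1\<^sub>m n))"
    then have ij: "i < n + 2" "j < n + 2"
      by (auto simp: U_def V_def)
    then have "(?B * ?C\<^sup>T) $$ (i, j) = row ?B i \<bullet> row ?C j"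
      using B C by simp
    then show "(?B * ?C\<^sup>T) $$ (i, j) = four_block_mat U V (0\<^sub>m n 2) (D \<cdot>\<^sub>m 1\<^sub>m n) $$ (i, j)"
      using ij by (auto simp: rowB rowC U_def V_def PS Pk less_2_cases_iff)
  qed (use B C in \<open>auto simp: U_def V_def\<close>)
  then have "det ?B * det ?C = det (four_block_mat U V (0\<^sub>m n 2) (D \<cdot>\<^sub>m 1\<^sub>m n))"
    using det_mult[OF B, of "?C\<^sup>T"] C by (simp add: det_transpose)
  also have "\<dots> = det U * det (D \<cdot>\<^sub>m 1\<^sub>m n)"
    by (rule det_four_block_mat_lower_left_zero) (auto simp: U_def V_def)
  also have "\<dots> = det U * D ^ n"
    by simp
  also have "det U = (\<alpha> \<bullet> w) * (\<beta> \<bullet> v) - (\<alpha> \<bullet> v) * (\<beta> \<bullet> w)"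
    by (subst mat_2_det) (auto simp: U_def)
  finally show ?thesis
    by (simp add: det2_def mult.commute)
qed

text \<open>The bordered determinants of \<open>P\<close> are the entries of the middle map of the Buchsbaum--Rim
  complex; on the kernel of \<open>P\<close> those of \<open>S\<close> invert it up to a power of \<open>D\<close>.\<close>

lemma det2_contract:
  fixes P S :: "'a::idom mat"
  assumes P: "P \<in> carrier_mat n (n + 2)" and S: "S \<in> carrier_mat n (n + 2)"
    and sec: "P * S\<^sup>T = D \<cdot>\<^sub>m 1\<^sub>m n" and D: "D \<noteq> 0"
    and vec: "\<alpha> \<in> carrier_vec (n + 2)" "w \<in> carrier_vec (n + 2)"
    and ker: "P *\<^sub>v w = 0\<^sub>v n"
  shows "det2 P \<alpha> (Matrix.vec (n + 2) (\<lambda>j. det2 S w (unit_vec (n + 2) j))) = D ^ n * (\<alpha> \<bullet> w)"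
proof -
  let ?e = "unit_vec (n + 2)"
  \<comment> \<open>\<open>D\<close> times the projection of the unit vector to the kernel of
    \<open>P\<close> along the image of the section.\<close>
  define \<pi> where "\<pi> j = D \<cdot>\<^sub>v ?e j - S\<^sup>T *\<^sub>v (P *\<^sub>v ?e j)" for j
  have e: "?e j \<in> carrier_vec (n + 2)" for j
    by simp
  have Pe: "P *\<^sub>v ?e j \<in> carrier_vec n" for j
    using P by (rule mult_mat_vec_carrier) simp
  have \<pi>: "\<pi> j \<in> carrier_vec (n + 2)" for j
    using S Pe by (auto simp: \<pi>_def)
  have nth: "\<pi> j $ l = (if j = l then D else 0) - (\<Sum>i<n. S $$ (i, l) * P $$ (i, j))"
    if "j < n + 2" "l < n + 2" for j l
    using that P S by (auto simp: \<pi>_def scalar_prod_def atLeast0LessThan if_distrib cong: if_cong)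
  have ker\<pi>: "P *\<^sub>v \<pi> j = 0\<^sub>v n" for j
  proof -
    have "P *\<^sub>v \<pi> j = D \<cdot>\<^sub>v (P *\<^sub>v ?e j) - P *\<^sub>v (S\<^sup>T *\<^sub>v (P *\<^sub>v ?e j))"
      unfolding \<pi>_def using P S Pe
      by (subst mult_minus_distrib_mat_vec[OF P]) (auto simp: mult_mat_smult_vec[OF P])
    also have "P *\<^sub>v (S\<^sup>T *\<^sub>v (P *\<^sub>v ?e j)) = (P * S\<^sup>T) *\<^sub>v (P *\<^sub>v ?e j)"
      using P S Pe by (subst assoc_mult_mat_vec[of _ n "n + 2" _ n]) auto
    also have "\<dots> = D \<cdot>\<^sub>v (P *\<^sub>v ?e j)"
      unfolding sec using Pe by (rule smult_one_mat_mult_vec)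
    finally show ?thesis
      using Pe[of j] by auto
  qed
  have proj: "D * det2 S w (?e j) = det2 S w (\<pi> j)" for j
    unfolding \<pi>_def using S Pe
    by (simp add: det2_diff_right[of S n] det2_smult_right[of S n] det2_rows[of S n])
  \<comment> \<open>The 2 is the rank of the kernel: \<open>(n + 2) * D\<close> for the whole space
    minus \<open>n * D\<close> for the image of the section.\<close>
  have trace: "(\<Sum>j<n + 2. ?e j \<bullet> \<pi> j) = 2 * D"
  proof -
    have "(\<Sum>j<n + 2. ?e j \<bullet> \<pi> j) = (\<Sum>j<n + 2. D - (\<Sum>i<n. S $$ (i, j) * P $$ (i, j)))"
      by (rule sum.cong) (use \<pi> nth in auto)
    also have "\<dots> = of_nat (n + 2) * D - (\<Sum>i<n. \<Sum>j<n + 2. P $$ (i, j) * S $$ (i, j))"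
      by (subst sum.swap) (simp add: sum_subtractf mult.commute)
    also have "(\<Sum>i<n. \<Sum>j<n + 2. P $$ (i, j) * S $$ (i, j)) = (\<Sum>i<n. (P * S\<^sup>T) $$ (i, i))"
      by (rule sum.cong) (use P S in \<open>auto simp: scalar_prod_def atLeast0LessThan\<close>)
    also have "\<dots> = of_nat n * D"
      by (simp add: sec)
    finally show ?thesis
      by (simp add: algebra_simps)
  qed
  \<comment> \<open>Since \<open>w\<close> lies in the kernel of \<open>P\<close>, the scaled
    projection acts on it as multiplication by \<open>D\<close>.\<close>
  have contract: "(\<Sum>j<n + 2. (?e j \<bullet> w) * (\<alpha> \<bullet> \<pi> j)) = D * (\<alpha> \<bullet> w)"
  proof -
    have "(\<Sum>j<n + 2. w $ j * \<pi> j $ l) = D * w $ l" if l: "l < n + 2" for l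
    proof -
      have "(\<Sum>j<n + 2. w $ j * \<pi> j $ l) =
          (\<Sum>j<n + 2. (if j = l then D * w $ l else 0) - (\<Sum>i<n. S $$ (i, l) * (P $$ (i, j) * w $ j)))"
        by (rule sum.cong)
          (use l nth in \<open>auto simp: right_diff_distrib sum_distrib_left mult_ac intro!: sum.cong\<close>)
      also have "\<dots> = D * w $ l - (\<Sum>i<n. S $$ (i, l) * (\<Sum>j<n + 2. P $$ (i, j) * w $ j))"
        unfolding sum_subtractf sum_distrib_left by (subst (2) sum.swap) (use l in simp)
      also have "(\<Sum>i<n. S $$ (i, l) * (\<Sum>j<n + 2. P $$ (i, j) * w $ j)) =
          (\<Sum>i<n. S $$ (i, l) * (P *\<^sub>v w) $ i)"
        by (rule sum.cong) (use P vec in \<open>auto simp: scalar_prod_def atLeast0LessThan\<close>)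
      also have "\<dots> = 0"
        by (simp add: ker)
      finally show ?thesis
        by simp
    qed
    note inner = this
    have "(\<Sum>j<n + 2. (?e j \<bullet> w) * (\<alpha> \<bullet> \<pi> j)) = (\<Sum>j<n + 2. \<Sum>l<n + 2. \<alpha> $ l * (w $ j * \<pi> j $ l))"
    proof (rule sum.cong[OF refl])
      fix j assume "j \<in> {..<n + 2}"
      then have "?e j \<bullet> w = w $ j"
        using vec by simp
      moreover have "\<alpha> \<bullet> \<pi> j = (\<Sum>l<n + 2. \<alpha> $ l * \<pi> j $ l)"
        using \<pi>[of j] by (simp add: scalar_prod_def atLeast0LessThan)
      ultimately show "(?e j \<bullet> w) * (\<alpha> \<bullet> \<pi> j) = (\<Sum>l<n + 2. \<alpha> $ l * (w $ j * \<pi> j $ l))"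
        by (simp add: sum_distrib_left mult_ac)
    qed
    also have "\<dots> = (\<Sum>l<n + 2. \<alpha> $ l * (D * w $ l))"
      by (subst sum.swap) (simp add: inner flip: sum_distrib_left del: lessThan_Suc sum.lessThan_Suc)
    also have "\<dots> = D * (\<alpha> \<bullet> w)"
      using vec by (simp add: scalar_prod_def atLeast0LessThan sum_distrib_left mult_ac)
    finally show ?thesis .
  qed
  have "det2 P \<alpha> (Matrix.vec (n + 2) (\<lambda>j. det2 S w (?e j))) =
      (\<Sum>j<n + 2. det2 S w (?e j) * det2 P \<alpha> (?e j))"
    using P by (subst det2_expand_right) auto
  \<comment> \<open>\<open>det2_mult\<close> needs both vectors in the kernel. The additional factor
    \<open>D\<close> pays for replacing the unit vectors by their projections, and it is cancelled
    at the end, where 2 D - D = D.\<close>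
  then have "D * det2 P \<alpha> (Matrix.vec (n + 2) (\<lambda>j. det2 S w (?e j))) =
      (\<Sum>j<n + 2. det2 P \<alpha> (?e j) * det2 S w (\<pi> j))"
    by (simp add: sum_distrib_left mult_ac flip: proj)
  also have "\<dots> = (\<Sum>j<n + 2. D ^ n * ((\<alpha> \<bullet> w) * (?e j \<bullet> \<pi> j) - (?e j \<bullet> w) * (\<alpha> \<bullet> \<pi> j)))"
    by (rule sum.cong) (use det2_mult[OF P S sec vec(1) e vec(2) \<pi> ker ker\<pi>] in \<open>simp_all add: mult.commute\<close>)
  also have "\<dots> = D ^ n * ((\<alpha> \<bullet> w) * (2 * D) - D * (\<alpha> \<bullet> w))"
    by (simp only: sum_subtractf contract trace flip: sum_distrib_left)
  also have "\<dots> = D * (D ^ n * (\<alpha> \<bullet> w))"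
    by (simp add: algebra_simps)
  finally show ?thesis
    using D by simp
qed

text \<open>The number \<open>det2 P (?b T l) (?b S k)\<close> can be contracted in either argument
  by \<open>det2_contract\<close>, and antisymmetry of \<open>det2 P\<close> compares the two
  results.\<close>

lemma det2_change_section:
  fixes P S T :: "'a::idom mat"
  assumes P: "P \<in> carrier_mat n (n + 2)"
    and S: "S \<in> carrier_mat n (n + 2)" "P * S\<^sup>T = D \<cdot>\<^sub>m 1\<^sub>m n" "D \<noteq> 0"
    and T: "T \<in> carrier_mat n (n + 2)" "P * T\<^sup>T = E \<cdot>\<^sub>m 1\<^sub>m n" "E \<noteq> 0"
    and k: "k \<in> carrier_vec (n + 2)" "P *\<^sub>v k = 0\<^sub>v n"
    and l: "l \<in> carrier_vec (n + 2)" "P *\<^sub>v l = 0\<^sub>v n"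
  shows "D ^ n * det2 T k l = E ^ n * det2 S k l"
proof -
  let ?b = "\<lambda>S k. Matrix.vec (n + 2) (\<lambda>j. det2 S k (unit_vec (n + 2) j))"
  have b: "?b S k \<in> carrier_vec (n + 2)" for S k
    by simp
  have dot: "?b S' k' \<bullet> l' = det2 S' k' l'"
    if "S' \<in> carrier_mat n (n + 2)" "l' \<in> carrier_vec (n + 2)" for S' k' and l' :: "'a vec"
    using that by (subst det2_expand_right) (auto simp: scalar_prod_def atLeast0LessThan mult.commute)
  have "D ^ n * det2 T l k = det2 P (?b T l) (?b S k)"
    by (subst det2_contract[OF P S b k]) (simp add: dot T k)
  also have "\<dots> = - det2 P (?b S k) (?b T l)"
    by (rule det2_swap)
  also have "\<dots> = - (E ^ n * det2 S k l)"
    by (subst det2_contract[OF P T b l]) (simp add: dot S l)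
  finally show ?thesis
    by (subst det2_swap) simp
qed


section \<open>Monomials and homogeneous components\<close>

abbreviation mon :: "(3 \<Rightarrow>\<^sub>0 nat) \<Rightarrow> 'k::comm_ring_1 poly3" where
  "mon t \<equiv> Poly_Mapping.single t 1"

lemma poly_mapping_eq_sum_single:
  "p = (\<Sum>m\<in>Poly_Mapping.keys p. Poly_Mapping.single m (Poly_Mapping.lookup p m))"
  by (rule poly_mapping_eqI)
    (auto simp: lookup_sum lookup_single when_def in_keys_iff sum.delta')

lemma lookup_single_mult:
  fixes p :: "'a::cancel_comm_monoid_add \<Rightarrow>\<^sub>0 'k::comm_ring_1"
  shows "Poly_Mapping.lookup (Poly_Mapping.single t c * p) (t + m) = c * Poly_Mapping.lookup p m"
proof -
  have "Poly_Mapping.single t c * p =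
      (\<Sum>l\<in>Poly_Mapping.keys p. Poly_Mapping.single (t + l) (c * Poly_Mapping.lookup p l))"
    by (subst poly_mapping_eq_sum_single[of p]) (simp add: sum_distrib_left mult_single)
  then show ?thesis
    by (auto simp: lookup_sum lookup_single when_def in_keys_iff sum.delta')
qed

lemma keys_mon_mult:
  fixes p :: "'k::comm_ring_1 poly3"
  shows "Poly_Mapping.keys (mon t * p) = (+) t ` Poly_Mapping.keys p"
proof
  show "Poly_Mapping.keys (mon t * p) \<subseteq> (+) t ` Poly_Mapping.keys p"
    using keys_mult[of "mon t" p] by (auto split: if_splits)
  show "(+) t ` Poly_Mapping.keys p \<subseteq> Poly_Mapping.keys (mon t * p)"
    by (auto simp: in_keys_iff lookup_single_mult)
qed

definition restrict_keys :: "'a set \<Rightarrow> ('a \<Rightarrow>\<^sub>0 'k::comm_monoid_add) \<Rightarrow> ('a \<Rightarrow>\<^sub>0 'k)" where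
  "restrict_keys S p =
     (\<Sum>m\<in>Poly_Mapping.keys p \<inter> S. Poly_Mapping.single m (Poly_Mapping.lookup p m))"

lemma lookup_restrict_keys:
  "Poly_Mapping.lookup (restrict_keys S p) m = (if m \<in> S then Poly_Mapping.lookup p m else 0)"
  by (auto simp: restrict_keys_def lookup_sum lookup_single when_def in_keys_iff sum.delta')

lemma keys_restrict_keys: "Poly_Mapping.keys (restrict_keys S p) = Poly_Mapping.keys p \<inter> S"
  by (auto simp: in_keys_iff lookup_restrict_keys split: if_splits)

lemma restrict_keys_add: "restrict_keys S (p + q) = restrict_keys S p + restrict_keys S q"
  by (rule poly_mapping_eqI) (simp add: lookup_restrict_keys lookup_add)

lemma restrict_keys_Compl: "restrict_keys S p + restrict_keys (- S) p = p"
  by (rule poly_mapping_eqI) (simp add: lookup_restrict_keys lookup_add)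

definition hcomp :: "int \<Rightarrow> 'k::comm_monoid_add poly3 \<Rightarrow> 'k poly3" where
  "hcomp d = restrict_keys {m. int (monom_degree m) = d}"

lemma lookup_hcomp:
  "Poly_Mapping.lookup (hcomp d p) m =
     (if int (monom_degree m) = d then Poly_Mapping.lookup p m else 0)"
  by (simp add: hcomp_def lookup_restrict_keys)

lemma hcomp_add: "hcomp d (p + q) = hcomp d p + hcomp d q"
  by (simp add: hcomp_def restrict_keys_add)

lemma hcomp_zero [simp]: "hcomp d 0 = 0"
  by (rule poly_mapping_eqI) (simp add: lookup_hcomp)

lemma hcomp_sum: "hcomp d (sum f A) = (\<Sum>x\<in>A. hcomp d (f x))"
  by (rule poly_mapping_eqI) (simp add: lookup_hcomp lookup_sum)

lemma hcomp_homogeneous: "hcomp d p \<in> homogeneous d"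
  by (auto simp: homogeneous_def hcomp_def keys_restrict_keys)

lemma homogeneous_zero [simp]: "0 \<in> homogeneous d"
  by (simp add: homogeneous_def)

lemma homogeneous_add:
  fixes p :: "'k::comm_ring_1 poly3"
  shows "p \<in> homogeneous d \<Longrightarrow> q \<in> homogeneous d \<Longrightarrow> p + q \<in> homogeneous d"
  using keys_add[of p q] by (auto simp: homogeneous_def)

lemma homogeneous_uminus:
  fixes p :: "'k::comm_ring_1 poly3"
  shows "p \<in> homogeneous d \<Longrightarrow> - p \<in> homogeneous d"
  by (auto simp: homogeneous_def in_keys_iff)

lemma homogeneous_sum:
  fixes f :: "'a \<Rightarrow> 'k::comm_ring_1 poly3"
  shows "(\<And>x. x \<in> A \<Longrightarrow> f x \<in> homogeneous d) \<Longrightarrow> sum f A \<in> homogeneous d"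
  by (induct A rule: infinite_finite_induct) (auto intro: homogeneous_add)

lemma monom_degree_add: "monom_degree (s + t) = monom_degree s + monom_degree t"
  by (simp add: monom_degree_def lookup_add sum.distrib)

lemma homogeneous_mult:
  fixes p :: "'k::comm_ring_1 poly3"
  assumes "p \<in> homogeneous d" "q \<in> homogeneous e"
  shows "p * q \<in> homogeneous (d + e)"
proof -
  have "int (monom_degree m) = d + e" if m: "m \<in> Poly_Mapping.keys (p * q)" for m
  proof -
    obtain s t where "m = s + t" "s \<in> Poly_Mapping.keys p" "t \<in> Poly_Mapping.keys q"
      using keys_mult[of p q] m by blast
    then show ?thesis
      using assms by (simp add: homogeneous_def monom_degree_add)
  qed
  then show ?thesis
    by (simp add: homogeneous_def)
qed

lemma homogeneous_one: "(1 :: 'k::comm_ring_1 poly3) \<in> homogeneous 0"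
  by (auto simp: homogeneous_def lookup_one when_def in_keys_iff monom_degree_def)

lemma homogeneous_prod:
  fixes f :: "'a \<Rightarrow> 'k::comm_ring_1 poly3"
  assumes "finite A" "\<And>x. x \<in> A \<Longrightarrow> f x \<in> homogeneous (d x)"
  shows "prod f A \<in> homogeneous (sum d A)"
  using assms by (induct rule: finite_induct) (auto intro: homogeneous_mult homogeneous_one)

lemma homogeneous_mon: "mon t \<in> homogeneous (int (monom_degree t))"
  by (simp add: homogeneous_def)

lemma homogeneous_Const: "Const c \<in> homogeneous 0"
  by (simp add: homogeneous_def Const_def monom_degree_def)

lemma hcomp_of_homogeneous: "p \<in> homogeneous e \<Longrightarrow> hcomp d p = (if d = e then p else 0)"
  by (rule poly_mapping_eqI) (auto simp: homogeneous_def lookup_hcomp in_keys_iff)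

definition degrees :: "'k::zero poly3 \<Rightarrow> int set" where
  "degrees p = (\<lambda>m. int (monom_degree m)) ` Poly_Mapping.keys p"

lemma finite_degrees [simp]: "finite (degrees p)"
  by (simp add: degrees_def)

lemma hcomp_eq_0_iff: "hcomp d p = 0 \<longleftrightarrow> d \<notin> degrees p"
  by (auto simp: degrees_def poly_mapping_eq_iff fun_eq_iff lookup_hcomp in_keys_iff)

lemma sum_hcomp:
  assumes "finite D" "degrees p \<subseteq> D"
  shows "(\<Sum>d\<in>D. hcomp d p) = p"
proof (rule poly_mapping_eqI)
  fix m
  have "Poly_Mapping.lookup p m = 0" if "int (monom_degree m) \<notin> D"
  proof (rule ccontr)
    assume "Poly_Mapping.lookup p m \<noteq> 0"
    then have "int (monom_degree m) \<in> degrees p"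
      by (simp add: degrees_def in_keys_iff)
    then show False
      using that assms(2) by blast
  qed
  then show "Poly_Mapping.lookup (\<Sum>d\<in>D. hcomp d p) m = Poly_Mapping.lookup p m"
    using assms(1) by (simp add: lookup_sum lookup_hcomp sum.delta')
qed

lemma hcomp_homogeneous_mult:
  fixes p q :: "'k::comm_ring_1 poly3"
  assumes "p \<in> homogeneous e"
  shows "hcomp d (p * q) = p * hcomp (d - e) q"
proof -
  let ?D = "insert (d - e) (degrees q)"
  have "p * q = (\<Sum>c\<in>?D. p * hcomp c q)"
    by (subst sum_hcomp[of ?D q, symmetric]) (auto simp: sum_distrib_left)
  also have "hcomp d \<dots> = (\<Sum>c\<in>?D. if c = d - e then p * hcomp c q else 0)"
    unfolding hcomp_sum
  proof (rule sum.cong[OF refl])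
    fix c
    have "p * hcomp c q \<in> homogeneous (e + c)"
      by (intro homogeneous_mult assms hcomp_homogeneous)
    then show "hcomp d (p * hcomp c q) = (if c = d - e then p * hcomp c q else 0)"
      by (simp add: hcomp_of_homogeneous)
  qed
  also have "\<dots> = p * hcomp (d - e) q"
    by (simp add: sum.delta')
  finally show ?thesis .
qed

lemma hcomp_mult:
  fixes p q :: "'k::comm_ring_1 poly3"
  assumes "finite D" "degrees p \<subseteq> D"
  shows "hcomp d (p * q) = (\<Sum>e\<in>D. hcomp e p * hcomp (d - e) q)"
proof -
  have "p * q = (\<Sum>e\<in>D. hcomp e p * q)"
    by (subst sum_hcomp[OF assms, symmetric]) (simp add: sum_distrib_right)
  then show ?thesis
    by (simp add: hcomp_sum hcomp_homogeneous_mult[OF hcomp_homogeneous])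
qed


section \<open>Monomial ideals\<close>

text \<open>This is an ideal only if \<open>S\<close> is closed under adding exponent vectors, which
  \<open>mono_ideal_mult\<close> asks for. Membership is thereby a question about exponents
  alone.\<close>

definition mono_ideal :: "(3 \<Rightarrow>\<^sub>0 nat) set \<Rightarrow> 'k::zero poly3 set" where
  "mono_ideal S = {p. Poly_Mapping.keys p \<subseteq> S}"

lemma mono_ideal_zero [simp]: "0 \<in> mono_ideal S"
  by (simp add: mono_ideal_def)

lemma mono_ideal_add:
  fixes p :: "'k::comm_ring_1 poly3"
  shows "p \<in> mono_ideal S \<Longrightarrow> q \<in> mono_ideal S \<Longrightarrow> p + q \<in> mono_ideal S"
  using keys_add[of p q] by (auto simp: mono_ideal_def)

lemma mono_ideal_uminus:
  fixes p :: "'k::comm_ring_1 poly3"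
  shows "p \<in> mono_ideal S \<Longrightarrow> - p \<in> mono_ideal S"
  by (auto simp: mono_ideal_def in_keys_iff)

lemma mono_ideal_diff:
  fixes p :: "'k::comm_ring_1 poly3"
  shows "p \<in> mono_ideal S \<Longrightarrow> q \<in> mono_ideal S \<Longrightarrow> p - q \<in> mono_ideal S"
  using mono_ideal_add[of p S "- q"] mono_ideal_uminus[of q S] by simp

lemma mon_mult_mono_ideal_iff:
  fixes p :: "'k::comm_ring_1 poly3"
  shows "mon t * p \<in> mono_ideal S \<longleftrightarrow> p \<in> mono_ideal {m. t + m \<in> S}"
  by (auto simp: mono_ideal_def keys_mon_mult)

lemma mono_ideal_mult:
  fixes p :: "'k::comm_ring_1 poly3"
  assumes "\<And>t m. m \<in> S \<Longrightarrow> t + m \<in> S" "p \<in> mono_ideal S"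
  shows "q * p \<in> mono_ideal S"
proof -
  have "m \<in> S" if "m \<in> Poly_Mapping.keys (q * p)" for m
    using keys_mult[of q p] that assms by (auto simp: mono_ideal_def)
  then show ?thesis
    by (auto simp: mono_ideal_def)
qed

lemma mono_ideal_sum:
  fixes f :: "'a \<Rightarrow> 'k::comm_ring_1 poly3"
  shows "(\<And>x. x \<in> A \<Longrightarrow> f x \<in> mono_ideal S) \<Longrightarrow> sum f A \<in> mono_ideal S"
  by (induct A rule: infinite_finite_induct) (auto intro: mono_ideal_add)

lemma mon_dvd_if_mono_ideal:
  fixes p :: "'k::comm_ring_1 poly3"
  assumes "p \<in> mono_ideal (range ((+) t))"
  shows "mon t dvd p"
proof -
  have "mon t dvd Poly_Mapping.single m (Poly_Mapping.lookup p m)"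
    if m: "m \<in> Poly_Mapping.keys p" for m
  proof -
    obtain s where "m = t + s"
      using assms m by (auto simp: mono_ideal_def)
    then have "Poly_Mapping.single m (Poly_Mapping.lookup p m)
        = mon t * Poly_Mapping.single s (Poly_Mapping.lookup p m)"
      by (simp add: mult_single)
    then show ?thesis
      by simp
  qed
  then have "mon t dvd (\<Sum>m\<in>Poly_Mapping.keys p. Poly_Mapping.single m (Poly_Mapping.lookup p m))"
    by (rule dvd_sum)
  then show ?thesis
    by (simp flip: poly_mapping_eq_sum_single)
qed

lemma mono_ideal_Un:
  fixes p :: "'k::comm_ring_1 poly3"
  assumes "p \<in> mono_ideal (S \<union> T)"
  obtains q r where "q \<in> mono_ideal S" "r \<in> mono_ideal T" "p = q + r"
proof
  show "restrict_keys S p \<in> mono_ideal S" "restrict_keys (- S) p \<in> mono_ideal T"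
    using assms by (auto simp: mono_ideal_def keys_restrict_keys)
qed (simp add: restrict_keys_Compl)

lemma range_add_conv:
  fixes t :: "'a \<Rightarrow>\<^sub>0 nat"
  shows "range ((+) t) = {m. \<forall>i. Poly_Mapping.lookup t i \<le> Poly_Mapping.lookup m i}"
proof -
  have "m \<in> range ((+) t)" if "\<forall>i. Poly_Mapping.lookup t i \<le> Poly_Mapping.lookup m i" for m
  proof
    show "m = t + (m - t)"
      using that by (intro poly_mapping_eqI) (simp add: lookup_add lookup_minus)
  qed simp
  then show ?thesis
    by (auto simp: lookup_add)
qed

section \<open>Ideals generated by powers of the variables\<close>

definition xyz :: "nat \<Rightarrow> nat \<Rightarrow> nat \<Rightarrow> 'k::comm_ring_1 poly3" where
  "xyz i j k = mon (Poly_Mapping.single 0 i + Poly_Mapping.single 1 j + Poly_Mapping.single 2 k)"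

lemma UNIV_3_eq: "(UNIV :: 3 set) = {0, 1, 2}"
  by (rule card_subset_eq[symmetric]) simp_all

lemma xyz_mult: "xyz i j k * xyz i' j' k' = xyz (i + i') (j + j') (k + k')"
  by (simp add: xyz_def mult_single single_add ac_simps)

lemma xyz_mult_left: "xyz i j k * (xyz i' j' k' * p) = xyz (i + i') (j + j') (k + k') * p"
  by (simp add: xyz_mult flip: mult.assoc)

lemma xyz_zero: "xyz 0 0 0 = 1"
  by (simp add: xyz_def)

lemma xyz_power: "xyz i j k ^ l = xyz (l * i) (l * j) (l * k)"
  by (induct l) (simp_all add: xyz_zero xyz_mult)

lemma xyz_nonzero [simp]: "xyz i j k \<noteq> 0"
  unfolding xyz_def by (metis lookup_single_eq lookup_zero zero_neq_one)

lemma monom_degree_xyz: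
  "monom_degree (Poly_Mapping.single 0 i + Poly_Mapping.single 1 j + Poly_Mapping.single 2 k) = i + j + k"
  unfolding monom_degree_def UNIV_3_eq by (simp add: lookup_add lookup_single when_def)

lemma homogeneous_xyz: "xyz i j k \<in> homogeneous (int (i + j + k))"
  by (metis homogeneous_mon monom_degree_xyz xyz_def)

definition ideal_xy :: "nat \<Rightarrow> nat \<Rightarrow> 'k::comm_ring_1 poly3 set" where
  "ideal_xy i j = mono_ideal {m. i \<le> Poly_Mapping.lookup m 0 \<or> j \<le> Poly_Mapping.lookup m 1}"

definition ideal_xyz :: "nat \<Rightarrow> nat \<Rightarrow> nat \<Rightarrow> 'k::comm_ring_1 poly3 set" where
  "ideal_xyz i j k = mono_ideal
     {m. i \<le> Poly_Mapping.lookup m 0 \<or> j \<le> Poly_Mapping.lookup m 1 \<or> k \<le> Poly_Mapping.lookup m 2}"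

text \<open>This is the colon ideal by a monomial. Truncated subtraction yields exponent 0, hence
  the unit ideal, as soon as the monomial itself lies in the ideal; most memberships below end in
  this way through \<open>ideal_trivial\<close>.\<close>

lemma xyz_mult_mem_ideal_xy:
  "xyz i' j' k' * p \<in> ideal_xy i j \<longleftrightarrow> p \<in> ideal_xy (i - i') (j - j')"
  by (simp add: ideal_xy_def xyz_def mon_mult_mono_ideal_iff lookup_add lookup_single when_def
      le_diff_conv add.commute)

lemma xyz_mult_mem_ideal_xyz:
  "xyz i' j' k' * p \<in> ideal_xyz i j k \<longleftrightarrow> p \<in> ideal_xyz (i - i') (j - j') (k - k')"
  by (simp add: ideal_xyz_def xyz_def mon_mult_mono_ideal_iff lookup_add lookup_single when_def
      le_diff_conv add.commute)

lemma ideal_trivial [simp]: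
  "p \<in> ideal_xy 0 j" "p \<in> ideal_xy i 0"
  "p \<in> ideal_xyz 0 j k" "p \<in> ideal_xyz i 0 k" "p \<in> ideal_xyz i j 0"
  by (simp_all add: ideal_xy_def ideal_xyz_def mono_ideal_def)

lemma ideal_xy_add: "p \<in> ideal_xy i j \<Longrightarrow> q \<in> ideal_xy i j \<Longrightarrow> p + q \<in> ideal_xy i j"
  by (simp add: ideal_xy_def mono_ideal_add)

lemma ideal_xyz_add: "p \<in> ideal_xyz i j k \<Longrightarrow> q \<in> ideal_xyz i j k \<Longrightarrow> p + q \<in> ideal_xyz i j k"
  by (simp add: ideal_xyz_def mono_ideal_add)

lemma ideal_xyz_diff: "p \<in> ideal_xyz i j k \<Longrightarrow> q \<in> ideal_xyz i j k \<Longrightarrow> p - q \<in> ideal_xyz i j k"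
  by (simp add: ideal_xyz_def mono_ideal_diff)

lemma ideal_xy_mult: "p \<in> ideal_xy i j \<Longrightarrow> q * p \<in> ideal_xy i j"
  unfolding ideal_xy_def by (rule mono_ideal_mult) (auto simp: lookup_add)

lemma ideal_xyz_mult: "p \<in> ideal_xyz i j k \<Longrightarrow> q * p \<in> ideal_xyz i j k"
  unfolding ideal_xyz_def by (rule mono_ideal_mult) (auto simp: lookup_add)

lemma ideal_xy_sum: "(\<And>x. x \<in> A \<Longrightarrow> f x \<in> ideal_xy i j) \<Longrightarrow> sum f A \<in> ideal_xy i j"
  by (simp add: ideal_xy_def mono_ideal_sum)

lemma ideal_xyz_sum: "(\<And>x. x \<in> A \<Longrightarrow> f x \<in> ideal_xyz i j k) \<Longrightarrow> sum f A \<in> ideal_xyz i j k"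
  by (simp add: ideal_xyz_def mono_ideal_sum)

lemma range_add_single:
  fixes j :: nat
  shows   "range ((+) (Poly_Mapping.single i j)) = {m. j \<le> Poly_Mapping.lookup m i}"
proof -
  have "(\<forall>l. Poly_Mapping.lookup (Poly_Mapping.single i j) l \<le> Poly_Mapping.lookup m l)
      \<longleftrightarrow> j \<le> Poly_Mapping.lookup m i" for m
    by (metis le0 lookup_single_eq lookup_single_not_eq)
  then show ?thesis
    by (simp only: range_add_conv)
qed

text \<open>Multiplication by a monomial in y and z leaves the exponents of x unchanged.\<close>

lemma x_power_dvd:
  assumes "xyz 0 j k * p = xyz i 0 0 * q"
  shows "xyz i 0 0 dvd (p :: 'k::comm_ring_1 poly3)"
proof -
  have "xyz 0 j k * p \<in> mono_ideal {m. i \<le> Poly_Mapping.lookup m 0}"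
    unfolding assms
    by (simp add: xyz_def mon_mult_mono_ideal_iff lookup_add lookup_single when_def)
      (simp add: mono_ideal_def)
  then have "p \<in> mono_ideal {m. i \<le> Poly_Mapping.lookup m 0}"
    by (simp add: xyz_def mon_mult_mono_ideal_iff lookup_add lookup_single when_def)
  then show ?thesis
    by (simp add: xyz_def mon_dvd_if_mono_ideal range_add_single)
qed

lemma y_power_dvd:
  assumes "xyz i 0 k * p = xyz 0 j 0 * q"
  shows "xyz 0 j 0 dvd (p :: 'k::comm_ring_1 poly3)"
proof -
  have "xyz i 0 k * p \<in> mono_ideal {m. j \<le> Poly_Mapping.lookup m 1}"
    unfolding assms
    by (simp add: xyz_def mon_mult_mono_ideal_iff lookup_add lookup_single when_def)
      (simp add: mono_ideal_def)
  then have "p \<in> mono_ideal {m. j \<le> Poly_Mapping.lookup m 1}"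
    by (simp add: xyz_def mon_mult_mono_ideal_iff lookup_add lookup_single when_def)
  then show ?thesis
    by (simp add: xyz_def mon_dvd_if_mono_ideal range_add_single)
qed

lemma ideal_xyE:
  fixes p :: "'k::comm_ring_1 poly3"
  assumes "p \<in> ideal_xy i j"
  obtains u v where "p = xyz i 0 0 * u + xyz 0 j 0 * v"
proof -
  obtain q r where q: "q \<in> mono_ideal {m. i \<le> Poly_Mapping.lookup m 0}"
    and r: "r \<in> mono_ideal {m. j \<le> Poly_Mapping.lookup m 1}" and p: "p = q + r"
    using assms mono_ideal_Un[of p "{m. i \<le> Poly_Mapping.lookup m 0}"
        "{m. j \<le> Poly_Mapping.lookup m 1}"]
    unfolding ideal_xy_def Collect_disj_eq by blast
  have "xyz i 0 0 dvd q" "xyz 0 j 0 dvd r"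
    using q r by (simp_all add: xyz_def mon_dvd_if_mono_ideal range_add_single)
  then show ?thesis
    using that p by (auto elim!: dvdE)
qed

lemma ideal_xyzE:
  fixes p :: "'k::comm_ring_1 poly3"
  assumes "p \<in> ideal_xyz i j k"
  obtains r where "p - xyz 0 0 k * r \<in> ideal_xy i j"
proof -
  let ?S = "{m. i \<le> Poly_Mapping.lookup m (0::3) \<or> j \<le> Poly_Mapping.lookup m 1}"
  let ?T = "{m. k \<le> Poly_Mapping.lookup m (2::3)}"
  have "p \<in> mono_ideal (?S \<union> ?T)"
    using assms unfolding ideal_xyz_def mono_ideal_def by blast
  then obtain q r where q: "q \<in> ideal_xy i j" and r: "r \<in> mono_ideal ?T" and p: "p = q + r"
    unfolding ideal_xy_def by (rule mono_ideal_Un)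
  have "xyz 0 0 k dvd r"
    using r by (simp add: xyz_def mon_dvd_if_mono_ideal range_add_single)
  then obtain s where "r = xyz 0 0 k * s"
    by (rule dvdE)
  then show ?thesis
    using that[of s] p q by simp
qed


section \<open>The pairing\<close>

text \<open>A section is stored as the transpose of the map from \<open>G\<close> to
  \<open>F\<close>. It then has the shape of \<open>P\<close>, and its values on the basis are rows
  that can be bordered.\<close>

locale sections =
  fixes n N :: nat and P Sx Sy Sz :: "'k::field poly3 mat"
  assumes P [simp]: "P \<in> carrier_mat n (n + 2)"
    and Sx [simp]: "Sx \<in> carrier_mat n (n + 2)" and Px: "P * Sx\<^sup>T = xyz N 0 0 \<cdot>\<^sub>m 1\<^sub>m n"
    and Sy [simp]: "Sy \<in> carrier_mat n (n + 2)" and Py: "P * Sy\<^sup>T = xyz 0 N 0 \<cdot>\<^sub>m 1\<^sub>m n"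
    and Sz [simp]: "Sz \<in> carrier_mat n (n + 2)" and Pz: "P * Sz\<^sup>T = xyz 0 0 N \<cdot>\<^sub>m 1\<^sub>m n"
begin

abbreviation X :: "'k poly3" where "X \<equiv> xyz N 0 0"
abbreviation Y :: "'k poly3" where "Y \<equiv> xyz 0 N 0"
abbreviation Z :: "'k poly3" where "Z \<equiv> xyz 0 0 N"

definition pairing :: "'k poly3 vec \<Rightarrow> 'k poly3 vec \<Rightarrow> 'k poly3" where
  "pairing g h = det2 Sy (Sx\<^sup>T *\<^sub>v h) (Sz\<^sup>T *\<^sub>v g)"

lemma dims [simp]:
  "dim_row Sx = n" "dim_row Sy = n" "dim_row Sz = n" "dim_row P = n"
  "dim_col Sx = n + 2" "dim_col Sy = n + 2" "dim_col Sz = n + 2" "dim_col P = n + 2"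
  using carrier_matD[OF Sx] carrier_matD[OF Sy] carrier_matD[OF Sz] carrier_matD[OF P] by auto

lemma section_carrier [simp]:
  "Sx\<^sup>T *\<^sub>v g \<in> carrier_vec (n + 2)" "Sy\<^sup>T *\<^sub>v g \<in> carrier_vec (n + 2)" "Sz\<^sup>T *\<^sub>v g \<in> carrier_vec (n + 2)"
  by (rule carrier_vecI, simp)+

lemma P_section:
  assumes "S \<in> carrier_mat n (n + 2)" "P * S\<^sup>T = D \<cdot>\<^sub>m 1\<^sub>m n" "g \<in> carrier_vec n"
  shows "P *\<^sub>v (S\<^sup>T *\<^sub>v g) = D \<cdot>\<^sub>v g"
  using assms assoc_mult_mat_vec[of P n "n + 2" "S\<^sup>T" n g, OF P] by (simp add: smult_one_mat_mult_vec)

lemma P_sections: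
  assumes "g \<in> carrier_vec n"
  shows "P *\<^sub>v (Sx\<^sup>T *\<^sub>v g) = X \<cdot>\<^sub>v g" "P *\<^sub>v (Sy\<^sup>T *\<^sub>v g) = Y \<cdot>\<^sub>v g" "P *\<^sub>v (Sz\<^sup>T *\<^sub>v g) = Z \<cdot>\<^sub>v g"
  using P_section[OF Sx Px] P_section[OF Sy Py] P_section[OF Sz Pz] assms by auto

lemma P_diff:
  assumes "f \<in> carrier_vec (n + 2)" "f' \<in> carrier_vec (n + 2)" "P *\<^sub>v f = v" "P *\<^sub>v f' = v'"
    "c \<cdot>\<^sub>v v = d \<cdot>\<^sub>v v'"
  shows "P *\<^sub>v (c \<cdot>\<^sub>v f - d \<cdot>\<^sub>v f') = 0\<^sub>v n"
proof -
  have "v' \<in> carrier_vec n"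
    using mult_mat_vec_carrier[OF P assms(2)] assms by simp
  then show ?thesis
    using assms by (simp add: mult_minus_distrib_mat_vec[OF P] mult_mat_smult_vec[OF P])
qed

lemma det2_zy:
  assumes "k \<in> carrier_vec (n + 2)" "P *\<^sub>v k = 0\<^sub>v n" "l \<in> carrier_vec (n + 2)" "P *\<^sub>v l = 0\<^sub>v n"
  shows "xyz 0 0 (n * N) * det2 Sy k l = xyz 0 (n * N) 0 * det2 Sz k l"
  using det2_change_section[OF P Sz Pz _ Sy Py _ assms] by (simp add: xyz_power)

lemma det2_xy:
  assumes "k \<in> carrier_vec (n + 2)" "P *\<^sub>v k = 0\<^sub>v n" "l \<in> carrier_vec (n + 2)" "P *\<^sub>v l = 0\<^sub>v n"
  shows "xyz 0 (n * N) 0 * det2 Sx k l = xyz (n * N) 0 0 * det2 Sy k l"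
  using det2_change_section[OF P Sy Py _ Sx Px _ assms] by (simp add: xyz_power)

lemmas det2_bilinear =
  det2_add_left[of _ n] det2_diff_left[of _ n] det2_smult_left[of _ n]
  det2_add_right[of _ n] det2_diff_right[of _ n] det2_smult_right[of _ n]

lemma ker_xz:
  "g \<in> carrier_vec n \<Longrightarrow> P *\<^sub>v (Z \<cdot>\<^sub>v (Sx\<^sup>T *\<^sub>v g) - X \<cdot>\<^sub>v (Sz\<^sup>T *\<^sub>v g)) = 0\<^sub>v n"
  by (rule P_diff[OF _ _ P_sections(1) P_sections(3)]) (auto simp: smult_smult_assoc mult.commute)

lemma ker_xy:
  "g \<in> carrier_vec n \<Longrightarrow> P *\<^sub>v (Y \<cdot>\<^sub>v (Sx\<^sup>T *\<^sub>v g) - X \<cdot>\<^sub>v (Sy\<^sup>T *\<^sub>v g)) = 0\<^sub>v n"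
  by (rule P_diff[OF _ _ P_sections(1) P_sections(2)]) (auto simp: smult_smult_assoc mult.commute)

text \<open>On the kernel, Z^n times the form of \<open>Sy\<close> equals Y^n times that of
  \<open>Sz\<close>, and \<open>Y\<close> and \<open>Z\<close> are coprime.\<close>

lemma det2_kernel_dvd:
  assumes "k \<in> carrier_vec (n + 2)" "P *\<^sub>v k = 0\<^sub>v n" "l \<in> carrier_vec (n + 2)" "P *\<^sub>v l = 0\<^sub>v n"
  obtains t where "det2 Sy k l = xyz 0 (n * N) 0 * t"
  using y_power_dvd[of 0, OF det2_zy[OF assms]] by (auto elim: dvdE)

text \<open>The form of \<open>Sy\<close> at the two kernel vectors \<open>?k h\<close> and
  \<open>?k g\<close> is divisible by Y^n. In its expansion the mixed terms are, up to sign, X Z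
  times the difference of the pairings, and the other terms are multiples of X^2 or Z^2. Cancelling
  X Z from (X^2, Y^n, Z^2) leaves (X, Y^n, Z).\<close>

lemma pairing_sym:
  assumes g: "g \<in> carrier_vec n" and h: "h \<in> carrier_vec n"
  shows "pairing g h - pairing h g \<in> ideal_xyz N (n * N) N"
proof -
  let ?k = "\<lambda>g. Z \<cdot>\<^sub>v (Sx\<^sup>T *\<^sub>v g) - X \<cdot>\<^sub>v (Sz\<^sup>T *\<^sub>v g)"
  obtain t where t: "det2 Sy (?k h) (?k g) = xyz 0 (n * N) 0 * t"
    by (rule det2_kernel_dvd[OF _ ker_xz[OF h] _ ker_xz[OF g]]) auto
  have "pairing h g = - det2 Sy (Sz\<^sup>T *\<^sub>v h) (Sx\<^sup>T *\<^sub>v g)"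
    unfolding pairing_def by (rule det2_swap)
  then have "(X * Z) * (pairing g h - pairing h g) =
      Z * (Z * det2 Sy (Sx\<^sup>T *\<^sub>v h) (Sx\<^sup>T *\<^sub>v g)) + X * (X * det2 Sy (Sz\<^sup>T *\<^sub>v h) (Sz\<^sup>T *\<^sub>v g))
       - det2 Sy (?k h) (?k g)"
    by (simp add: det2_bilinear pairing_def ring_distribs mult_ac)
  also have "\<dots> \<in> ideal_xyz (2 * N) (n * N) (2 * N)"
    unfolding t
    by (intro ideal_xyz_add ideal_xyz_diff) (simp_all add: xyz_mult_mem_ideal_xyz)
  finally show ?thesis
    by (simp add: xyz_mult xyz_mult_mem_ideal_xyz)
qed

text \<open>Modulo \<open>Z\<close> and up to sign, the lift of \<open>P *\<^sub>v w\<close> along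
  \<open>Sz\<close> may be replaced by the kernel vector \<open>k\<close>. After multiplication by
  \<open>Z\<close>, the lift of \<open>h\<close> along \<open>Sx\<close> agrees modulo
  \<open>X\<close> with a kernel vector as well, so \<open>det2_kernel_dvd\<close> applies.\<close>

lemma pairing_image:
  assumes w: "w \<in> carrier_vec (n + 2)" and h: "h \<in> carrier_vec n"
  shows "pairing (P *\<^sub>v w) h \<in> ideal_xyz N (n * N) N"
proof -
  have Pw: "P *\<^sub>v w \<in> carrier_vec n"
    using P w by (rule mult_mat_vec_carrier)
  define k where "k = Z \<cdot>\<^sub>v w - Sz\<^sup>T *\<^sub>v (P *\<^sub>v w)"
  have k: "k \<in> carrier_vec (n + 2)"
    using w by (simp add: k_def)
  have Pk: "P *\<^sub>v k = 0\<^sub>v n"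
    unfolding k_def using P_diff[of w "Sz\<^sup>T *\<^sub>v (P *\<^sub>v w)" _ _ Z 1] w Pw P_sections(3)[OF Pw] by simp
  let ?l = "Z \<cdot>\<^sub>v (Sx\<^sup>T *\<^sub>v h) - X \<cdot>\<^sub>v (Sz\<^sup>T *\<^sub>v h)"
  obtain t where t: "det2 Sy ?l k = xyz 0 (n * N) 0 * t"
    by (rule det2_kernel_dvd[OF _ ker_xz[OF h] k Pk]) auto
  have "Z * det2 Sy (Sx\<^sup>T *\<^sub>v h) k = X * det2 Sy (Sz\<^sup>T *\<^sub>v h) k + det2 Sy ?l k"
    using k by (simp add: det2_bilinear)
  also have "\<dots> \<in> ideal_xyz N (n * N) (2 * N)"
    unfolding t by (intro ideal_xyz_add) (simp_all add: xyz_mult_mem_ideal_xyz)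
  finally have "det2 Sy (Sx\<^sup>T *\<^sub>v h) k \<in> ideal_xyz N (n * N) N"
    by (simp add: xyz_mult_mem_ideal_xyz)
  moreover have "pairing (P *\<^sub>v w) h = Z * det2 Sy (Sx\<^sup>T *\<^sub>v h) w - det2 Sy (Sx\<^sup>T *\<^sub>v h) k"
    using w by (simp add: k_def det2_bilinear pairing_def)
  ultimately show ?thesis
    by (auto intro!: ideal_xyz_diff simp: xyz_mult_mem_ideal_xyz)
qed

lemma pairing_smult_right:
  "h \<in> carrier_vec n \<Longrightarrow> pairing g (c \<cdot>\<^sub>v h) = c * pairing g h"
  unfolding pairing_def
  by (subst mult_mat_smult_vec[of _ "n + 2" n]) (auto simp: det2_bilinear)

lemma pairing_add_left:
  "g \<in> carrier_vec n \<Longrightarrow> g' \<in> carrier_vec n \<Longrightarrow> pairing (g + g') h = pairing g h + pairing g' h"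
  unfolding pairing_def
  by (subst mult_add_distrib_mat_vec[of _ "n + 2" n]) (auto simp: det2_bilinear)

lemma pairing_smult_left:
  "g \<in> carrier_vec n \<Longrightarrow> pairing (c \<cdot>\<^sub>v g) h = c * pairing g h"
  unfolding pairing_def
  by (subst mult_mat_smult_vec[of _ "n + 2" n]) (auto simp: det2_bilinear)

lemma pairing_expand_right:
  assumes h: "h \<in> carrier_vec n"
  shows "pairing g h = (\<Sum>i<n. h $ i * pairing g (unit_vec n i))"
proof -
  have "pairing g h = det2 Sy (Matrix.vec (n + 2) (\<lambda>j. \<Sum>i<n. h $ i * Sx $$ (i, j))) (Sz\<^sup>T *\<^sub>v g)"
    unfolding pairing_def
    by (rule arg_cong[where f = "\<lambda>f. det2 Sy f _"], rule eq_vecI)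
      (use h in \<open>auto simp: scalar_prod_def atLeast0LessThan mult.commute\<close>)
  also have "\<dots> = (\<Sum>i<n. h $ i * (\<Sum>j<n + 2. Sx $$ (i, j) * det2 Sy (unit_vec (n + 2) j) (Sz\<^sup>T *\<^sub>v g)))"
    by (subst det2_expand_left)
      (simp add: sum_distrib_left sum_distrib_right mult.assoc sum.swap[of _ "{..<n}"])
  also have "\<dots> = (\<Sum>i<n. h $ i * pairing g (unit_vec n i))"
    unfolding pairing_def
    by (rule sum.cong[OF refl], subst (2) det2_expand_left) (simp add: mult_mat_vec_def)
  finally show ?thesis .
qed

text \<open>Lifting \<open>g\<close> along \<open>P\<close> amounts to correcting the local lift \<open>Sx\<^sup>T g / X\<close> by an element of the
  image of the bordered determinants of \<open>P\<close>, so that it agrees with \<open>Sy\<^sup>T g / Y\<close>.\<close>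

lemma pairing_nondegenerate:
  assumes g: "g \<in> carrier_vec n"
    and zero: "\<And>h. h \<in> carrier_vec n \<Longrightarrow> pairing g h \<in> ideal_xyz N (n * N) N"
  obtains w where "w \<in> carrier_vec (n + 2)" "g = P *\<^sub>v w"
proof -
  let ?sx = "Sx\<^sup>T *\<^sub>v g" and ?sy = "Sy\<^sup>T *\<^sub>v g" and ?sz = "Sz\<^sup>T *\<^sub>v g"
  let ?e = "unit_vec (n + 2)"
  have "\<exists>r. pairing g (unit_vec n i) - Z * r \<in> ideal_xy N (n * N)" for i
    by (rule ideal_xyzE[OF zero[of "unit_vec n i"]]) auto
  then obtain \<rho> where \<rho>: "pairing g (unit_vec n i) - Z * \<rho> i \<in> ideal_xy N (n * N)" for i
    by metis
  \<comment> \<open>The quotients by \<open>Z\<close> are chosen on the basis only and extended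
    linearly, so that \<open>r\<close> is a linear functional on \<open>G\<close> and
    \<open>r (P *\<^sub>v f)\<close> is the scalar product of \<open>f\<close> with a combination of
    rows of \<open>P\<close>.\<close>
  define r where "r h = (\<Sum>i<n. h $ i * \<rho> i)" for h
  have r: "pairing g h - Z * r h \<in> ideal_xy N (n * N)" if "h \<in> carrier_vec n" for h
  proof -
    have "pairing g h - Z * r h = (\<Sum>i<n. h $ i * (pairing g (unit_vec n i) - Z * \<rho> i))"
      using that
      by (simp add: pairing_expand_right[of h] r_def right_diff_distrib sum_subtractf sum_distrib_left mult_ac)
    then show ?thesis
      using \<rho> by (simp add: ideal_xy_sum ideal_xy_mult)
  qed
  \<comment> \<open>The difference of the local lifts over x and y with its denominator X Y
    cleared.\<close>
  define \<kappa> where "\<kappa> = Y \<cdot>\<^sub>v ?sx - X \<cdot>\<^sub>v ?sy"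
  have \<kappa>: "\<kappa> \<in> carrier_vec (n + 2)" and P\<kappa>: "P *\<^sub>v \<kappa> = 0\<^sub>v n"
    unfolding \<kappa>_def using ker_xy[OF g] by auto
  \<comment> \<open>Divided by X^(n+1) Y^(n+1), the first term is a preimage of the difference of
    the lifts under the middle map. The second term changes it by a combination of rows of
    \<open>P\<close>, which the middle map kills. The membership below says that the corrected
    preimage is a sum of a part over x and a part over y.\<close>
  define A where "A f = xyz 0 (n * N) 0 * det2 Sx \<kappa> f - xyz (n * N) N 0 * r (P *\<^sub>v f)" for f
  have "A f \<in> ideal_xy (n * N + N) (n * N + N)" if f: "f \<in> carrier_vec (n + 2)" for f
  proof -
    have Pf: "P *\<^sub>v f \<in> carrier_vec n"
      using P f by (rule mult_mat_vec_carrier)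
    define k where "k = X \<cdot>\<^sub>v f - Sx\<^sup>T *\<^sub>v (P *\<^sub>v f)"
    have k: "k \<in> carrier_vec (n + 2)"
      using f by (simp add: k_def)
    have Pk: "P *\<^sub>v k = 0\<^sub>v n"
      unfolding k_def using P_diff[of f "Sx\<^sup>T *\<^sub>v (P *\<^sub>v f)" _ _ X 1] f Pf P_sections(1)[OF Pf] by simp
    let ?\<mu> = "Z \<cdot>\<^sub>v ?sx - X \<cdot>\<^sub>v ?sz"
    have zy: "xyz 0 0 (n * N) * det2 Sy ?\<mu> k = xyz 0 (n * N) 0 * det2 Sz ?\<mu> k"
      by (rule det2_zy[OF _ ker_xz[OF g] k Pk]) auto
    have xy: "xyz 0 (n * N) 0 * det2 Sx \<kappa> k = xyz (n * N) 0 0 * det2 Sy \<kappa> k"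
      by (rule det2_xy[OF \<kappa> P\<kappa> k Pk])
    \<comment> \<open>Z \<open>\<kappa>\<close> equals Y \<open>?\<mu>\<close> + X Y
      \<open>?sz\<close> up to a multiple of \<open>?sy\<close>, and \<open>?sy\<close> is a
      combination of rows of \<open>Sy\<close>.\<close>
    have "Z * det2 Sy \<kappa> k = Y * det2 Sy ?\<mu> k + X * (Y * det2 Sy ?sz k)"
      using k g by (simp add: \<kappa>_def det2_bilinear det2_rows_left[of Sy n] ring_distribs mult_ac)
    also have "det2 Sy ?sz k = X * det2 Sy ?sz f + pairing g (P *\<^sub>v f)"
      using f unfolding pairing_def
      by (subst (3) det2_swap) (simp add: k_def det2_bilinear)
    finally have *: "Z * det2 Sy \<kappa> k =
        Y * det2 Sy ?\<mu> k + X * (Y * (X * det2 Sy ?sz f + pairing g (P *\<^sub>v f)))" .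
    have **: "X * det2 Sx \<kappa> f = det2 Sx \<kappa> k"
      using f Pf by (simp add: k_def det2_bilinear det2_rows[of Sx n])
    \<comment> \<open>The membership is shown for X Z^(n+1) times \<open>A f\<close>, where both
      changes of section have polynomial coefficients. The ideal does not see \<open>Z\<close>, and
      \<open>X\<close> costs \<open>N\<close> in the exponent of x.\<close>
    have "xyz N 0 (n * N + N) * (xyz 0 (n * N) 0 * det2 Sx \<kappa> f) =
        xyz 0 0 (n * N + N) * (xyz 0 (n * N) 0 * (X * det2 Sx \<kappa> f))"
      by (simp add: xyz_mult_left add_ac)
    also have "\<dots> = xyz 0 0 (n * N) * (Z * (xyz (n * N) 0 0 * det2 Sy \<kappa> k))"
      unfolding ** xy by (simp add: xyz_mult flip: mult.assoc)
    also have "\<dots> = xyz (n * N) 0 (n * N) * (Z * det2 Sy \<kappa> k)"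
      by (simp add: xyz_mult_left add_ac)
    also have "\<dots> = xyz (n * N) N 0 * (xyz 0 0 (n * N) * det2 Sy ?\<mu> k)
        + xyz (n * N + N + N) N (n * N) * det2 Sy ?sz f
        + xyz (n * N + N) N (n * N) * pairing g (P *\<^sub>v f)"
      unfolding * by (simp add: ring_distribs xyz_mult xyz_mult_left add_ac)
    finally have "xyz N 0 (n * N + N) * A f = xyz (n * N) (n * N + N) 0 * det2 Sz ?\<mu> k
        + xyz (n * N + N + N) N (n * N) * det2 Sy ?sz f
        + xyz (n * N + N) N (n * N) * (pairing g (P *\<^sub>v f) - Z * r (P *\<^sub>v f))"
      unfolding zy A_def by (simp add: ring_distribs xyz_mult xyz_mult_left add_ac)
    also have "\<dots> \<in> ideal_xy (n * N + N + N) (n * N + N)"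
      using r[OF Pf] by (intro ideal_xy_add) (simp_all add: xyz_mult_mem_ideal_xy)
    finally show ?thesis
      by (simp add: xyz_mult_mem_ideal_xy)
  qed
  then have "\<exists>u v. A (?e j) = xyz (n * N + N) 0 0 * u + xyz 0 (n * N + N) 0 * v" for j
    using unit_vec_carrier ideal_xyE by metis
  then obtain u v where uv: "A (?e j) = xyz (n * N + N) 0 0 * u j + xyz 0 (n * N + N) 0 * v j" for j
    by metis
  define U where "U = Matrix.vec (n + 2) u"
  define V where "V = Matrix.vec (n + 2) v"
  let ?b = "Matrix.vec (n + 2) (\<lambda>j. det2 Sx \<kappa> (?e j))"
  define R where "R = P\<^sup>T *\<^sub>v Matrix.vec n \<rho>"
  have R: "R \<in> carrier_vec (n + 2)"
    unfolding R_def by (rule carrier_vecI) simp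
  have rR: "r (P *\<^sub>v ?e j) = R $ j" if "j < n + 2" for j
    using that
    by (simp add: r_def R_def scalar_prod_def atLeast0LessThan mult.commute if_distrib cong: if_cong)
  have eq: "xyz 0 (n * N) 0 \<cdot>\<^sub>v ?b - xyz (n * N) N 0 \<cdot>\<^sub>v R
      = xyz (n * N + N) 0 0 \<cdot>\<^sub>v U + xyz 0 (n * N + N) 0 \<cdot>\<^sub>v V"
  proof (rule eq_vecI)
    fix j assume "j < dim_vec (xyz (n * N + N) 0 0 \<cdot>\<^sub>v U + xyz 0 (n * N + N) 0 \<cdot>\<^sub>v V)"
    then have "j < n + 2"
      by (simp add: V_def)
    then show "(xyz 0 (n * N) 0 \<cdot>\<^sub>v ?b - xyz (n * N) N 0 \<cdot>\<^sub>v R) $ j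
        = (xyz (n * N + N) 0 0 \<cdot>\<^sub>v U + xyz 0 (n * N + N) 0 \<cdot>\<^sub>v V) $ j"
      using uv[of j] R by (simp add: A_def U_def V_def rR)
  qed (use R in \<open>simp add: V_def\<close>)
  \<comment> \<open>In the splitting of \<open>A\<close>, the part \<open>V\<close> is the one whose
    denominator is X^(n+1) alone; its image under the middle map corrects the local lift over
    x.\<close>
  define \<psi> where "\<psi> = Matrix.vec (n + 2) (\<lambda>j. det2 P (?e j) V)"
  \<comment> \<open>After correction the lifts over x and y agree, so a fraction with denominator
    X^(n+1) equals one with denominator Y^(n+1). It is therefore a polynomial.\<close>
  have "\<exists>w. xyz (n * N) 0 0 * ?sx $ j - \<psi> $ j = xyz (n * N + N) 0 0 * w" if j: "j < n + 2" for j
  proof -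
    have "det2 P (?e j) (xyz 0 (n * N) 0 \<cdot>\<^sub>v ?b - xyz (n * N) N 0 \<cdot>\<^sub>v R) =
        xyz 0 (n * N) 0 * (xyz (n * N) 0 0 * (?e j \<bullet> \<kappa>))"
      using R det2_contract[OF P Sx Px _ unit_vec_carrier \<kappa> P\<kappa>] det2_rows[of P n]
      by (simp add: det2_bilinear xyz_power R_def)
    also have "?e j \<bullet> \<kappa> = Y * ?sx $ j - X * ?sy $ j"
      using j \<kappa> by (simp add: \<kappa>_def)
    finally have "xyz (n * N + N) 0 0 * det2 P (?e j) U + xyz 0 (n * N + N) 0 * \<psi> $ j =
        xyz 0 (n * N) 0 * (xyz (n * N) 0 0 * (Y * ?sx $ j - X * ?sy $ j))"
      unfolding eq using j by (simp add: U_def V_def \<psi>_def det2_bilinear)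
    then have "xyz 0 (n * N + N) 0 * (xyz (n * N) 0 0 * ?sx $ j - \<psi> $ j) =
        xyz (n * N + N) 0 0 * (det2 P (?e j) U + xyz 0 (n * N) 0 * ?sy $ j)"
      by (simp add: ring_distribs xyz_mult_left diff_eq_eq eq_diff_eq add_ac)
    then show ?thesis
      by (intro x_power_dvd[of "n * N + N" 0, unfolded dvd_def])
  qed
  then obtain w' where w': "j < n + 2 \<Longrightarrow> xyz (n * N) 0 0 * ?sx $ j - \<psi> $ j = xyz (n * N + N) 0 0 * w' j" for j
    by metis
  define w where "w = Matrix.vec (n + 2) w'"
  have w: "w \<in> carrier_vec (n + 2)" and \<psi>: "\<psi> \<in> carrier_vec (n + 2)"
    by (simp_all add: w_def \<psi>_def)
  have "P *\<^sub>v \<psi> = 0\<^sub>v n"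
  proof (rule eq_vecI)
    fix i assume "i < dim_vec (0\<^sub>v n :: 'k poly3 vec)"
    then have i: "i < n" by simp
    have "(P *\<^sub>v \<psi>) $ i = (\<Sum>j<n + 2. row P i $ j * det2 P (?e j) V)"
      using i by (simp add: \<psi>_def scalar_prod_def atLeast0LessThan)
    also have "\<dots> = det2 P (row P i) V"
      by (subst (2) det2_expand_left) simp
    also have "\<dots> = 0"
      using i by (subst det2_swap) (simp add: det2_row[of P n])
    finally show "(P *\<^sub>v \<psi>) $ i = 0\<^sub>v n $ i"
      using i by simp
  qed simp
  moreover have "xyz (n * N) 0 0 \<cdot>\<^sub>v ?sx - \<psi> = xyz (n * N + N) 0 0 \<cdot>\<^sub>v w"
    by (rule eq_vecI) (use w' in \<open>auto simp: w_def \<psi>_def\<close>)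
  then have "P *\<^sub>v (xyz (n * N) 0 0 \<cdot>\<^sub>v ?sx - \<psi>) = xyz (n * N + N) 0 0 \<cdot>\<^sub>v (P *\<^sub>v w)"
    using w by (simp add: mult_mat_smult_vec[OF P])
  ultimately have "xyz (n * N + N) 0 0 \<cdot>\<^sub>v g = xyz (n * N + N) 0 0 \<cdot>\<^sub>v (P *\<^sub>v w)"
    using g \<psi> P_sections(1)[OF g]
    by (simp add: mult_minus_distrib_mat_vec[OF P] mult_mat_smult_vec[OF P] smult_smult_assoc xyz_mult)
  then have "g = P *\<^sub>v w"
    using g w by (intro eq_vecI) (auto simp: vec_eq_iff)
  then show ?thesis
    using that w by blast
qed

end


section \<open>The dimension of the polynomial ring\<close>

definition exps_le :: "nat \<Rightarrow> 'k::zero poly3 \<Rightarrow> bool" where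
  "exps_le L p \<longleftrightarrow> (\<forall>t\<in>Poly_Mapping.keys p. \<forall>i. Poly_Mapping.lookup t i \<le> L)"

lemma exps_le_mono: "exps_le L p \<Longrightarrow> L \<le> L' \<Longrightarrow> exps_le L' p"
  unfolding exps_le_def by (meson order_trans)

lemma exps_le_mult:
  fixes p q :: "'k::comm_ring_1 poly3"
  assumes "exps_le L p" "exps_le L' q"
  shows "exps_le (L + L') (p * q)"
  unfolding exps_le_def
proof (intro ballI allI)
  fix t i assume "t \<in> Poly_Mapping.keys (p * q)"
  then obtain r s where "t = r + s" "r \<in> Poly_Mapping.keys p" "s \<in> Poly_Mapping.keys q"
    using keys_mult[of p q] by blast
  then show "Poly_Mapping.lookup t i \<le> L + L'"
    using assms by (simp add: exps_le_def lookup_add add_mono)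
qed

lemma exps_le_one: "exps_le 0 (1 :: 'k::comm_ring_1 poly3)"
  by (simp add: exps_le_def)

lemma exps_le_power: "exps_le L p \<Longrightarrow> exps_le (k * L) ((p :: 'k::comm_ring_1 poly3) ^ k)"
  by (induct k) (auto intro: exps_le_mult exps_le_one)

lemma exps_le_prod:
  fixes f :: "'a \<Rightarrow> 'k::comm_ring_1 poly3"
  assumes "finite A" "\<And>x. x \<in> A \<Longrightarrow> exps_le (L x) (f x)"
  shows "exps_le (sum L A) (prod f A)"
  using assms by (induct rule: finite_induct) (auto intro: exps_le_mult exps_le_one)

lemma ex_exps_le: "\<exists>L. exps_le L (p :: 'k::zero poly3)"
proof -
  let ?A = "(\<lambda>(t, i). Poly_Mapping.lookup t i) ` (Poly_Mapping.keys p \<times> (UNIV :: 3 set))"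
  have "finite ?A"
    by simp
  then have "exps_le (Max ?A) p"
    by (auto simp: exps_le_def intro!: Max_ge)
  then show ?thesis ..
qed

lemma exponents_le:
  fixes L :: nat
  defines "B \<equiv> {t :: 3 \<Rightarrow>\<^sub>0 nat. \<forall>i. Poly_Mapping.lookup t i \<le> L}"
  shows "finite B" "card B \<le> (L + 1) ^ 3"
proof -
  let ?g = "\<lambda>(i, j, k). Poly_Mapping.single 0 i + Poly_Mapping.single 1 j + Poly_Mapping.single 2 k :: 3 \<Rightarrow>\<^sub>0 nat"
  have sub: "B \<subseteq> ?g ` ({..L} \<times> {..L} \<times> {..L})"
  proof
    fix t assume t: "t \<in> B"
    have "Poly_Mapping.lookup t i = Poly_Mapping.lookup
        (?g (Poly_Mapping.lookup t 0, Poly_Mapping.lookup t 1, Poly_Mapping.lookup t 2)) i" for i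
    proof -
      have "i \<in> {0, 1, 2}"
        unfolding UNIV_3_eq[symmetric] by simp
      then show ?thesis
        by (auto simp: lookup_add lookup_single_not_eq)
    qed
    then have "t = ?g (Poly_Mapping.lookup t 0, Poly_Mapping.lookup t 1, Poly_Mapping.lookup t 2)"
      by (rule poly_mapping_eqI)
    then show "t \<in> ?g ` ({..L} \<times> {..L} \<times> {..L})"
      by (rule image_eqI) (use t in \<open>simp add: B_def\<close>)
  qed
  then show "finite B"
    by (rule finite_subset) simp
  have "card B \<le> card (?g ` ({..L} \<times> {..L} \<times> {..L}))"
    using sub by (rule card_mono[rotated]) simp
  also have "\<dots> \<le> card ({..L} \<times> {..L} \<times> {..L})"
    by (rule card_image_le) simp
  also have "\<dots> = (L + 1) ^ 3"
    by (simp add: card_cartesian_product power3_eq_cube)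
  finally show "card B \<le> (L + 1) ^ 3" .
qed

lemma Const_mult: "Const (c * d) = Const c * (Const d :: 'k::comm_ring_1 poly3)"
  by (simp add: Const_def mult_single)

lemma Const_add: "Const (c + d) = Const c + (Const d :: 'k::comm_ring_1 poly3)"
  by (simp add: Const_def single_add)

lemma Const_1 [simp]: "Const 1 = 1"
  by (simp add: Const_def)

lemma Const_0 [simp]: "Const 0 = 0"
  by (simp add: Const_def)

lemma Const_mult_mon: "Const c * mon t = Poly_Mapping.single t (c :: 'k::comm_ring_1)"
  by (simp add: Const_def mult_single)

lemma vector_space_poly3: "vector_space (\<lambda>c (p :: 'k::field poly3). Const c * p)"
  by unfold_locales (simp_all add: Const_mult Const_add algebra_simps)

text \<open>There are \<open>T\<^sup>4\<close> products of powers below \<open>T\<close>, and they lie in a space of dimension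
  \<open>O(T\<^sup>3)\<close>.\<close>

lemma four_algebraically_dependent:
  fixes f :: "nat \<Rightarrow> 'k::field poly3"
  obtains S c where "finite S" "S \<noteq> {}" "S \<subseteq> {e :: nat \<Rightarrow> nat. \<forall>i\<ge>4. e i = 0}" "\<And>e. e \<in> S \<Longrightarrow> c e \<noteq> 0"
    "(\<Sum>e\<in>S. Const (c e) * (\<Prod>i<4. f i ^ e i)) = 0"
proof -
  interpret V: vector_space "\<lambda>c (p :: 'k poly3). Const c * p"
    by (rule vector_space_poly3)
  have "\<exists>L. \<forall>i<4. exps_le L (f i)"
  proof -
    have "\<forall>i. \<exists>L. exps_le L (f i)"
      using ex_exps_le by blast
    then obtain l where "exps_le (l i) (f i)" for i
      by metis
    then have "exps_le (sum l {..<4}) (f i)" if "i < 4" for i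
      using that by (intro exps_le_mono[OF _ member_le_sum]) auto
    then show ?thesis by blast
  qed
  then obtain d where d: "\<And>i. i < 4 \<Longrightarrow> exps_le d (f i)"
    by blast
  \<comment> \<open>\<open>T\<close> exceeds (4 d + 1)^3, and L + 1 is at most (4 d + 1) T for the
    bound \<open>L\<close> below. Hence (L + 1)^3 < T^4.\<close>
  define T where "T = (4 * d + 1) ^ 3 + 1"
  \<comment> \<open>Extension by 0 makes exponent families that agree below 4 equal as functions;
    the argument with prime chains relies on this.\<close>
  define ext where "ext g i = (if i < 4 then g i else 0)" for g :: "nat \<Rightarrow> nat" and i :: nat
  define E where "E = ext ` ({..<4} \<rightarrow>\<^sub>E {..<T})"
  have E: "e i < T" if e: "e \<in> E" and i: "i < 4" for e i
  proof -
    obtain g where "g \<in> {..<4} \<rightarrow>\<^sub>E {..<T}" "e = ext g"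
      using e unfolding E_def by blast
    then show ?thesis
      using i PiE_mem[of g "{..<4}" "\<lambda>_. {..<T}" i] unfolding ext_def by simp
  qed
  have E0: "E \<subseteq> {e. \<forall>i\<ge>4. e i = 0}"
    unfolding E_def ext_def by (intro image_subsetI CollectI allI impI) simp
  define m where "m e = (\<Prod>i<4. f i ^ e i)" for e :: "nat \<Rightarrow> nat"
  define L where "L = 4 * (T * d)"
  define B where "B = (mon :: _ \<Rightarrow> 'k poly3) ` {t. \<forall>i. Poly_Mapping.lookup t i \<le> L}"
  have "inj_on ext ({..<4} \<rightarrow>\<^sub>E {..<T})"
  proof (rule inj_onI)
    fix g h assume gh: "g \<in> {..<4} \<rightarrow>\<^sub>E {..<T}" "h \<in> {..<4} \<rightarrow>\<^sub>E {..<T}" "ext g = ext h"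
    show "g = h"
    proof (rule PiE_ext[OF gh(1,2)])
      fix i assume "i \<in> {..<4::nat}"
      then show "g i = h i"
        using fun_cong[OF gh(3), of i] by (simp add: ext_def)
    qed
  qed
  then have cardE: "card E = T ^ 4" and finE: "finite E"
    by (simp_all add: E_def card_image card_PiE finite_PiE)
  have finB: "finite B"
    unfolding B_def by (intro finite_imageI exponents_le)
  have "card B \<le> (L + 1) ^ 3"
    unfolding B_def by (rule order_trans[OF card_image_le[OF exponents_le(1)] exponents_le(2)])
  also have "\<dots> \<le> ((4 * d + 1) * T) ^ 3"
    by (rule power_mono) (auto simp: L_def T_def algebra_simps)
  also have "\<dots> = (4 * d + 1) ^ 3 * T ^ 3"
    by (rule power_mult_distrib)
  also have "\<dots> < T * T ^ 3"
    by (rule mult_strict_right_mono) (simp_all add: T_def)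
  also have "\<dots> = T ^ 4"
    by (simp add: power_Suc[symmetric] del: power_Suc)
  finally have card: "card B < card E"
    by (simp add: cardE)
  have "m e \<in> V.span B" if "e \<in> E" for e
  proof -
    have "exps_le (\<Sum>i<4. e i * d) (m e)"
      unfolding m_def by (rule exps_le_prod) (auto intro: exps_le_power d)
    moreover have "(\<Sum>i<4. e i * d) \<le> (\<Sum>i<4::nat. T * d)"
      using that by (intro sum_mono mult_right_mono) (auto simp: less_imp_le E)
    ultimately have bound: "exps_le L (m e)"
      by (auto simp: L_def intro: exps_le_mono)
    have "(\<Sum>t\<in>Poly_Mapping.keys (m e). Const (Poly_Mapping.lookup (m e) t) * mon t) \<in> V.span B"
      by (intro V.span_sum V.span_scale V.span_base) (use bound in \<open>auto simp: B_def exps_le_def\<close>)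
    then show ?thesis
      by (simp add: Const_mult_mon flip: poly_mapping_eq_sum_single)
  qed
  then have span: "m ` E \<subseteq> V.span B"
    by auto
  show ?thesis
  \<comment> \<open>Linear dependence of the image set does not register coincidences among the
    products, but a coincidence is itself a relation.\<close>
  proof (cases "inj_on m E")
    case False
    then obtain e e' where "e \<in> E" "e' \<in> E" "e \<noteq> e'" "m e = m e'"
      by (auto simp: inj_on_def)
    then show ?thesis
      using that[of "{e, e'}" "\<lambda>x. if x = e then 1 else - 1"]
      using subsetD[OF E0, of e] subsetD[OF E0, of e']
      by (auto simp: m_def Const_def single_uminus)
  next
    case True
    have "V.dependent (m ` E)"
    proof (rule ccontr)
      assume "\<not> V.dependent (m ` E)"
      then have "card (m ` E) \<le> card B"
        using V.independent_span_bound[OF finB _ span] by blast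
      then show False
        using card by (simp add: card_image True)
    qed
    then obtain u v where u: "(\<Sum>p\<in>m ` E. Const (u p) * p) = 0" and v: "v \<in> m ` E" "u v \<noteq> 0"
      using V.dependent_finite[of "m ` E"] finE by auto
    let ?S = "{e \<in> E. u (m e) \<noteq> 0}"
    have "(\<Sum>e\<in>?S. Const (u (m e)) * m e) = (\<Sum>e\<in>E. Const (u (m e)) * m e)"
      by (rule sum.mono_neutral_left) (use finE in auto)
    also have "\<dots> = 0"
      using u by (simp add: sum.reindex[OF True])
    finally show ?thesis
      using that[of ?S "\<lambda>e. u (m e)"] v finE subset_trans[of ?S E, OF _ E0]
      by (auto simp: m_def)
  qed
qed

section \<open>Ideals and chains of primes\<close>

lemma ideal_class_ringD:
  fixes I :: "'a::comm_ring_1 set"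
  assumes "ideal I class_ring"
  shows "0 \<in> I" "a \<in> I \<Longrightarrow> b \<in> I \<Longrightarrow> a + b \<in> I" "a \<in> I \<Longrightarrow> r * a \<in> I"
    "a \<in> I \<Longrightarrow> b \<in> I \<Longrightarrow> a - b \<in> I"
proof -
  interpret ideal I class_ring by fact
  show "0 \<in> I" using zero_closed by simp
  show add: "a \<in> I \<Longrightarrow> b \<in> I \<Longrightarrow> a + b \<in> I" for a b using a_closed by simp
  show mult: "a \<in> I \<Longrightarrow> r * a \<in> I" for a r using I_l_closed[of a r] by simp
  show "a \<in> I \<Longrightarrow> b \<in> I \<Longrightarrow> a - b \<in> I"
    using add[of a "- b"] mult[of b "- 1"] by simp
qed

lemma ideal_class_ring_sum:
  fixes I :: "'a::comm_ring_1 set"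
  assumes "ideal I class_ring" "\<And>x. x \<in> A \<Longrightarrow> f x \<in> I"
  shows "sum f A \<in> I"
  using assms(2)
  by (induct A rule: infinite_finite_induct) (auto intro: ideal_class_ringD[OF assms(1)])

lemma ideal_class_ringI:
  fixes I :: "'a::comm_ring_1 set"
  assumes "0 \<in> I" "\<And>a b. a \<in> I \<Longrightarrow> b \<in> I \<Longrightarrow> a + b \<in> I" "\<And>a r. a \<in> I \<Longrightarrow> r * a \<in> I"
  shows "ideal I class_ring"
proof (rule idealI)
  show "ring (class_ring :: 'a ring)"
    by (rule class_ring.ring_axioms)
  show "subgroup I (add_monoid (class_ring :: 'a ring))"
  proof (rule group.subgroupI)
    show "Group.group (add_monoid (class_ring :: 'a ring))"
      using abelian_group.a_group[OF ring.is_abelian_group[OF class_ring.ring_axioms]] .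
    fix a assume "a \<in> I"
    then have "- a \<in> I"
      using assms(3)[of a "- 1"] by simp
    moreover have "\<ominus>\<^bsub>class_ring\<^esub> a = - a"
      by (simp add: class_ring_simps)
    ultimately show "inv\<^bsub>add_monoid class_ring\<^esub> a \<in> I"
      by (simp add: a_inv_def)
  qed (use assms in auto)
qed (use assms in \<open>auto simp: mult.commute\<close>)

lemma primeideal_class_ring_iff:
  fixes P :: "'a::comm_ring_1 set"
  shows "primeideal P class_ring \<longleftrightarrow>
    ideal P class_ring \<and> 1 \<notin> P \<and> (\<forall>a b. a * b \<in> P \<longrightarrow> a \<in> P \<or> b \<in> P)"
proof
  assume "primeideal P class_ring"
  then interpret primeideal P "class_ring :: 'a ring" .
  have "1 \<notin> P"
    using I_notcarr one_imp_carrier by auto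
  then show "ideal P class_ring \<and> 1 \<notin> P \<and> (\<forall>a b. a * b \<in> P \<longrightarrow> a \<in> P \<or> b \<in> P)"
    using I_prime ideal_axioms by auto
next
  assume "ideal P class_ring \<and> 1 \<notin> P \<and> (\<forall>a b. a * b \<in> P \<longrightarrow> a \<in> P \<or> b \<in> P)"
  then show "primeideal P class_ring"
    by (intro primeidealI) (auto intro: class_cring.cring_axioms)
qed

text \<open>From an algebraic relation between \<open>f i \<in> C (i + 1) - C i\<close>, successively split off the terms
  that are minimal in the exponent of \<open>f i\<close>; the lexicographically least coefficient ends up
  in \<open>C l\<close>.\<close>

lemma relation_in_prime_chain:
  fixes f :: "nat \<Rightarrow> 'k::field poly3"
  assumes prime: "\<And>i. i \<le> l \<Longrightarrow> primeideal (C i) class_ring"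
    and mono: "\<And>i. i < l \<Longrightarrow> C i \<subseteq> C (Suc i)"
    and f: "\<And>i. i < l \<Longrightarrow> f i \<in> C (Suc i)" "\<And>i. i < l \<Longrightarrow> f i \<notin> C i"
    and S: "finite S" "S \<noteq> {}"
    and rel: "(\<Sum>e\<in>S. Const (c e) * (\<Prod>i<l. f i ^ e i)) \<in> C 0"
  shows "k \<le> l \<Longrightarrow> \<exists>S'\<subseteq>S. S' \<noteq> {} \<and> (\<forall>e\<in>S'. \<forall>e'\<in>S'. \<forall>i<k. e i = e' i) \<and>
    (\<Sum>e\<in>S'. Const (c e) * (\<Prod>i\<in>{k..<l}. f i ^ e i)) \<in> C k"
proof (induct k)
  case 0
  show ?case
    using rel S by (intro exI[of _ S]) (simp add: atLeast0LessThan)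
next
  case (Suc k)
  then obtain S' where S': "S' \<subseteq> S" "S' \<noteq> {}" "\<forall>e\<in>S'. \<forall>e'\<in>S'. \<forall>i<k. e i = e' i"
    and sum: "(\<Sum>e\<in>S'. Const (c e) * (\<Prod>i\<in>{k..<l}. f i ^ e i)) \<in> C k"
    by auto
  have k: "k < l"
    using Suc by simp
  have fin: "finite S'"
    using S S' finite_subset by blast
  define \<mu> where "\<mu> = Min ((\<lambda>e. e k) ` S')"
  have \<mu>: "\<mu> \<le> e k" if "e \<in> S'" for e
    using that fin by (simp add: \<mu>_def)
  have "\<mu> \<in> (\<lambda>e. e k) ` S'"
    unfolding \<mu>_def using fin S' by (intro Min_in) auto
  then obtain e0 where e0: "e0 \<in> S'" "e0 k = \<mu>"
    by auto
  define g where "g e = Const (c e) * (\<Prod>i\<in>{Suc k..<l}. f i ^ e i)" for e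
  note Ck = prime[of k, unfolded primeideal_class_ring_iff]
  note CSk = prime[of "Suc k", unfolded primeideal_class_ring_iff]
  have idk: "ideal (C k) class_ring" and idSk: "ideal (C (Suc k)) class_ring"
    using Ck CSk k by auto
  have "f k ^ \<mu> * (\<Sum>e\<in>S'. f k ^ (e k - \<mu>) * g e) =
      (\<Sum>e\<in>S'. Const (c e) * (\<Prod>i\<in>{k..<l}. f i ^ e i))"
    unfolding sum_distrib_left
  proof (rule sum.cong[OF refl])
    fix e assume "e \<in> S'"
    then have "f k ^ \<mu> * f k ^ (e k - \<mu>) = f k ^ e k"
      using \<mu> by (simp flip: power_add)
    then have "f k ^ \<mu> * (f k ^ (e k - \<mu>) * g e) = f k ^ e k * g e"
      by (simp flip: mult.assoc)
    also have "\<dots> = Const (c e) * (\<Prod>i\<in>{k..<l}. f i ^ e i)"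
      using k by (simp add: g_def prod.atLeast_Suc_lessThan mult_ac)
    finally show "f k ^ \<mu> * (f k ^ (e k - \<mu>) * g e) = \<dots>" .
  qed
  then have "f k ^ \<mu> * (\<Sum>e\<in>S'. f k ^ (e k - \<mu>) * g e) \<in> C k"
    using sum by simp
  \<comment> \<open>The common power of \<open>f k\<close> can be cancelled because
    \<open>C k\<close> is prime and does not contain \<open>f k\<close>.\<close>
  moreover have "f k ^ j \<notin> C k" for j
    using Ck f(2)[OF k] k by (induct j) auto
  ultimately have in_k: "(\<Sum>e\<in>S'. f k ^ (e k - \<mu>) * g e) \<in> C k"
    using Ck k by auto
  let ?S = "{e \<in> S'. e k = \<mu>}"
  have "(\<Sum>e\<in>S' - ?S. f k ^ (e k - \<mu>) * g e) \<in> C (Suc k)"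
  proof (rule ideal_class_ring_sum[OF idSk])
    fix e assume "e \<in> S' - ?S"
    then obtain j where j: "e k - \<mu> = Suc j"
      using \<mu>[of e] by (cases "e k - \<mu>") auto
    have "(f k ^ j * g e) * f k \<in> C (Suc k)"
      by (rule ideal_class_ringD(3)[OF idSk f(1)[OF k]])
    then show "f k ^ (e k - \<mu>) * g e \<in> C (Suc k)"
      by (simp add: j mult_ac)
  qed
  moreover have "(\<Sum>e\<in>S'. f k ^ (e k - \<mu>) * g e) =
      (\<Sum>e\<in>S' - ?S. f k ^ (e k - \<mu>) * g e) + (\<Sum>e\<in>?S. g e)"
    by (subst sum.subset_diff[of ?S]) (use fin in auto)
  ultimately have "(\<Sum>e\<in>?S. g e) \<in> C (Suc k)"
    using ideal_class_ringD(4)[OF idSk subsetD[OF mono[OF k] in_k]] by fastforce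
  then show ?case
    using S' e0 by (intro exI[of _ ?S]) (auto simp: g_def less_Suc_eq)
qed

text \<open>An algebraic relation between elements taken from the four differences of the chain is
  cut down to terms with the same four exponents, hence to a single term. Its nonzero constant
  coefficient lies in \<open>C 4\<close>, which is then not proper.\<close>

lemma no_prime_chain_of_length_4:
  assumes prime: "\<And>i. i \<le> 4 \<Longrightarrow> primeideal (C i) (class_ring :: 'k::field poly3 ring)"
    and less: "\<And>i. i < 4 \<Longrightarrow> C i \<subset> C (Suc i)"
  shows False
proof -
  have "\<forall>i. \<exists>p. i < 4 \<longrightarrow> p \<in> C (Suc i) \<and> p \<notin> C i"
    using less by blast
  then obtain f where f: "\<And>i. i < 4 \<Longrightarrow> f i \<in> C (Suc i)" "\<And>i. i < 4 \<Longrightarrow> f i \<notin> C i"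
    by metis
  obtain S c where S: "finite S" "S \<noteq> {}" "S \<subseteq> {e :: nat \<Rightarrow> nat. \<forall>i\<ge>4. e i = 0}"
    and c: "\<And>e. e \<in> S \<Longrightarrow> c e \<noteq> 0"
    and rel: "(\<Sum>e\<in>S. Const (c e) * (\<Prod>i<4. f i ^ e i)) = 0"
    by (rule four_algebraically_dependent[of f]) blast
  have id: "ideal (C i) class_ring" if "i \<le> 4" for i
    using prime[OF that] by (simp add: primeideal_class_ring_iff)
  have "\<exists>S'\<subseteq>S. S' \<noteq> {} \<and> (\<forall>e\<in>S'. \<forall>e'\<in>S'. \<forall>i<4. e i = e' i) \<and>
      (\<Sum>e\<in>S'. Const (c e) * (\<Prod>i\<in>{4..<4}. f i ^ e i)) \<in> C 4"
    by (rule relation_in_prime_chain[where C = C and l = 4,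
          OF prime psubset_imp_subset[OF less] f S(1,2)])
      (simp_all add: rel ideal_class_ringD(1)[OF id])
  then obtain S' where S': "S' \<subseteq> S" "S' \<noteq> {}" "\<forall>e\<in>S'. \<forall>e'\<in>S'. \<forall>i<4. e i = e' i"
    and sum: "(\<Sum>e\<in>S'. Const (c e)) \<in> C 4"
    by auto
  obtain e where e: "e \<in> S'"
    using S' by auto
  have "e' = e" if "e' \<in> S'" for e'
  proof
    fix i
    show "e' i = e i"
      using S'(3) e that subsetD[OF S(3) subsetD[OF S'(1) e]] subsetD[OF S(3) subsetD[OF S'(1) that]]
      by (cases "i < 4") auto
  qed
  then have "S' = {e}"
    using e by blast
  then have "Const (c e) \<in> C 4"
    using sum by simp
  then have "Const (inverse (c e)) * Const (c e) \<in> C 4"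
    using ideal_class_ringD(3)[OF id] by blast
  then have "1 \<in> C 4"
    using c[of e] e S' by (auto simp flip: Const_mult)
  then show False
    using prime[of 4] by (simp add: primeideal_class_ring_iff)
qed


section \<open>Homogeneous ideals of height three\<close>

text \<open>Take \<open>P\<close> maximal among the ideals that contain \<open>J\<close> and no
  power of \<open>x\<close>. Adjoining an element outside \<open>P\<close> captures a power of
  \<open>x\<close>. If this happens for \<open>a\<close> and for \<open>b\<close>, the product of
  the two powers lies in the ideal generated by \<open>P\<close> and \<open>a * b\<close>.\<close>

lemma prime_ideal_avoiding_powers:
  fixes J :: "'a::comm_ring_1 set"
  assumes J: "ideal J class_ring" and x: "\<And>N. x ^ N \<notin> J"
  obtains P where "primeideal P class_ring" "J \<subseteq> P" "x \<notin> P"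
proof -
  define \<A> where "\<A> = {I. ideal I class_ring \<and> J \<subseteq> I \<and> (\<forall>N. x ^ N \<notin> I)}"
  have "\<exists>P\<in>\<A>. \<forall>I\<in>\<A>. P \<subseteq> I \<longrightarrow> I = P"
  proof (rule subset_Zorn_nonempty)
    show "\<A> \<noteq> {}"
      using J x by (auto simp: \<A>_def)
    fix \<C> assume \<C>: "\<C> \<noteq> {}" "subset.chain \<A> \<C>"
    have \<C>\<A>: "\<C> \<subseteq> \<A>"
      using \<C>(2) by (simp add: subset.chain_def)
    then have id: "ideal I class_ring" if "I \<in> \<C>" for I
      using that by (auto simp: \<A>_def)
    have "ideal (\<Union>\<C>) class_ring"
    proof (rule ideal_class_ringI)
      show "0 \<in> \<Union>\<C>"
        using \<C>(1) ideal_class_ringD(1)[OF id] by blast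
      show "r * a \<in> \<Union>\<C>" if "a \<in> \<Union>\<C>" for a r
        using that ideal_class_ringD(3)[OF id] by blast
      fix a b assume "a \<in> \<Union>\<C>" "b \<in> \<Union>\<C>"
      then obtain I I' where I: "I \<in> \<C>" "a \<in> I" "I' \<in> \<C>" "b \<in> I'"
        by auto
      then have "I \<subseteq> I' \<or> I' \<subseteq> I"
        using \<C>(2) by (auto simp: subset.chain_def)
      then obtain I'' where "I'' \<in> \<C>" "a \<in> I''" "b \<in> I''"
        using I by blast
      then show "a + b \<in> \<Union>\<C>"
        using ideal_class_ringD(2)[OF id] by blast
    qed
    then show "\<Union>\<C> \<in> \<A>"
      using \<C>(1) \<C>\<A> by (auto simp: \<A>_def)
  qed
  then obtain P where P: "P \<in> \<A>" and max: "\<And>I. I \<in> \<A> \<Longrightarrow> P \<subseteq> I \<Longrightarrow> I = P"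
    by auto
  have id: "ideal P class_ring" and PJ: "J \<subseteq> P" and Px: "\<And>N. x ^ N \<notin> P"
    using P by (auto simp: \<A>_def)
  note [intro] = ideal_class_ringD[OF id]
  have power: "\<exists>N r p. x ^ N = p + r * a \<and> p \<in> P" if a: "a \<notin> P" for a
  proof (rule ccontr)
    assume contr: "\<not> ?thesis"
    define Q where "Q = {p + r * a | p r. p \<in> P}"
    have PQ: "P \<subseteq> Q"
      unfolding Q_def by (force intro: exI[of _ 0])
    have "ideal Q class_ring"
    proof (rule ideal_class_ringI)
      show "0 \<in> Q"
        using PQ id ideal_class_ringD(1) by blast
      fix b c assume "b \<in> Q"
      then obtain p r where b: "p \<in> P" "b = p + r * a"
        by (auto simp: Q_def)
      have "c * b = c * p + (c * r) * a" "c * p \<in> P"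
        using b ideal_class_ringD(3)[OF id] by (auto simp: algebra_simps)
      then show "c * b \<in> Q"
        unfolding Q_def by blast
      assume "c \<in> Q"
      then obtain q s where c: "q \<in> P" "c = q + s * a"
        by (auto simp: Q_def)
      have "b + c = (p + q) + (r + s) * a" "p + q \<in> P"
        using b c by (auto simp: algebra_simps)
      then show "b + c \<in> Q"
        unfolding Q_def by blast
    qed
    moreover have "x ^ N \<notin> Q" for N
      using contr by (auto simp: Q_def)
    ultimately have "Q = P"
      using PQ PJ by (intro max) (auto simp: \<A>_def)
    moreover have "a \<in> Q"
      unfolding Q_def using ideal_class_ringD(1)[OF id] by (force intro: exI[of _ 1])
    ultimately show False
      using a by simp
  qed
  have "primeideal P class_ring"
    unfolding primeideal_class_ring_iff
  proof (intro conjI id allI impI)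
    show "1 \<notin> P"
      using Px[of 0] by simp
    fix a b assume ab: "a * b \<in> P"
    show "a \<in> P \<or> b \<in> P"
    proof (rule ccontr)
      assume "\<not> ?thesis"
      then obtain N r p M s q where "x ^ N = p + r * a" "p \<in> P" "x ^ M = q + s * b" "q \<in> P"
        using power by metis
      moreover from this have "x ^ (N + M) = (q + s * b) * p + ((r * a) * q + (r * s) * (a * b))"
        by (simp add: power_add algebra_simps)
      ultimately have "x ^ (N + M) \<in> P"
        using ab ideal_class_ringD(2,3)[OF id] by simp
      then show False
        using Px by blast
    qed
  qed
  then show ?thesis
    using that PJ Px[of 1] by simp
qed

text \<open>For an ideal \<open>P\<close> this is the largest homogeneous ideal contained in
  \<open>P\<close>.\<close>

definition homogeneous_core :: "'k::comm_ring_1 poly3 set \<Rightarrow> 'k poly3 set" where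
  "homogeneous_core P = {p. \<forall>d. hcomp d p \<in> P}"

lemma homogeneous_core_subset:
  assumes "ideal P class_ring"
  shows "homogeneous_core P \<subseteq> P"
proof
  fix p assume "p \<in> homogeneous_core P"
  then have "(\<Sum>d\<in>degrees p. hcomp d p) \<in> P"
    by (intro ideal_class_ring_sum[OF assms]) (simp add: homogeneous_core_def)
  then show "p \<in> P"
    by (simp add: sum_hcomp)
qed

text \<open>If neither factor is in the core, take in each the top component outside
  \<open>P\<close>. In the sum of the two degrees every other product of components has a factor in
  \<open>P\<close>, so the product of the two chosen components would lie in
  \<open>P\<close>.\<close>

lemma primeideal_homogeneous_core:
  fixes P :: "'k::comm_ring_1 poly3 set"
  assumes P: "primeideal P class_ring"
  shows "primeideal (homogeneous_core P) class_ring"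
proof -
  have id: "ideal P class_ring" and one: "1 \<notin> P" and prime: "\<And>a b. a * b \<in> P \<Longrightarrow> a \<in> P \<or> b \<in> P"
    using P by (auto simp: primeideal_class_ring_iff)
  have idc: "ideal (homogeneous_core P) class_ring"
  proof (rule ideal_class_ringI)
    show "r * p \<in> homogeneous_core P" if p: "p \<in> homogeneous_core P" for r p
    proof -
      have "hcomp d (r * p) \<in> P" for d
        using p unfolding hcomp_mult[OF finite_degrees[of r] order_refl] homogeneous_core_def
        by (intro ideal_class_ring_sum[OF id] ideal_class_ringD(3)[OF id]) simp
      then show ?thesis
        by (simp add: homogeneous_core_def)
    qed
  qed (auto simp: homogeneous_core_def hcomp_add intro: ideal_class_ringD[OF id])
  have "1 \<notin> homogeneous_core P"
    using homogeneous_core_subset[OF id] one by auto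
  moreover have "p \<in> homogeneous_core P \<or> q \<in> homogeneous_core P"
    if pq: "p * q \<in> homogeneous_core P" for p q
  proof (rule ccontr)
    assume contr: "\<not> ?thesis"
    define D where "D p = {d. hcomp d p \<notin> P}" for p
    have D: "D p \<subseteq> degrees p" for p
      using ideal_class_ringD(1)[OF id] by (auto simp: D_def) (metis hcomp_eq_0_iff)
    then have fin: "finite (D p)" for p
      using finite_subset finite_degrees by blast
    have max: "Max (D p) \<in> D p" if "p \<notin> homogeneous_core P" for p
      using that fin by (intro Max_in) (auto simp: D_def homogeneous_core_def)
    define d where "d = Max (D p)"
    define e where "e = Max (D q)"
    have d: "hcomp d p \<notin> P" and e: "hcomp e q \<notin> P"
      using contr max[of p] max[of q] by (auto simp: D_def d_def e_def)
    have top: "hcomp c p \<in> P" if "d < c" for c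
    proof (rule ccontr)
      assume "hcomp c p \<notin> P"
      then have "c \<le> d"
        unfolding d_def by (intro Max_ge fin) (simp add: D_def)
      then show False
        using that by simp
    qed
    have top': "hcomp c q \<in> P" if "e < c" for c
    proof (rule ccontr)
      assume "hcomp c q \<notin> P"
      then have "c \<le> e"
        unfolding e_def by (intro Max_ge fin) (simp add: D_def)
      then show False
        using that by simp
    qed
    let ?A = "insert d (degrees p)"
    have "hcomp (d + e) (p * q) = (\<Sum>c\<in>?A. hcomp c p * hcomp (d + e - c) q)"
      by (rule hcomp_mult) auto
    also have "\<dots> = hcomp d p * hcomp e q + (\<Sum>c\<in>?A - {d}. hcomp c p * hcomp (d + e - c) q)"
      by (subst sum.remove[of ?A d]) auto
    finally have "hcomp d p * hcomp e q =
        hcomp (d + e) (p * q) - (\<Sum>c\<in>?A - {d}. hcomp c p * hcomp (d + e - c) q)"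
      by simp
    also have "\<dots> \<in> P"
    proof (intro ideal_class_ringD(4)[OF id] ideal_class_ring_sum[OF id])
      show "hcomp (d + e) (p * q) \<in> P"
        using pq by (simp add: homogeneous_core_def)
      fix c assume "c \<in> ?A - {d}"
      then consider "d < c" | "e < d + e - c"
        by fastforce
      then show "hcomp c p * hcomp (d + e - c) q \<in> P"
      proof cases
        case 1
        then show ?thesis
          using ideal_class_ringD(3)[OF id top, of c "hcomp (d + e - c) q"] by (simp add: mult.commute)
      next
        case 2
        then show ?thesis
          by (intro ideal_class_ringD(3)[OF id top'])
      qed
    qed
    finally show False
      using prime d e by blast
  qed
  ultimately show ?thesis
    using idc by (auto simp: primeideal_class_ring_iff)
qed

text \<open>Otherwise the homogeneous core of a prime avoiding \<open>x\<close> could be extended by the irrelevant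
  ideal to a chain of length four.\<close>

lemma power_mem_of_codim_3:
  fixes J :: "'k::field poly3 set"
  assumes J: "ideal J class_ring" and homog: "\<And>p d. p \<in> J \<Longrightarrow> hcomp d p \<in> J"
    and I: "I \<subseteq> J" "codim class_ring I = 3"
    and x: "x \<in> homogeneous 1"
  shows "\<exists>N. x ^ N \<in> J"
proof (rule ccontr)
  assume "\<not> ?thesis"
  then obtain P where P: "primeideal P class_ring" "J \<subseteq> P" "x \<notin> P"
    using prime_ideal_avoiding_powers[OF J] by metis
  let ?Q = "homogeneous_core P"
  have idP: "ideal P class_ring"
    using P by (simp add: primeideal_class_ring_iff)
  have Q: "primeideal ?Q class_ring"
    by (rule primeideal_homogeneous_core[OF P(1)])
  have "I \<subseteq> ?Q"
    using I homog P by (auto simp: homogeneous_core_def)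
  then have "codim class_ring I \<le> height class_ring ?Q"
    using Q unfolding codim_def by (intro Inf_lower) auto
  then have "enat 2 < height class_ring ?Q"
    using I by (simp add: numeral_eq_enat order_less_le_trans[of _ "3::enat"])
  then have "\<exists>l C. 2 < l \<and> (\<forall>i\<le>l. primeideal (C i) (class_ring :: 'k poly3 ring)) \<and>
      (\<forall>i<l. C i \<subset> C (Suc i)) \<and> C l = ?Q"
    unfolding height_def less_Sup_iff by auto blast
  then obtain l C where l: "2 < l" and C: "\<And>i. i \<le> l \<Longrightarrow> primeideal (C i) (class_ring :: 'k poly3 ring)"
    "\<And>i. i < l \<Longrightarrow> C i \<subset> C (Suc i)" "C l = ?Q"
    by blast
  \<comment> \<open>The irrelevant maximal ideal, which contains \<open>x\<close> because
    \<open>x\<close> has degree one.\<close>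
  define m where "m = {p :: 'k poly3. Poly_Mapping.lookup p 0 = 0}"
  have lookup_0: "Poly_Mapping.lookup p 0 = Poly_Mapping.lookup (hcomp 0 p) 0" for p :: "'k poly3"
    by (simp add: lookup_hcomp monom_degree_def)
  have hcomp_0: "hcomp 0 p = Const (Poly_Mapping.lookup p 0)" for p :: "'k poly3"
  proof (rule poly_mapping_eqI)
    fix t
    have "monom_degree t = 0 \<longleftrightarrow> t = 0"
      by (auto simp: monom_degree_def poly_mapping_eq_iff fun_eq_iff)
    then show "Poly_Mapping.lookup (hcomp 0 p) t = Poly_Mapping.lookup (Const (Poly_Mapping.lookup p 0)) t"
      by (simp add: lookup_hcomp Const_def lookup_single when_def)
  qed
  have lookup_mult_0: "Poly_Mapping.lookup (p * q) 0 = Poly_Mapping.lookup p 0 * Poly_Mapping.lookup q 0"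
    for p q :: "'k poly3"
  proof -
    have "Const (Poly_Mapping.lookup (p * q) 0) = hcomp 0 (p * q)"
      by (simp add: hcomp_0)
    also have "\<dots> = (\<Sum>e\<in>insert 0 (degrees p). hcomp e p * hcomp (0 - e) q)"
      by (rule hcomp_mult) auto
    also have "\<dots> = (\<Sum>e\<in>insert 0 (degrees p). if e = 0 then hcomp 0 p * hcomp 0 q else 0)"
    proof (rule sum.cong[OF refl])
      fix e assume "e \<in> insert 0 (degrees p)"
      then have "e = 0 \<or> 0 < e"
        by (auto simp: degrees_def)
      moreover have "hcomp (0 - e) q = 0" if "0 < e"
        using that by (auto simp: hcomp_eq_0_iff degrees_def)
      ultimately show "hcomp e p * hcomp (0 - e) q = (if e = 0 then hcomp 0 p * hcomp 0 q else 0)"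
        by auto
    qed
    also have "\<dots> = Const (Poly_Mapping.lookup p 0 * Poly_Mapping.lookup q 0)"
      by (simp add: hcomp_0 Const_mult)
    finally show ?thesis
      by (metis Const_def lookup_single_eq)
  qed
  have m: "primeideal m class_ring"
    unfolding primeideal_class_ring_iff
    by (auto simp: m_def lookup_mult_0 lookup_add intro!: ideal_class_ringI)
  \<comment> \<open>A nonzero constant coefficient of an element of the core would be a unit in
    \<open>P\<close>.\<close>
  have "?Q \<subseteq> m"
  proof
    fix p assume "p \<in> ?Q"
    then have "Const (Poly_Mapping.lookup p 0) \<in> P"
      by (auto simp: homogeneous_core_def hcomp_0[symmetric])
    then have "Const (inverse (Poly_Mapping.lookup p 0)) * Const (Poly_Mapping.lookup p 0) \<in> P"
      by (rule ideal_class_ringD(3)[OF idP])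
    then show "p \<in> m"
      using P by (cases "Poly_Mapping.lookup p 0 = 0")
        (auto simp: m_def primeideal_class_ring_iff simp flip: Const_mult)
  qed
  moreover have "x \<in> m"
    unfolding m_def by (subst mem_Collect_eq, subst lookup_0)
      (simp add: hcomp_of_homogeneous[OF x])
  moreover have "x \<notin> ?Q"
    using P(3) homogeneous_core_subset[OF idP] by auto
  ultimately have less: "?Q \<subset> m"
    by blast
  show False
  proof (rule no_prime_chain_of_length_4)
    \<comment> \<open>The chain that ends in the core may have more than three steps. Its last three
      are kept and \<open>m\<close> is appended.\<close>
    let ?C = "\<lambda>i. if i \<le> 3 then C (l - 3 + i) else m"
    show "primeideal (?C i) class_ring" if "i \<le> 4" for i
      using l m C(1) by auto
    show "?C i \<subset> ?C (Suc i)" if "i < 4" for i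
    proof (cases "i = 3")
      case True
      then show ?thesis
        using less C(3) l by simp
    next
      case False
      then show ?thesis
        using that C(2)[of "l - 3 + i"] l by simp
    qed
  qed
qed


section \<open>Homogeneous vectors\<close>

text \<open>With entry degrees of the form \<open>r i - c j\<close>, every term of the Leibniz
  formula has the same degree.\<close>

lemma det_homogeneous:
  fixes A :: "'k::comm_ring_1 poly3 mat"
  assumes A: "A \<in> carrier_mat m m"
    and hom: "\<And>i j. i < m \<Longrightarrow> j < m \<Longrightarrow> A $$ (i, j) \<in> homogeneous (r i - c j)"
  shows "det A \<in> homogeneous ((\<Sum>i<m. r i) - (\<Sum>j<m. c j))"
  unfolding det_def'[OF A]
proof (rule homogeneous_sum)
  fix p assume "p \<in> {p. p permutes {0..<m}}"
  then have p: "p permutes {..<m}"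
    by (simp add: atLeast0LessThan)
  have "(\<Prod>i<m. A $$ (i, p i)) \<in> homogeneous (\<Sum>i<m. r i - c (p i))"
    using permutes_in_image[OF p] by (intro homogeneous_prod hom) auto
  also have "(\<Sum>i<m. r i - c (p i)) = (\<Sum>i<m. r i) - (\<Sum>j<m. c j)"
    using sum.permute[OF p, of c] by (simp add: sum_subtractf o_def)
  finally have "(\<Prod>i<m. A $$ (i, p i)) \<in> homogeneous ((\<Sum>i<m. r i) - (\<Sum>j<m. c j))" .
  then show "signof p * (\<Prod>i = 0..<m. A $$ (i, p i)) \<in> homogeneous ((\<Sum>i<m. r i) - (\<Sum>j<m. c j))"
    by (auto simp: sign_def atLeast0LessThan homogeneous_uminus)
qed

text \<open>The projection of the graded free module with generators in degrees \<open>a i\<close>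
  to its component of degree \<open>t\<close>.\<close>

definition vcomp :: "nat \<Rightarrow> (nat \<Rightarrow> int) \<Rightarrow> int \<Rightarrow> 'k::comm_ring_1 poly3 vec \<Rightarrow> 'k poly3 vec" where
  "vcomp n a t v = Matrix.vec n (\<lambda>i. hcomp (t - a i) (v $ i))"

lemma vcomp_carrier [simp]: "vcomp n a t v \<in> carrier_vec n" "dim_vec (vcomp n a t v) = n"
  by (simp_all add: vcomp_def)

lemma vcomp_nth [simp]: "i < n \<Longrightarrow> vcomp n a t v $ i = hcomp (t - a i) (v $ i)"
  by (simp add: vcomp_def)

lemma mult_mat_vcomp:
  fixes P :: "'k::comm_ring_1 poly3 mat"
  assumes P: "P \<in> carrier_mat n m" and w: "w \<in> carrier_vec m"
    and hom: "\<And>i j. i < n \<Longrightarrow> j < m \<Longrightarrow> P $$ (i, j) \<in> homogeneous (b j - a i)"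
  shows "P *\<^sub>v vcomp m b t w = vcomp n a t (P *\<^sub>v w)"
proof (rule eq_vecI)
  fix i assume "i < dim_vec (vcomp n a t (P *\<^sub>v w))"
  then have i: "i < n"
    by simp
  have "(P *\<^sub>v vcomp m b t w) $ i = (\<Sum>j<m. P $$ (i, j) * hcomp (t - b j) (w $ j))"
    using P i by (simp add: scalar_prod_def atLeast0LessThan)
  also have "\<dots> = (\<Sum>j<m. hcomp (t - a i) (P $$ (i, j) * w $ j))"
    by (intro sum.cong refl) (simp add: hcomp_homogeneous_mult[OF hom[OF i]])
  also have "\<dots> = vcomp n a t (P *\<^sub>v w) $ i"
    using P i w by (simp add: scalar_prod_def atLeast0LessThan hcomp_sum)
  finally show "(P *\<^sub>v vcomp m b t w) $ i = vcomp n a t (P *\<^sub>v w) $ i" .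
qed (use P in simp)

section \<open>Minors acting on the cokernel\<close>

lemma bij_betw_pick:
  assumes "finite J"
  shows "bij_betw (pick J) {..<card J} J"
proof -
  have "j \<in> pick J ` {..<card J}" if j: "j \<in> J" for j
  proof (rule image_eqI)
    show "j = pick J (card {a \<in> J. a < j})"
      by (simp add: pick_card_in_set j)
    have "{a \<in> J. a < j} \<subset> J"
      using j by auto
    then show "card {a \<in> J. a < j} \<in> {..<card J}"
      by (simp add: psubset_card_mono assms)
  qed
  then have surj: "pick J ` {..<card J} = J"
    by (auto intro: pick_in_set_le)
  then have "inj_on (pick J) {..<card J}"
    by (intro eq_card_imp_inj_on) simp_all
  then show ?thesis
    using surj by (simp add: bij_betw_def)
qed

text \<open>Cramer's rule: the witness is column \<open>i\<close> of the adjugate of the selected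
  square submatrix, extended by zero to the indices outside \<open>J\<close>.\<close>

lemma minor_mult_unit_vec:
  fixes P :: "'a::comm_ring_1 mat"
  assumes P: "P \<in> carrier_mat n m" and J: "J \<subseteq> {..<m}" "card J = n" and i: "i < n"
  shows "\<exists>w\<in>carrier_vec m. P *\<^sub>v w = det (submatrix P UNIV J) \<cdot>\<^sub>v unit_vec n i"
proof
  have fin: "finite J"
    using J finite_subset by blast
  define A where "A = submatrix P UNIV J"
  have eq: "{j. j < dim_col P \<and> j \<in> J} = J" "{j. j < dim_row P} = {..<n}"
    using P J by auto
  have A: "A \<in> carrier_mat n n"
    by (rule carrier_matI) (simp_all add: A_def dim_submatrix eq J)
  have nth: "A $$ (k, l) = P $$ (k, pick J l)" if "k < n" "l < n" for k l
    unfolding A_def using that J by (subst submatrix_index) (simp_all add: eq pick_UNIV)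
  note bij = bij_betw_pick[OF fin, unfolded J(2)]
  define w where "w = Matrix.vec m (\<lambda>j. if j \<in> J then adj_mat A $$ (inv_into {..<n} (pick J) j, i) else 0)"
  show "w \<in> carrier_vec m"
    by (simp add: w_def)
  show "P *\<^sub>v w = det (submatrix P UNIV J) \<cdot>\<^sub>v unit_vec n i"
  proof (rule eq_vecI)
    fix k assume "k < dim_vec (det (submatrix P UNIV J) \<cdot>\<^sub>v unit_vec n i)"
    then have k: "k < n"
      by simp
    have "(P *\<^sub>v w) $ k = (\<Sum>j<m. P $$ (k, j) * w $ j)"
      using P k by (simp add: w_def scalar_prod_def atLeast0LessThan)
    also have "\<dots> = (\<Sum>j\<in>J. P $$ (k, j) * adj_mat A $$ (inv_into {..<n} (pick J) j, i))"
      by (rule sum.mono_neutral_cong_right) (use J in \<open>auto simp: w_def\<close>)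
    also have "\<dots> = (\<Sum>l<n. P $$ (k, pick J l) * adj_mat A $$ (l, i))"
      using bij by (subst sum.reindex_bij_betw[OF bij, symmetric])
        (simp add: bij_betw_def)
    also have "\<dots> = (A * adj_mat A) $$ (k, i)"
      using adj_mat(1)[OF A] A k i by (simp add: scalar_prod_def nth atLeast0LessThan)
    also have "\<dots> = (det (submatrix P UNIV J) \<cdot>\<^sub>v unit_vec n i) $ k"
      using k i adj_mat(2)[OF A] by (simp add: A_def)
    finally show "(P *\<^sub>v w) $ k = (det (submatrix P UNIV J) \<cdot>\<^sub>v unit_vec n i) $ k" .
  qed (use P in simp)
qed


section \<open>The form on the cokernel\<close>

locale presentation =
  fixes n :: nat and a b :: "nat \<Rightarrow> int" and P :: "'k::field poly3 mat"
  assumes n_pos: "0 < n"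
    and P [simp]: "P \<in> carrier_mat n (n + 2)"
    and P_homogeneous: "\<And>i j. i < n \<Longrightarrow> j < n + 2 \<Longrightarrow> P $$ (i, j) \<in> homogeneous (b j - a i)"
    and codim: "codim class_ring (maximal_minors_ideal P) = 3"
begin

definition im :: "'k poly3 vec set" where
  "im = (\<lambda>w. P *\<^sub>v w) ` carrier_vec (n + 2)"

text \<open>The sum of complementary degrees under the form. The Buchsbaum-Rim resolution ends in
  the dual of \<open>G\<close> twisted by the sum of the \<open>a i\<close> minus the sum of the
  \<open>b j\<close>, and the canonical module R(-3) contributes the 3.\<close>

definition s :: int where
  "s = (\<Sum>j<n + 2. b j) - (\<Sum>i<n. a i) - 3"

lemma imI: "w \<in> carrier_vec (n + 2) \<Longrightarrow> P *\<^sub>v w \<in> im"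
  by (simp add: im_def)

lemma im_carrier: "v \<in> im \<Longrightarrow> v \<in> carrier_vec n"
  using mult_mat_vec_carrier[OF P] by (auto simp: im_def)

lemma im_zero: "0\<^sub>v n \<in> im"
proof -
  have "P *\<^sub>v 0\<^sub>v (n + 2) = 0\<^sub>v n"
    by (rule eq_vecI) (use carrier_matD[OF P] in auto)
  then show ?thesis
    using imI[of "0\<^sub>v (n + 2)"] by simp
qed

lemma im_add: "v \<in> im \<Longrightarrow> v' \<in> im \<Longrightarrow> v + v' \<in> im"
  unfolding im_def by (auto simp flip: mult_add_distrib_mat_vec[OF P])

lemma im_smult: "v \<in> im \<Longrightarrow> c \<cdot>\<^sub>v v \<in> im"
  unfolding im_def by (auto simp flip: mult_mat_smult_vec[OF P])

lemma im_vcomp: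
  assumes "v \<in> im"
  shows "vcomp n a t v \<in> im"
proof -
  obtain w where "w \<in> carrier_vec (n + 2)" "v = P *\<^sub>v w"
    using assms by (auto simp: im_def)
  then show ?thesis
    by (simp add: imI P_homogeneous flip: mult_mat_vcomp[OF P, where b = b])
qed

definition annihilator :: "'k poly3 set" where
  "annihilator = {r. \<forall>i<n. r \<cdot>\<^sub>v unit_vec n i \<in> im}"

lemma ideal_annihilator: "ideal annihilator class_ring"
proof (rule ideal_class_ringI)
  have "0 \<cdot>\<^sub>v unit_vec n i = (0\<^sub>v n :: 'k poly3 vec)" for i
    by (rule eq_vecI) auto
  then show "0 \<in> annihilator"
    by (simp add: annihilator_def im_zero)
  show "r + r' \<in> annihilator" if "r \<in> annihilator" "r' \<in> annihilator" for r r'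
    using that by (simp add: annihilator_def im_add add_smult_distrib_vec)
  show "q * r \<in> annihilator" if "r \<in> annihilator" for q r
    using that by (simp add: annihilator_def im_smult flip: smult_smult_assoc)
qed

lemma hcomp_annihilator:
  assumes "r \<in> annihilator"
  shows "hcomp d r \<in> annihilator"
proof -
  have "hcomp d r \<cdot>\<^sub>v unit_vec n i \<in> im" if i: "i < n" for i
  proof -
    have "hcomp d r \<cdot>\<^sub>v unit_vec n i = vcomp n a (d + a i) (r \<cdot>\<^sub>v unit_vec n i)"
      by (rule eq_vecI) (use i in auto)
    then show ?thesis
      using assms i by (simp add: annihilator_def im_vcomp)
  qed
  then show ?thesis
    by (simp add: annihilator_def)
qed

lemma minors_annihilate: "maximal_minors_ideal P \<subseteq> annihilator"
  unfolding maximal_minors_ideal_def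
proof (rule ring.genideal_minimal[OF class_ring.ring_axioms ideal_annihilator], rule subsetI)
  fix r assume "r \<in> {det (submatrix P UNIV J) |J. J \<subseteq> {..<dim_col P} \<and> card J = dim_row P}"
  then obtain J where J: "J \<subseteq> {..<n + 2}" "card J = n" "r = det (submatrix P UNIV J)"
    using carrier_matD[OF P] by auto
  show "r \<in> annihilator"
    unfolding annihilator_def
  proof (intro CollectI allI impI)
    fix i assume "i < n"
    then show "r \<cdot>\<^sub>v unit_vec n i \<in> im"
      using minor_mult_unit_vec[OF P J(1,2)] imI unfolding J(3) by metis
  qed
qed

lemma ex_power_annihilates:
  "\<exists>N>0. xyz N 0 0 \<in> annihilator \<and> xyz 0 N 0 \<in> annihilator \<and> xyz 0 0 N \<in> annihilator"
proof -
  note power = power_mem_of_codim_3[OF ideal_annihilator hcomp_annihilator minors_annihilate codim]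
  have "xyz 1 0 0 \<in> homogeneous 1" "xyz 0 1 0 \<in> homogeneous 1" "xyz 0 0 1 \<in> homogeneous 1"
    using homogeneous_xyz[of 1 0 0] homogeneous_xyz[of 0 1 0] homogeneous_xyz[of 0 0 1] by simp_all
  then obtain i j k where ijk: "xyz i 0 0 \<in> annihilator" "xyz 0 j 0 \<in> annihilator" "xyz 0 0 k \<in> annihilator"
    using power[of "xyz 1 0 0"] power[of "xyz 0 1 0"] power[of "xyz 0 0 1"]
    by (auto simp: xyz_power)
  \<comment> \<open>One exponent for all three variables. The added 1 makes it positive, so that
    \<open>N - 1\<close> in the socle exponents is a true predecessor.\<close>
  let ?N = "i + j + k + 1"
  have "xyz ?N 0 0 = (xyz (j + k + 1) 0 0 * xyz i 0 0 :: 'k poly3)"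
    "xyz 0 ?N 0 = (xyz 0 (i + k + 1) 0 * xyz 0 j 0 :: 'k poly3)"
    "xyz 0 0 ?N = (xyz 0 0 (i + j + 1) * xyz 0 0 k :: 'k poly3)"
    by (simp_all add: xyz_mult add_ac)
  then show ?thesis
    using ijk ideal_class_ringD(3)[OF ideal_annihilator] by (intro exI[of _ ?N]) auto
qed

text \<open>Preimages of \<open>r\<close> times the unit vectors exist since \<open>r\<close>
  annihilates the cokernel. Passing to their components of degree \<open>d + a i\<close> makes them
  homogeneous and does not change the images, because \<open>r\<close> is homogeneous of degree
  \<open>d\<close>.\<close>

lemma ex_section:
  assumes r: "r \<in> annihilator" "r \<in> homogeneous d"
  obtains S where "S \<in> carrier_mat n (n + 2)" "P * S\<^sup>T = r \<cdot>\<^sub>m 1\<^sub>m n"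
    "\<And>i j. i < n \<Longrightarrow> j < n + 2 \<Longrightarrow> S $$ (i, j) \<in> homogeneous (d + a i - b j)"
proof -
  have "\<forall>i. \<exists>w. i < n \<longrightarrow> w \<in> carrier_vec (n + 2) \<and> P *\<^sub>v w = r \<cdot>\<^sub>v unit_vec n i"
    using r(1) by (auto simp: annihilator_def im_def image_iff Bex_def eq_commute)
  then obtain w where w: "\<And>i. i < n \<Longrightarrow> w i \<in> carrier_vec (n + 2)"
    "\<And>i. i < n \<Longrightarrow> P *\<^sub>v w i = r \<cdot>\<^sub>v unit_vec n i"
    by metis
  define v where "v i = vcomp (n + 2) b (d + a i) (w i)" for i
  define S where "S = mat n (n + 2) (\<lambda>(i, j). v i $ j)"
  have Pv: "P *\<^sub>v v i = r \<cdot>\<^sub>v unit_vec n i" if i: "i < n" for i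
  proof -
    have "P *\<^sub>v v i = vcomp n a (d + a i) (r \<cdot>\<^sub>v unit_vec n i)"
      using i w by (simp add: v_def mult_mat_vcomp[OF P _ P_homogeneous])
    also have "\<dots> = r \<cdot>\<^sub>v unit_vec n i"
      by (rule eq_vecI) (use i hcomp_of_homogeneous[OF r(2)] in auto)
    finally show ?thesis .
  qed
  show ?thesis
  proof
    show S: "S \<in> carrier_mat n (n + 2)"
      by (simp add: S_def)
    show "P * S\<^sup>T = r \<cdot>\<^sub>m 1\<^sub>m n"
    proof (rule eq_matI)
      fix k i assume "k < dim_row (r \<cdot>\<^sub>m 1\<^sub>m n)" "i < dim_col (r \<cdot>\<^sub>m 1\<^sub>m n)"
      then have ki: "k < n" "i < n"
        by auto
      have "row S i = v i"
        by (rule eq_vecI) (use ki in \<open>auto simp: S_def v_def\<close>)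
      then have "(P * S\<^sup>T) $$ (k, i) = (P *\<^sub>v v i) $ k"
        using ki S carrier_matD[OF P] by simp
      then show "(P * S\<^sup>T) $$ (k, i) = (r \<cdot>\<^sub>m 1\<^sub>m n) $$ (k, i)"
        using ki by (simp add: Pv)
    qed (use carrier_matD[OF P] in \<open>auto simp: S_def\<close>)
    show "S $$ (i, j) \<in> homogeneous (d + a i - b j)" if "i < n" "j < n + 2" for i j
      using that by (simp add: S_def v_def hcomp_homogeneous)
  qed
qed

end

section \<open>Degrees of the pairing\<close>

lemma mult_transpose_homogeneous:
  fixes S :: "'k::comm_ring_1 poly3 mat"
  assumes S: "S \<in> carrier_mat n m" and h: "h \<in> carrier_vec n"
    and hom: "\<And>i j. i < n \<Longrightarrow> j < m \<Longrightarrow> S $$ (i, j) \<in> homogeneous (d + a i - b j)"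
      "\<And>i. i < n \<Longrightarrow> h $ i \<in> homogeneous (t - a i)"
    and j: "j < m"
  shows "(S\<^sup>T *\<^sub>v h) $ j \<in> homogeneous (d + t - b j)"
proof -
  have "(\<Sum>i<n. S $$ (i, j) * h $ i) \<in> homogeneous (d + t - b j)"
  proof (rule homogeneous_sum)
    fix i assume "i \<in> {..<n}"
    then have "S $$ (i, j) * h $ i \<in> homogeneous ((d + a i - b j) + (t - a i))"
      using j by (intro homogeneous_mult hom) auto
    then show "S $$ (i, j) * h $ i \<in> homogeneous (d + t - b j)"
      by (simp add: add_diff_eq)
  qed
  then show ?thesis
    using S h j by (simp add: scalar_prod_def atLeast0LessThan)
qed

lemma pairing_homogeneous:
  fixes P Sx Sy Sz :: "'k::field poly3 mat"
  assumes "sections n N P Sx Sy Sz"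
    and hom: "\<And>S i j. S \<in> {Sx, Sy, Sz} \<Longrightarrow> i < n \<Longrightarrow> j < n + 2 \<Longrightarrow> S $$ (i, j) \<in> homogeneous (int N + a i - b j)"
    and g: "g \<in> carrier_vec n" "\<And>i. i < n \<Longrightarrow> g $ i \<in> homogeneous (t - a i)"
    and h: "h \<in> carrier_vec n" "\<And>i. i < n \<Longrightarrow> h $ i \<in> homogeneous (u - a i)"
  shows "sections.pairing Sx Sy Sz g h
    \<in> homogeneous (t + u + int ((n + 2) * N) + (\<Sum>i<n. a i) - (\<Sum>j<n + 2. b j))"
proof -
  interpret sections n N P Sx Sy Sz by fact
  \<comment> \<open>The top rows carry the degrees of \<open>h\<close> and \<open>g\<close>, in this
    order; each of the \<open>n + 2\<close> rows comes from one section and so contributes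
    \<open>N\<close>.\<close>
  let ?r = "\<lambda>i. int N + (if i = 0 then u else if i = 1 then t else a (i - 2))"
  have "det (bordered Sy (Sx\<^sup>T *\<^sub>v h) (Sz\<^sup>T *\<^sub>v g))
      \<in> homogeneous ((\<Sum>i<n + 2. ?r i) - (\<Sum>j<n + 2. b j))"
  proof (rule det_homogeneous)
    show "bordered Sy (Sx\<^sup>T *\<^sub>v h) (Sz\<^sup>T *\<^sub>v g) \<in> carrier_mat (n + 2) (n + 2)"
      using bordered_carrier[of Sy] by simp
    fix i j assume ij: "i < n + 2" "j < n + 2"
    have "(Sx\<^sup>T *\<^sub>v h) $ j \<in> homogeneous (int N + u - b j)"
      by (rule mult_transpose_homogeneous[OF Sx h(1) hom h(2) ij(2)]) auto
    moreover have "(Sz\<^sup>T *\<^sub>v g) $ j \<in> homogeneous (int N + t - b j)"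
      by (rule mult_transpose_homogeneous[OF Sz g(1) hom g(2) ij(2)]) auto
    moreover have "Sy $$ (i - 2, j) \<in> homogeneous (int N + a (i - 2) - b j)" if "2 \<le> i"
      using ij that by (intro hom) auto
    moreover have "i = 0 \<or> i = 1 \<or> 2 \<le> i"
      by linarith
    ultimately show "bordered Sy (Sx\<^sup>T *\<^sub>v h) (Sz\<^sup>T *\<^sub>v g) $$ (i, j) \<in> homogeneous (?r i - b j)"
      using ij by (auto simp: bordered_def)
  qed
  moreover have "(\<Sum>i<n + 2. ?r i) = t + u + int ((n + 2) * N) + (\<Sum>i<n. a i)"
  proof -
    have "(\<Sum>i<n + 2. if i = 0 then u else if i = 1 then t else a (i - 2)) = u + (t + (\<Sum>i<n. a i))"
      by (simp add: sum.lessThan_Suc_shift add_2_eq_Suc' del: sum.lessThan_Suc)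
    then show ?thesis
      by (simp add: sum.distrib algebra_simps)
  qed
  ultimately show ?thesis
    by (simp add: pairing_def det2_def)
qed

context presentation
begin

definition comp :: "int \<Rightarrow> 'k poly3 vec set" where
  "comp t = {v \<in> carrier_vec n. \<forall>i<n. v $ i \<in> homogeneous (t - a i)}"

text \<open>The form is the coefficient of the socle generator of \<open>R/(x\<^sup>N, y\<^sup>n\<^sup>N, z\<^sup>N)\<close> in the pairing.\<close>

lemma ex_form:
  obtains \<beta> :: "'k poly3 vec \<Rightarrow> 'k poly3 vec \<Rightarrow> 'k" and B where
    "finite B" "B \<subseteq> carrier_vec n"
    "\<And>g g' h. g \<in> carrier_vec n \<Longrightarrow> g' \<in> carrier_vec n \<Longrightarrow> h \<in> carrier_vec n \<Longrightarrow>
      \<beta> (g + g') h = \<beta> g h + \<beta> g' h"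
    "\<And>p g h. g \<in> carrier_vec n \<Longrightarrow> h \<in> carrier_vec n \<Longrightarrow> \<beta> (p \<cdot>\<^sub>v g) h = \<beta> g (p \<cdot>\<^sub>v h)"
    "\<And>c g h. g \<in> carrier_vec n \<Longrightarrow> h \<in> carrier_vec n \<Longrightarrow> \<beta> (Const c \<cdot>\<^sub>v g) h = c * \<beta> g h"
    "\<And>g h. g \<in> carrier_vec n \<Longrightarrow> h \<in> carrier_vec n \<Longrightarrow> \<beta> g h = \<beta> h g"
    "\<And>g h. g \<in> im \<Longrightarrow> h \<in> carrier_vec n \<Longrightarrow> \<beta> g h = 0"
    "\<And>h. h \<in> carrier_vec n \<Longrightarrow> (\<And>u. u \<in> B \<Longrightarrow> \<beta> u h = 0) \<Longrightarrow> h \<in> im"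
    "\<And>t u g h. g \<in> comp t \<Longrightarrow> h \<in> comp u \<Longrightarrow> t + u \<noteq> s \<Longrightarrow> \<beta> g h = 0"
proof -
  obtain N where N: "0 < N" "xyz N 0 0 \<in> annihilator" "xyz 0 N 0 \<in> annihilator" "xyz 0 0 N \<in> annihilator"
    using ex_power_annihilates by blast
  obtain Sx where Sx: "Sx \<in> carrier_mat n (n + 2)" "P * Sx\<^sup>T = xyz N 0 0 \<cdot>\<^sub>m 1\<^sub>m n"
    "\<And>i j. i < n \<Longrightarrow> j < n + 2 \<Longrightarrow> Sx $$ (i, j) \<in> homogeneous (int N + a i - b j)"
    by (rule ex_section[OF N(2) homogeneous_xyz]) auto
  obtain Sy where Sy: "Sy \<in> carrier_mat n (n + 2)" "P * Sy\<^sup>T = xyz 0 N 0 \<cdot>\<^sub>m 1\<^sub>m n"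
    "\<And>i j. i < n \<Longrightarrow> j < n + 2 \<Longrightarrow> Sy $$ (i, j) \<in> homogeneous (int N + a i - b j)"
    by (rule ex_section[OF N(3) homogeneous_xyz]) auto
  obtain Sz where Sz: "Sz \<in> carrier_mat n (n + 2)" "P * Sz\<^sup>T = xyz 0 0 N \<cdot>\<^sub>m 1\<^sub>m n"
    "\<And>i j. i < n \<Longrightarrow> j < n + 2 \<Longrightarrow> Sz $$ (i, j) \<in> homogeneous (int N + a i - b j)"
    by (rule ex_section[OF N(4) homogeneous_xyz]) auto
  have sec: "sections n N P Sx Sy Sz"
    using P Sx Sy Sz by unfold_locales
  interpret S: sections n N P Sx Sy Sz
    by (rule sec)
  let ?I = "ideal_xyz N (n * N) N :: 'k poly3 set"
  define m0 :: "3 \<Rightarrow>\<^sub>0 nat" where "m0 = Poly_Mapping.single 0 (N - 1)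
    + Poly_Mapping.single 1 (n * N - 1) + Poly_Mapping.single 2 (N - 1)"
  have m0: "Poly_Mapping.lookup m0 0 = N - 1" "Poly_Mapping.lookup m0 1 = n * N - 1" "Poly_Mapping.lookup m0 2 = N - 1"
    by (simp_all add: m0_def lookup_add lookup_single_not_eq)
  have nN: "0 < n * N"
    using n_pos N by simp
  \<comment> \<open>Finitely many multipliers suffice: they move every exponent vector outside the
    ideal up to \<open>m0\<close>, whose entries are all at most \<open>n * N\<close>.\<close>
  define below where "below = {t :: 3 \<Rightarrow>\<^sub>0 nat. \<forall>i. Poly_Mapping.lookup t i \<le> n * N}"
  have mem: "q \<in> ?I" if q: "\<And>t. t \<in> below \<Longrightarrow> Poly_Mapping.lookup (mon t * q) m0 = 0" for q
    unfolding ideal_xyz_def mono_ideal_def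
  proof (intro CollectI subsetI)
    fix m assume m: "m \<in> Poly_Mapping.keys q"
    show "N \<le> Poly_Mapping.lookup m 0 \<or> n * N \<le> Poly_Mapping.lookup m 1 \<or> N \<le> Poly_Mapping.lookup m 2"
    proof (rule ccontr)
      assume contr: "\<not> ?thesis"
      have "Poly_Mapping.lookup m i \<le> Poly_Mapping.lookup m0 i \<and> Poly_Mapping.lookup m0 i \<le> n * N" for i
      proof -
        have "i \<in> {0, 1, 2}"
          unfolding UNIV_3_eq[symmetric] by simp
        moreover have "N - 1 \<le> n * N"
          using n_pos by (metis One_nat_def Suc_leI diff_le_self le_trans mult_le_mono1 nat_mult_1)
        ultimately show ?thesis
          using contr m0 by auto
      qed
      then have le: "Poly_Mapping.lookup m i \<le> Poly_Mapping.lookup m0 i"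
        and le': "Poly_Mapping.lookup m0 i \<le> n * N" for i
        by auto
      have "m0 - m + m = m0"
        by (rule poly_mapping_eqI) (simp add: lookup_add lookup_minus le)
      then have "Poly_Mapping.lookup (mon (m0 - m) * q) m0 = Poly_Mapping.lookup q m"
        using lookup_single_mult[of "m0 - m" 1 q m] by simp
      moreover have "m0 - m \<in> below"
        using le' by (auto simp: below_def lookup_minus intro: le_trans[OF diff_le_self])
      ultimately show False
        using q m by (simp add: in_keys_iff)
    qed
  qed
  have coeff_0: "Poly_Mapping.lookup q m0 = 0" if "q \<in> ?I" for q
  proof (rule ccontr)
    assume "Poly_Mapping.lookup q m0 \<noteq> 0"
    then have "m0 \<in> Poly_Mapping.keys q"
      by (simp add: in_keys_iff)
    then have "N \<le> N - 1 \<or> n * N \<le> n * N - 1"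
      using that subsetD[of "Poly_Mapping.keys q" _ m0]
      by (fastforce simp: ideal_xyz_def mono_ideal_def m0)
    then show False
      using nN N(1) by linarith
  qed
  let ?\<beta> = "\<lambda>g h. Poly_Mapping.lookup (S.pairing g h) m0"
  let ?B = "(\<lambda>(t, i). mon t \<cdot>\<^sub>v unit_vec n i) ` (below \<times> {..<n})"
  show ?thesis
  proof (rule that[of ?B ?\<beta>])
    show "finite ?B"
      unfolding below_def by (intro finite_imageI finite_cartesian_product exponents_le) simp
    show "?B \<subseteq> carrier_vec n"
      by auto
    show "?\<beta> (g + g') h = ?\<beta> g h + ?\<beta> g' h" if "g \<in> carrier_vec n" "g' \<in> carrier_vec n" for g g' h
      using that by (simp add: S.pairing_add_left lookup_add)
    show "?\<beta> (p \<cdot>\<^sub>v g) h = ?\<beta> g (p \<cdot>\<^sub>v h)" if "g \<in> carrier_vec n" "h \<in> carrier_vec n" for p g h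
      using that by (simp add: S.pairing_smult_left S.pairing_smult_right)
    show "?\<beta> (Const c \<cdot>\<^sub>v g) h = c * ?\<beta> g h" if "g \<in> carrier_vec n" for c g h
      using that lookup_single_mult[of 0 c "S.pairing g h" m0]
      by (simp add: S.pairing_smult_left Const_def)
    show sym: "?\<beta> g h = ?\<beta> h g" if "g \<in> carrier_vec n" "h \<in> carrier_vec n" for g h
      using coeff_0[OF S.pairing_sym[OF that]] by (simp add: lookup_minus)
    show "?\<beta> g h = 0" if "g \<in> im" "h \<in> carrier_vec n" for g h
      using that coeff_0 S.pairing_image by (auto simp: im_def)
    show "h \<in> im" if h: "h \<in> carrier_vec n" and zero: "\<And>u. u \<in> ?B \<Longrightarrow> ?\<beta> u h = 0" for h
    proof -
      have unit: "S.pairing h (unit_vec n i) \<in> ?I" if i: "i < n" for i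
      proof -
        have "Poly_Mapping.lookup (mon t * S.pairing (unit_vec n i) h) m0 = 0" if "t \<in> below" for t
          using zero[OF image_eqI, of _ "(t, i)"] i that by (simp add: S.pairing_smult_left)
        then have "S.pairing (unit_vec n i) h \<in> ?I"
          by (rule mem)
        then have "S.pairing h (unit_vec n i) - S.pairing (unit_vec n i) h + S.pairing (unit_vec n i) h \<in> ?I"
          using h by (intro ideal_xyz_add S.pairing_sym) auto
        then show ?thesis
          by simp
      qed
      have "S.pairing h g \<in> ?I" if "g \<in> carrier_vec n" for g
        unfolding S.pairing_expand_right[OF that]
        by (intro ideal_xyz_sum ideal_xyz_mult unit) simp
      then obtain w where "w \<in> carrier_vec (n + 2)" "h = P *\<^sub>v w"
        using S.pairing_nondegenerate[OF h] by blast
      then show ?thesis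
        by (simp add: imI)
    qed
    show "?\<beta> g h = 0" if g: "g \<in> comp t" and h: "h \<in> comp u" and "t + u \<noteq> s" for t u g h
    proof (rule ccontr)
      assume "?\<beta> g h \<noteq> 0"
      moreover have "S.pairing g h \<in> homogeneous
          (t + u + int ((n + 2) * N) + (\<Sum>i<n. a i) - (\<Sum>j<n + 2. b j))"
        using g h Sx Sy Sz by (intro pairing_homogeneous[OF sec]) (auto simp: comp_def)
      ultimately have "int (monom_degree m0) = t + u + int ((n + 2) * N) + (\<Sum>i<n. a i) - (\<Sum>j<n + 2. b j)"
        by (auto simp: homogeneous_def in_keys_iff)
      \<comment> \<open>Each of the three exponents is one less than the corresponding generator of
        the ideal; this is the 3 in \<open>s\<close>.\<close>
      moreover have "int (monom_degree m0) = int ((n + 2) * N) - 3"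
      proof -
        have "(n + 2) * N = n * N + 2 * N"
          by (rule distrib_right)
        then show ?thesis
          unfolding m0_def monom_degree_xyz using N(1) nN by linarith
      qed
      ultimately show False
        using that(3) by (simp add: s_def)
    qed
  qed
qed

end


section \<open>Graded modules with a nondegenerate symmetric form\<close>

text \<open>The system is padded with zero rows to a square matrix. As \<open>card U < k\<close>,
  the last row is zero, so the determinant vanishes and the kernel is nonzero.\<close>

lemma ex_nontrivial_solution:
  fixes f :: "'u \<Rightarrow> nat \<Rightarrow> 'k::field"
  assumes U: "finite U" "card U < k"
  obtains c where "\<exists>i<k. c i \<noteq> 0" "\<And>u. u \<in> U \<Longrightarrow> (\<Sum>i<k. c i * f u i) = 0"
proof -
  obtain g where g: "bij_betw g {0..<card U} U"
    using ex_bij_betw_nat_finite[OF U(1)] by blast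
  define A where "A = mat k k (\<lambda>(r, i). if r < card U then f (g r) i else 0)"
  have A: "A \<in> carrier_mat k k"
    by (simp add: A_def)
  have "A\<^sup>T *\<^sub>v unit_vec k (k - 1) = 0\<^sub>v k"
    by (rule eq_vecI) (use U in \<open>auto simp: A_def scalar_prod_def\<close>)
  moreover have "unit_vec k (k - 1) \<noteq> (0\<^sub>v k :: 'k vec)"
    using U by (simp add: unit_vec_nonzero)
  ultimately have "det A\<^sup>T = 0"
    using A det_0_iff_vec_prod_zero_field[of "A\<^sup>T" k] by (metis transpose_carrier_mat unit_vec_carrier)
  then have "det A = 0"
    by (simp add: det_transpose[OF A])
  then obtain v where v: "v \<in> carrier_vec k" "v \<noteq> 0\<^sub>v k" "A *\<^sub>v v = 0\<^sub>v k"
    using det_0_iff_vec_prod_zero_field[OF A] by blast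
  show ?thesis
  proof (rule that[of "\<lambda>i. v $ i"])
    show "\<exists>i<k. v $ i \<noteq> 0"
    proof (rule ccontr)
      assume "\<not> ?thesis"
      then have "v = 0\<^sub>v k"
        by (intro eq_vecI) (use v(1) in auto)
      then show False
        using v by simp
    qed
    fix u assume "u \<in> U"
    then have "u \<in> g ` {0..<card U}"
      using bij_betw_imp_surj_on[OF g] by simp
    then obtain r where r: "r < card U" "u = g r"
      by auto
    then have "(A *\<^sub>v v) $ r = (\<Sum>i<k. v $ i * f u i)"
      using U v(1) by (simp add: A_def scalar_prod_def atLeast0LessThan mult.commute)
    then show "(\<Sum>i<k. v $ i * f u i) = 0"
      using r U by (simp add: v)
  qed
qed

text \<open>The finite set \<open>U\<close> stands in for finite dimension: an element is determined
  by its \<open>card U\<close> values under the form.\<close>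

locale graded_form = graded_module N
  for N :: "('k::field poly3, 'm, 'z) gmodule_scheme" (structure) +
  fixes B :: "'m \<Rightarrow> 'm \<Rightarrow> 'k" and s :: int and U :: "'m set"
  assumes B_add: "x \<in> carrier N \<Longrightarrow> y \<in> carrier N \<Longrightarrow> z \<in> carrier N \<Longrightarrow> B (x \<oplus> y) z = B x z + B y z"
    and B_smult: "x \<in> carrier N \<Longrightarrow> y \<in> carrier N \<Longrightarrow> B (p \<odot> x) y = B x (p \<odot> y)"
    and B_Const: "x \<in> carrier N \<Longrightarrow> y \<in> carrier N \<Longrightarrow> B (Const c \<odot> x) y = c * B x y"
    and B_sym: "x \<in> carrier N \<Longrightarrow> y \<in> carrier N \<Longrightarrow> B x y = B y x"
    and finite_U: "finite U" and U_carrier: "U \<subseteq> carrier N"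
    and nondegenerate: "y \<in> carrier N \<Longrightarrow> (\<And>u. u \<in> U \<Longrightarrow> B u y = 0) \<Longrightarrow> y = \<zero>"
    and orthogonal: "x \<in> component N i \<Longrightarrow> y \<in> component N j \<Longrightarrow> i + j \<noteq> s \<Longrightarrow> B x y = 0"
begin

sublocale module "class_ring :: 'k poly3 ring" N
  by (rule module)

lemma smult_class_ring:
  assumes "x \<in> carrier N"
  shows "(p + q) \<odot> x = p \<odot> x \<oplus> q \<odot> x" "(p * q) \<odot> x = p \<odot> (q \<odot> x)" "1 \<odot> x = x"
  using assms smult_l_distr[of p q x] smult_assoc1[of p q x] smult_one[of x] by simp_all

lemma U_in_carrier [simp]: "u \<in> U \<Longrightarrow> u \<in> carrier N"
  using U_carrier by blast

lemma B_add_right: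
  "x \<in> carrier N \<Longrightarrow> y \<in> carrier N \<Longrightarrow> z \<in> carrier N \<Longrightarrow> B x (y \<oplus> z) = B x y + B x z"
  using B_add[of y z x] by (simp add: B_sym[of x])

lemma B_Const_right: "x \<in> carrier N \<Longrightarrow> y \<in> carrier N \<Longrightarrow> B x (Const c \<odot> y) = c * B x y"
  using B_Const[of y x c] by (simp add: B_sym[of x])

lemma zero_smult [simp]: "x \<in> carrier N \<Longrightarrow> 0 \<odot> x = \<zero>"
  using smult_l_null[of x] by simp

lemma B_zero [simp]: "x \<in> carrier N \<Longrightarrow> B \<zero> x = 0" "x \<in> carrier N \<Longrightarrow> B x \<zero> = 0"
  using B_Const[of \<zero> x 0] B_sym[of x \<zero>] by (simp_all)

lemma Const_uminus_1_add:
  assumes "y \<in> carrier N"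
  shows "Const (- 1) \<odot> y \<oplus> y = \<zero>"
proof -
  have "Const (- 1) \<odot> y \<oplus> y = Const (- 1) \<odot> y \<oplus> Const 1 \<odot> y"
    using smult_one[OF assms] by simp
  also have "\<dots> = Const (- 1 + 1) \<odot> y"
    unfolding Const_add using assms by (subst smult_l_distr[symmetric]) auto
  finally show ?thesis
    using assms by simp
qed

lemma diff_eq_zeroD:
  assumes x: "x \<in> carrier N" "y \<in> carrier N" and eq: "x \<oplus> Const (- 1) \<odot> y = \<zero>"
  shows "x = y"
proof -
  have "x = x \<oplus> (Const (- 1) \<odot> y \<oplus> y)"
    using x by (simp add: Const_uminus_1_add)
  also have "\<dots> = (x \<oplus> Const (- 1) \<odot> y) \<oplus> y"
    using x by (simp add: a_assoc)
  finally show ?thesis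
    using x by (simp add: eq)
qed

lemma B_eqI:
  assumes "x \<in> carrier N" "y \<in> carrier N" "\<And>u. u \<in> U \<Longrightarrow> B u x = B u y"
  shows "x = y"
proof (rule diff_eq_zeroD)
  show "x \<oplus> Const (- 1) \<odot> y = \<zero>"
    using assms by (intro nondegenerate) (simp_all add: B_add_right B_Const_right)
qed (use assms in auto)

section \<open>Linear combinations and finite length\<close>

definition lc :: "nat \<Rightarrow> (nat \<Rightarrow> 'k) \<Rightarrow> (nat \<Rightarrow> 'm) \<Rightarrow> 'm" where
  "lc k c x = (\<Oplus>i\<in>{..<k}. Const (c i) \<odot> x i)"

lemma lc_closed [simp]: "(\<And>i. i < k \<Longrightarrow> x i \<in> carrier N) \<Longrightarrow> lc k c x \<in> carrier N"
  unfolding lc_def by (rule finsum_closed) auto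

lemma lc_0 [simp]: "lc 0 c x = \<zero>"
  by (simp add: lc_def)

lemma lc_Suc:
  "(\<And>i. i \<le> k \<Longrightarrow> x i \<in> carrier N) \<Longrightarrow> lc (Suc k) c x = Const (c k) \<odot> x k \<oplus> lc k c x"
  unfolding lc_def lessThan_Suc by (subst finsum_insert) auto

lemma lc_mem:
  assumes "V \<subseteq> carrier N" "\<zero> \<in> V" "\<And>v w. v \<in> V \<Longrightarrow> w \<in> V \<Longrightarrow> v \<oplus> w \<in> V"
    "\<And>c v. v \<in> V \<Longrightarrow> Const c \<odot> v \<in> V"
  shows "(\<And>i. i < k \<Longrightarrow> x i \<in> V) \<Longrightarrow> lc k c x \<in> V"
proof (induct k)
  case (Suc k)
  then have "\<And>i. i \<le> k \<Longrightarrow> x i \<in> carrier N"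
    using assms(1) by (auto simp: less_Suc_eq_le)
  then show ?case
    using Suc assms by (simp add: lc_Suc)
qed (use assms in simp)

lemma linear_lc:
  assumes "\<And>x y. x \<in> carrier N \<Longrightarrow> y \<in> carrier N \<Longrightarrow> f (x \<oplus> y) = f x + f y"
    "\<And>c x. x \<in> carrier N \<Longrightarrow> f (Const c \<odot> x) = c * f x"
  shows "(\<And>i. i < k \<Longrightarrow> x i \<in> carrier N) \<Longrightarrow> f (lc k c x) = (\<Sum>i<k. c i * (f (x i) :: 'k))"
proof (induct k)
  case 0
  have "f (Const 0 \<odot> \<zero>) = 0"
    using assms(2)[of \<zero> 0] by simp
  then show ?case
    by simp
next
  case (Suc k)
  then show ?case
    by (simp add: lc_Suc assms less_Suc_eq_le)
qed

lemma B_lc_left: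
  "(\<And>i. i < k \<Longrightarrow> x i \<in> carrier N) \<Longrightarrow> y \<in> carrier N \<Longrightarrow> B (lc k c x) y = (\<Sum>i<k. c i * B (x i) y)"
  by (rule linear_lc) (simp_all add: B_add B_Const)

lemma B_lc_right:
  "(\<And>i. i < k \<Longrightarrow> x i \<in> carrier N) \<Longrightarrow> y \<in> carrier N \<Longrightarrow> B y (lc k c x) = (\<Sum>i<k. c i * B y (x i))"
  by (rule linear_lc) (simp_all add: B_add_right B_Const_right)

text \<open>Elements chosen from the successive differences of a chain of submodules are linearly
  independent over the field, whereas more than \<open>card U\<close> elements satisfy a linear
  relation because the test vectors separate points.\<close>

lemma finite_length: "finite_length (class_ring :: 'k poly3 ring) N"
  unfolding finite_length_def
proof (intro exI[of _ "card U"] allI impI)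
  fix l and C :: "nat \<Rightarrow> 'm set"
  assume C: "(\<forall>i\<le>l. submodule (class_ring :: 'k poly3 ring) (C i) N) \<and> (\<forall>i<l. C i \<subset> C (Suc i))"
  show "l \<le> card U"
  proof (rule ccontr)
    assume "\<not> ?thesis"
    then have l: "card U < l"
      by simp
    have "\<forall>i. \<exists>x. i < l \<longrightarrow> x \<in> C (Suc i) \<and> x \<notin> C i"
      using C by blast
    then obtain x where x: "\<And>i. i < l \<Longrightarrow> x i \<in> C (Suc i)" "\<And>i. i < l \<Longrightarrow> x i \<notin> C i"
      by metis
    have sub: "C i \<subseteq> carrier N" if "i \<le> l" for i
      using C that by (meson submodule.subset)
    then have xc: "x i \<in> carrier N" if "i < l" for i
      using x(1)[OF that] that by (meson Suc_leI subsetD)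
    obtain c where c: "\<exists>i<l. c i \<noteq> 0" "\<And>u. u \<in> U \<Longrightarrow> (\<Sum>i<l. c i * B u (x i)) = 0"
      by (rule ex_nontrivial_solution[OF finite_U l, of "\<lambda>u i. B u (x i)"]) blast
    \<comment> \<open>At the largest index with a nonzero coefficient, the relation expresses
      \<open>x m\<close> by earlier elements, which all lie in \<open>C m\<close>.\<close>
    define m where "m = Max {i. i < l \<and> c i \<noteq> 0}"
    have "m \<in> {i. i < l \<and> c i \<noteq> 0}"
      unfolding m_def by (rule Max_in) (use c in auto)
    then have m: "m < l" "c m \<noteq> 0"
      by auto
    have above: "c i = 0" if "m < i" "i < l" for i
    proof (rule ccontr)
      assume "c i \<noteq> 0"
      then have "i \<le> m"
        unfolding m_def using that by (intro Max_ge) auto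
      then show False
        using that by simp
    qed
    have mono: "C i \<subseteq> C j" if "i \<le> j" "j \<le> l" for i j
      using that
    proof (induct rule: dec_induct)
      case (step m)
      then have "C i \<subseteq> C m" "C m \<subset> C (Suc m)"
        using C by auto
      then show ?case
        by blast
    qed simp
    interpret Cm: LinearCombinations.submodule "class_ring :: 'k poly3 ring" "C m" N
      using C m by simp
    have xm: "x i \<in> C m" if "i < m" for i
      using x(1)[of i] mono[of "Suc i" m] that m by auto
    have "lc m c x \<in> C m"
      by (rule lc_mem[OF sub]) (use m xm in auto)
    moreover have "x m = Const (- inverse (c m)) \<odot> lc m c x"
    proof (rule B_eqI)
      fix u assume u: "u \<in> U"
      have "(\<Sum>i<l. c i * B u (x i)) = (\<Sum>i<Suc m. c i * B u (x i))"
        by (rule sum.mono_neutral_right) (use m above in auto)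
      then have "c m * B u (x m) = - (\<Sum>i<m. c i * B u (x i))"
        using c(2)[OF u] by (simp add: eq_neg_iff_add_eq_0 add.commute)
      then have "B u (x m) = - inverse (c m) * (\<Sum>i<m. c i * B u (x i))"
        using m by (simp add: field_simps)
      then show "B u (x m) = B u (Const (- inverse (c m)) \<odot> lc m c x)"
        using u xc m by (simp add: B_Const_right B_lc_right)
    qed (use xc m in auto)
    ultimately have "x m \<in> C m"
      by simp
    then show False
      using x(2) m by blast
  qed
qed

section \<open>Dual bases for the form\<close>

definition subspc :: "'m set \<Rightarrow> bool" where
  "subspc V \<longleftrightarrow> V \<subseteq> carrier N \<and> \<zero> \<in> V \<and> (\<forall>v\<in>V. \<forall>w\<in>V. v \<oplus> w \<in> V) \<and> (\<forall>c. \<forall>v\<in>V. Const c \<odot> v \<in> V)"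

lemma subspc_lc: "subspc V \<Longrightarrow> (\<And>i. i < k \<Longrightarrow> x i \<in> V) \<Longrightarrow> lc k c x \<in> V"
  by (rule lc_mem) (auto simp: subspc_def)

definition dual_system :: "'m set \<Rightarrow> 'm set \<Rightarrow> nat \<Rightarrow> (nat \<Rightarrow> 'm) \<Rightarrow> (nat \<Rightarrow> 'm) \<Rightarrow> bool" where
  "dual_system V W k x y \<longleftrightarrow> (\<forall>i<k. x i \<in> V \<and> y i \<in> W) \<and>
     (\<forall>i<k. \<forall>j<k. B (x i) (y j) = (if i = j then 1 else 0))"

text \<open>Spanning is encoded by the functionals given by the \<open>y j\<close> separating the
  points of \<open>V\<close>; \<open>dual_basis_expand\<close> turns this into an expansion.\<close>

definition dual_basis :: "'m set \<Rightarrow> 'm set \<Rightarrow> nat \<Rightarrow> (nat \<Rightarrow> 'm) \<Rightarrow> (nat \<Rightarrow> 'm) \<Rightarrow> bool" where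
  "dual_basis V W k x y \<longleftrightarrow> dual_system V W k x y \<and>
     (\<forall>z\<in>V. (\<forall>j<k. B z (y j) = 0) \<longrightarrow> z = \<zero>)"

lemma dual_basisD:
  assumes "dual_basis V W k x y"
  shows "dual_system V W k x y" "z \<in> V \<Longrightarrow> (\<And>j. j < k \<Longrightarrow> B z (y j) = 0) \<Longrightarrow> z = \<zero>"
  using assms by (auto simp: dual_basis_def)

lemma B_lc_dual_system:
  assumes V: "subspc V" "subspc W" and dual: "dual_system V W k x y" and j: "j < k"
  shows "B (lc k c x) (y j) = c j"
proof -
  have x: "x i \<in> carrier N" "y i \<in> carrier N" if "i < k" for i
    using V dual that by (auto simp: subspc_def dual_system_def)
  have "B (lc k c x) (y j) = (\<Sum>i<k. c i * B (x i) (y j))"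
    using x j by (intro B_lc_left) auto
  also have "\<dots> = (\<Sum>i<k. if i = j then c j else 0)"
    by (rule sum.cong) (use dual j in \<open>auto simp: dual_system_def\<close>)
  finally show ?thesis
    using j by simp
qed

lemma dual_system_bound:
  assumes V: "subspc V" "subspc W" and dual: "dual_system V W k x y"
  shows "k \<le> card U"
proof (rule ccontr)
  assume "\<not> ?thesis"
  then have k: "card U < k"
    by simp
  have x: "x i \<in> carrier N" "y i \<in> carrier N" if "i < k" for i
    using V dual that by (auto simp: subspc_def dual_system_def)
  obtain c where c: "\<exists>i<k. c i \<noteq> 0" "\<And>u. u \<in> U \<Longrightarrow> (\<Sum>i<k. c i * B u (x i)) = 0"
    by (rule ex_nontrivial_solution[OF finite_U k, of "\<lambda>u i. B u (x i)"]) blast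
  have "lc k c x = \<zero>"
    by (rule nondegenerate) (use x c in \<open>auto simp: B_lc_right\<close>)
  have "c j = 0" if j: "j < k" for j
  proof -
    show ?thesis
      using B_lc_dual_system[OF V dual j, of c] j x \<open>lc k c x = \<zero>\<close> by simp
  qed
  then show False
    using c by blast
qed

text \<open>A dual system of greatest length works. A nonzero \<open>z\<close> orthogonal to all
  \<open>y j\<close> has a partner in \<open>W\<close>; correcting the partner by multiples of the
  \<open>y i\<close> makes it orthogonal to all \<open>x i\<close> and keeps its value at
  \<open>z\<close>, so the system could be extended.\<close>

lemma ex_dual_basis:
  assumes V: "subspc V" "subspc W"
    and nondeg: "\<And>x. x \<in> V \<Longrightarrow> (\<And>y. y \<in> W \<Longrightarrow> B x y = 0) \<Longrightarrow> x = \<zero>"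
  obtains k x y where "dual_basis V W k x y"
proof -
  let ?Q = "\<lambda>k. \<exists>x y. dual_system V W k x y"
  have "?Q 0"
    by (simp add: dual_system_def)
  moreover have "\<forall>k. ?Q k \<longrightarrow> k \<le> card U"
    using dual_system_bound[OF V] by blast
  ultimately obtain k where k: "?Q k" and max: "\<And>l. ?Q l \<Longrightarrow> l \<le> k"
    using Nat.ex_has_greatest_nat[of ?Q 0 "card U"] by blast
  then obtain x y where dual: "dual_system V W k x y"
    by blast
  have x: "x i \<in> V" "y i \<in> W" "x i \<in> carrier N" "y i \<in> carrier N" if "i < k" for i
    using V dual that by (auto simp: subspc_def dual_system_def)
  have "z = \<zero>" if z: "z \<in> V" "\<And>j. j < k \<Longrightarrow> B z (y j) = 0" for z
  proof (rule ccontr)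
    assume "z \<noteq> \<zero>"
    then obtain w where w: "w \<in> W" "B z w \<noteq> 0"
      using nondeg z by blast
    have wc: "w \<in> carrier N" "z \<in> carrier N"
      using V w z by (auto simp: subspc_def)
    define v where "v = Const (inverse (B z w)) \<odot> w"
    define v' where "v' = v \<oplus> lc k (\<lambda>i. - B (x i) v) y"
    have v: "v \<in> W" "v \<in> carrier N"
      using V w wc by (auto simp: v_def subspc_def)
    have v': "v' \<in> W" "v' \<in> carrier N"
      using V v x subspc_lc[OF V(2)] by (auto simp: v'_def subspc_def)
    have Bv': "B t v' = B t v - (\<Sum>i<k. B (x i) v * B t (y i))" if "t \<in> carrier N" for t
      using that v x by (simp add: v'_def B_add_right B_lc_right sum_negf)
    have "B z v' = 1"
      using wc w z by (simp add: Bv' v_def B_Const_right)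
    moreover have "B (x l) v' = 0" if "l < k" for l
    proof -
      have "(\<Sum>i<k. B (x i) v * B (x l) (y i)) = (\<Sum>i<k. if i = l then B (x l) v else 0)"
        by (rule sum.cong) (use dual that in \<open>auto simp: dual_system_def\<close>)
      then show ?thesis
        using that x by (simp add: Bv')
    qed
    ultimately have "dual_system V W (Suc k) (x(k := z)) (y(k := v'))"
      using dual z v' by (auto simp: dual_system_def less_Suc_eq)
    then show False
      using max[of "Suc k"] by auto
  qed
  then have "dual_basis V W k x y"
    using dual by (auto simp: dual_basis_def)
  then show ?thesis
    by (rule that)
qed

lemma dual_basis_expand:
  assumes V: "subspc V" "subspc W" and basis: "dual_basis V W k x y"
    and z: "z \<in> V"
  shows "z = lc k (\<lambda>i. B z (y i)) x"
proof (rule diff_eq_zeroD)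
  let ?l = "lc k (\<lambda>i. B z (y i)) x"
  note dual = dual_basisD(1)[OF basis] and span = dual_basisD(2)[OF basis]
  have x: "x i \<in> V" "y i \<in> W" "x i \<in> carrier N" "y i \<in> carrier N" if "i < k" for i
    using V dual that by (auto simp: subspc_def dual_system_def)
  have l: "?l \<in> V"
    using x by (intro subspc_lc V) auto
  show zc: "z \<in> carrier N" "?l \<in> carrier N"
    using V z l by (auto simp: subspc_def)
  show "z \<oplus> Const (- 1) \<odot> ?l = \<zero>"
  proof (rule span)
    show "z \<oplus> Const (- 1) \<odot> ?l \<in> V"
      using V z l by (auto simp: subspc_def)
    fix j assume j: "j < k"
    have "B ?l (y j) = B z (y j)"
      by (rule B_lc_dual_system[OF V dual j])
    then show "B (z \<oplus> Const (- 1) \<odot> ?l) (y j) = 0"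
      using j x zc by (simp add: B_add B_Const)
  qed
qed

text \<open>This allows one number \<open>k\<close> to be read as the dimension of \<open>V\<close>
  and of \<open>W\<close>.\<close>

lemma dual_basis_swap:
  assumes V: "subspc V" "subspc W" and basis: "dual_basis V W k x y"
    and nondeg: "\<And>y. y \<in> W \<Longrightarrow> (\<And>x. x \<in> V \<Longrightarrow> B y x = 0) \<Longrightarrow> y = \<zero>"
  shows "dual_basis W V k y x"
  unfolding dual_basis_def
proof (intro conjI ballI impI)
  note dual = dual_basisD(1)[OF basis]
  have x: "x i \<in> V" "y i \<in> W" "x i \<in> carrier N" "y i \<in> carrier N" if "i < k" for i
    using V dual that by (auto simp: subspc_def dual_system_def)
  show "dual_system W V k y x"
    using dual x by (auto simp: dual_system_def B_sym[of "y _" "x _"])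
  fix z assume z: "z \<in> W" "\<forall>j<k. B z (x j) = 0"
  have zc: "z \<in> carrier N"
    using V z by (auto simp: subspc_def)
  show "z = \<zero>"
  proof (rule nondeg[OF z(1)])
    fix t assume "t \<in> V"
    then show "B z t = 0"
      using x z zc by (subst dual_basis_expand[OF V basis]) (auto simp: B_lc_right)
  qed
qed

lemma subspc_carrier: "subspc (carrier N)"
  by (simp add: subspc_def)

lemma nondegenerate_carrier:
  "x \<in> carrier N \<Longrightarrow> (\<And>y. y \<in> carrier N \<Longrightarrow> B x y = 0) \<Longrightarrow> x = \<zero>"
  by (rule nondegenerate) (simp_all add: B_sym[of _ x])

text \<open>The representing element has the coefficients \<open>f (x i)\<close> in the dual basis
  \<open>y\<close>.\<close>

lemma represent_functional:
  assumes "\<And>x y. x \<in> carrier N \<Longrightarrow> y \<in> carrier N \<Longrightarrow> f (x \<oplus> y) = f x + f y"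
    "\<And>c x. x \<in> carrier N \<Longrightarrow> f (Const c \<odot> x) = c * f x"
  obtains z where "z \<in> carrier N" "\<And>x. x \<in> carrier N \<Longrightarrow> f x = B z x"
proof -
  obtain k x y where basis: "dual_basis (carrier N) (carrier N) k x y"
    by (rule ex_dual_basis[OF subspc_carrier subspc_carrier nondegenerate_carrier]) blast
  note dual = dual_basisD(1)[OF basis]
  have x: "x i \<in> carrier N" "y i \<in> carrier N" if "i < k" for i
    using dual that by (auto simp: dual_system_def)
  show ?thesis
  proof
    show "lc k (\<lambda>i. f (x i)) y \<in> carrier N"
      using x by simp
    fix z assume z: "z \<in> carrier N"
    have "f z = f (lc k (\<lambda>i. B z (y i)) x)"
      using dual_basis_expand[OF subspc_carrier subspc_carrier basis z] by simp
    also have "\<dots> = (\<Sum>i<k. B z (y i) * f (x i))"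
      by (rule linear_lc) (use assms x in auto)
    also have "\<dots> = B (lc k (\<lambda>i. f (x i)) y) z"
      using x z by (simp add: B_lc_left B_sym[of z] mult.commute)
    finally show "f z = B (lc k (\<lambda>i. f (x i)) y) z" .
  qed
qed

text \<open>The isomorphism sends \<open>x\<close> to the functional \<open>B x\<close>. It is
  surjective by \<open>represent_functional\<close>, has degree zero by orthogonality, and is its
  own dual precisely because \<open>B\<close> is symmetric.\<close>

lemma symmetrically_gorenstein: "symmetrically_gorenstein N"
proof -
  define \<tau> where "\<tau> x = (\<lambda>y\<in>carrier N. B x y)" for x
  let ?D = "twist (graded_dual N) (- s)"
  have carrier: "carrier ?D = carrier (graded_dual N)"
    by (simp add: twist_def)
  have \<tau>: "\<tau> x \<in> carrier (graded_dual N)" if "x \<in> carrier N" for x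
    using that by (simp add: graded_dual_def \<tau>_def B_add_right B_Const_right)
  have "\<tau> \<in> module_hom class_ring N ?D"
    unfolding module_hom_def
  proof (intro CollectI conjI allI impI)
    show "\<tau> \<in> carrier N \<rightarrow> carrier ?D"
      using \<tau> by (simp add: carrier)
    show "\<tau> (x \<oplus> y) = \<tau> x \<oplus>\<^bsub>?D\<^esub> \<tau> y" if "x \<in> carrier N \<and> y \<in> carrier N" for x y
      using that by (auto simp: twist_def graded_dual_def \<tau>_def B_add)
    show "\<tau> (p \<odot> x) = p \<odot>\<^bsub>?D\<^esub> \<tau> x" if "p \<in> carrier class_ring \<and> x \<in> carrier N" for p x
      using that by (auto simp: twist_def graded_dual_def \<tau>_def B_smult)
  qed
  moreover have comp: "component N j \<subseteq> carrier N" for j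
    using additive_subgroup.a_subset[OF component_subgroup] .
  have "\<tau> ` component N j \<subseteq> component ?D j" for j
  proof
    fix f assume "f \<in> \<tau> ` component N j"
    then obtain x where x: "x \<in> component N j" "f = \<tau> x"
      by blast
    have "f \<in> carrier (graded_dual N)"
      using x comp \<tau> by blast
    \<comment> \<open>Degree \<open>j\<close> of the twist is degree \<open>j - s\<close> of the
      dual, so only values on degree \<open>s - j\<close> may be nonzero.\<close>
    moreover have "f y = 0" if "i \<noteq> - (- s + j)" "y \<in> component N i" for i y
      using that x comp orthogonal[OF x(1) that(2)] by (auto simp: \<tau>_def)
    ultimately show "f \<in> component ?D j"
      by (auto simp: twist_def graded_dual_def)
  qed
  ultimately have "graded_hom N ?D \<tau>"
    by (simp add: graded_hom_def)
  moreover have "bij_betw \<tau> (carrier N) (carrier ?D)"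
    unfolding bij_betw_def
  proof
    show "inj_on \<tau> (carrier N)"
    proof (rule inj_onI)
      fix x y assume xy: "x \<in> carrier N" "y \<in> carrier N" "\<tau> x = \<tau> y"
      show "x = y"
      proof (rule B_eqI[OF xy(1,2)])
        fix u assume u: "u \<in> U"
        have "\<tau> x u = \<tau> y u"
          using xy(3) by (rule fun_cong)
        then show "B u x = B u y"
          using xy(1,2) u by (simp add: \<tau>_def B_sym[of u])
      qed
    qed
    show "\<tau> ` carrier N = carrier ?D"
    proof
      show "\<tau> ` carrier N \<subseteq> carrier ?D"
        using \<tau> by (auto simp: carrier)
      show "carrier ?D \<subseteq> \<tau> ` carrier N"
      proof
        fix f assume "f \<in> carrier ?D"
        then have "f \<in> carrier (graded_dual N)"
          by (simp add: twist_def)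
        then have f: "f \<in> extensional (carrier N)"
          "\<And>x y. x \<in> carrier N \<Longrightarrow> y \<in> carrier N \<Longrightarrow> f (x \<oplus> y) = f x + f y"
          "\<And>c x. x \<in> carrier N \<Longrightarrow> f (Const c \<odot> x) = c * f x"
          by (auto simp: graded_dual_def)
        obtain z where "z \<in> carrier N" "\<And>x. x \<in> carrier N \<Longrightarrow> f x = B z x"
          using represent_functional[OF f(2,3)] by blast
        moreover from this have "f = \<tau> z"
          using f(1) by (intro extensionalityI[of _ "carrier N"]) (auto simp: \<tau>_def)
        ultimately show "f \<in> \<tau> ` carrier N"
          by blast
      qed
    qed
  qed
  ultimately have "graded_iso N ?D \<tau>"
    by (simp add: graded_iso_def)
  moreover have "\<tau> x = dual_map N \<tau> (double_dual_map N x)" if x: "x \<in> carrier N" for x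
    using x \<tau> by (auto simp: dual_map_def double_dual_map_def fun_eq_iff) (auto simp: \<tau>_def B_sym)
  ultimately show ?thesis
    using finite_length graded_module_axioms unfolding symmetrically_gorenstein_def by blast
qed

section \<open>Complementary degrees and the Hilbert function\<close>

lemma component_carrier: "x \<in> component N j \<Longrightarrow> x \<in> carrier N"
  using additive_subgroup.a_subset[OF component_subgroup] by blast

lemma subspc_component: "subspc (component N j)"
  unfolding subspc_def
proof (intro conjI ballI allI)
  interpret additive_subgroup "component N j" N
    by (rule component_subgroup)
  show "component N j \<subseteq> carrier N" "\<zero> \<in> component N j"
    by (auto simp: a_subset)
  show "v \<oplus> w \<in> component N j" if "v \<in> component N j" "w \<in> component N j" for v w
    using that by simp
  show "Const c \<odot> v \<in> component N j" if "v \<in> component N j" for c v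
    using smult_component[OF homogeneous_Const that, of c] by simp
qed

text \<open>Of the homogeneous components of any \<open>y\<close>, only the one of degree
  \<open>s - i\<close> can pair nontrivially with \<open>x\<close>.\<close>

lemma nondegenerate_component:
  assumes x: "x \<in> component N i" and zero: "\<And>y. y \<in> component N (s - i) \<Longrightarrow> B x y = 0"
  shows "x = \<zero>"
proof (rule nondegenerate_carrier)
  show xc: "x \<in> carrier N"
    using x by (rule component_carrier)
  fix y assume "y \<in> carrier N"
  then obtain c where c: "\<And>j. c j \<in> component N j" "finite {j. c j \<noteq> \<zero>}"
    "y = finsum N c {j. c j \<noteq> \<zero>}"
    using direct_sum by blast
  have B0: "B x (c j) = 0" for j
    using c(1)[of j] zero orthogonal[OF x c(1)[of j]] by (cases "j = s - i") auto
  have cc: "c j \<in> carrier N" for j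
    using c(1) by (rule component_carrier)
  have "finite A \<Longrightarrow> finsum N c A \<in> carrier N \<and> B x (finsum N c A) = 0" for A
  proof (induct A rule: finite_induct)
    case empty
    then show ?case
      using xc by simp
  next
    case (insert j A)
    then show ?case
      using cc xc B0 by (simp add: B_add_right Pi_def)
  qed
  then show "B x y = 0"
    using c by simp
qed

lemma vectorspace_component: "vectorspace (class_ring :: 'k ring) (component_space N j)"
proof -
  let ?V = "component_space N j"
  have V: "subspc (component N j)"
    by (rule subspc_component)
  have mem: "x \<in> carrier N" if "x \<in> carrier ?V" for x
    using that component_carrier by (simp add: component_space_def)
  have "module (class_ring :: 'k ring) ?V"
  proof (rule moduleI)
    show "cring (class_ring :: 'k ring)"
      by (rule class_cring.cring_axioms)
    show "abelian_group ?V"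
    proof (rule abelian_groupI)
      show "\<exists>y\<in>carrier ?V. y \<oplus>\<^bsub>?V\<^esub> x = \<zero>\<^bsub>?V\<^esub>" if "x \<in> carrier ?V" for x
      proof
        show "Const (- 1) \<odot> x \<in> carrier ?V"
          using V that by (auto simp: subspc_def component_space_def)
        show "Const (- 1) \<odot> x \<oplus>\<^bsub>?V\<^esub> x = \<zero>\<^bsub>?V\<^esub>"
          using Const_uminus_1_add[OF mem[OF that]] by (simp add: component_space_def)
      qed
    qed (use V mem in \<open>auto simp: subspc_def component_space_def a_ac\<close>)
  qed (use V mem in \<open>auto simp: subspc_def component_space_def Const_add Const_mult
        smult_class_ring smult_r_distr\<close>)
  then show ?thesis
    unfolding vectorspace_def using class_field by blast
qed

lemma component_space_simps:
  "carrier (component_space N j) = component N j"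
  "\<zero>\<^bsub>component_space N j\<^esub> = \<zero>"
  "x \<oplus>\<^bsub>component_space N j\<^esub> y = x \<oplus> y"
  "c \<odot>\<^bsub>component_space N j\<^esub> x = Const c \<odot> x"
  by (simp_all add: component_space_def)

text \<open>The \<open>x i\<close> form a basis of the component: duality with the
  \<open>y i\<close> gives independence, and the separation property gives spanning.\<close>

lemma hilbert_function_dual_basis:
  assumes W: "subspc W" and basis: "dual_basis (component N j) W k x y"
  shows "hilbert_function N j = k"
proof -
  let ?V = "component_space N j"
  interpret V: vectorspace "class_ring :: 'k ring" ?V
    by (rule vectorspace_component)
  note V = subspc_component[of j]
  note dual = dual_basisD(1)[OF basis] and span = dual_basisD(2)[OF basis]
  have x: "x i \<in> component N j" "x i \<in> carrier N" "y i \<in> carrier N" if "i < k" for i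
    using V W dual that by (auto simp: subspc_def dual_system_def)
  have delta: "B (x i) (y l) = (if i = l then 1 else 0)" if "i < k" "l < k" for i l
    using dual that by (auto simp: dual_system_def)
  have inj: "inj_on x {..<k}"
  proof (rule inj_onI)
    fix i l assume "i \<in> {..<k}" "l \<in> {..<k}" "x i = x l"
    then show "i = l"
      using delta[of i l] delta[of l l] by (auto split: if_splits)
  qed
  define A where "A = x ` {..<k}"
  have A: "finite A" "card A = k" "A \<subseteq> carrier ?V"
    using x inj by (auto simp: A_def card_image component_space_simps)
  have lincomb_B: "V.lincomb c D \<in> carrier ?V \<and> B (V.lincomb c D) w = (\<Sum>v\<in>D. c v * B v w)"
    if "finite D" "D \<subseteq> carrier ?V" "w \<in> carrier N" for c D w
    using that(1,2)
  proof (induct D rule: finite_induct)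
    case empty
    then show ?case
      using that(3) V by (simp add: V.lincomb_def component_space_simps subspc_def)
  next
    case (insert v D)
    have "V.lincomb c (insert v D) = c v \<odot>\<^bsub>?V\<^esub> v \<oplus>\<^bsub>?V\<^esub> V.lincomb c D"
      unfolding V.lincomb_def using insert by (subst V.finsum_insert) auto
    then show ?case
      using insert that(3) V component_carrier
      by (auto simp: component_space_simps subspc_def B_add B_Const)
  qed
  have sum_A: "(\<Sum>v\<in>A. c v * B v (y l)) = c (x l)" if "l < k" for c l
  proof -
    have "(\<Sum>v\<in>A. c v * B v (y l)) = (\<Sum>i<k. if i = l then c (x l) else 0)"
      unfolding A_def sum.reindex[OF inj] o_def by (rule sum.cong) (use that delta in auto)
    then show ?thesis
      using that by simp
  qed
  have "V.lin_indpt A"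
  proof (rule V.finite_lin_indpt2[OF A(1,3)])
    fix c assume "V.lincomb c A = \<zero>\<^bsub>?V\<^esub>"
    then have "V.lincomb c A = \<zero>"
      by (simp add: component_space_simps)
    then have "c (x l) = 0" if "l < k" for l
      using lincomb_B[OF A(1,3), of "y l" c] x that sum_A by simp
    then show "\<forall>v\<in>A. c v = \<zero>\<^bsub>class_ring\<^esub>"
      by (auto simp: A_def)
  qed
  moreover have "V.gen_set A"
  proof
    show "V.span A \<subseteq> carrier ?V"
      using A V.span_is_subset2 by blast
    show "carrier ?V \<subseteq> V.span A"
    proof
      fix z assume "z \<in> carrier ?V"
      then have z: "z \<in> component N j" "z \<in> carrier N"
        using component_carrier by (auto simp: component_space_simps)
      define c where "c v = B z (y (inv_into {..<k} x v))" for v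
      have c: "c (x l) = B z (y l)" if "l < k" for l
        using that inj by (simp add: c_def)
      let ?l = "V.lincomb c A"
      have l: "?l \<in> component N j" "?l \<in> carrier N"
        using lincomb_B[OF A(1,3) zero_closed] component_carrier by (auto simp: component_space_simps)
      have "z = ?l"
      proof (rule diff_eq_zeroD[OF z(2) l(2)], rule span)
        show "z \<oplus> Const (- 1) \<odot> ?l \<in> component N j"
          using V z l by (auto simp: subspc_def)
        show "B (z \<oplus> Const (- 1) \<odot> ?l) (y i) = 0" if "i < k" for i
          using z l x[OF that] lincomb_B[OF A(1,3), of "y i" c] sum_A[OF that, of c] c[OF that]
          by (simp add: B_add B_Const)
      qed
      then show "z \<in> V.span A"
        unfolding V.finite_span[OF A(1,3)] by auto
    qed
  qed
  ultimately have "V.dim = card A"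
    using A by (intro V.dim_basis) (auto simp: V.basis_def)
  then show ?thesis
    using A by (simp add: hilbert_function_def)
qed

lemma hilbert_function_symmetric: "hilbert_function N j = hilbert_function N (s - j)"
proof -
  have nondeg: "x = \<zero>" if "x \<in> component N (s - j)" "\<And>y. y \<in> component N j \<Longrightarrow> B x y = 0" for x
    using that by (intro nondegenerate_component[of x "s - j"]) simp_all
  obtain k x y where basis: "dual_basis (component N j) (component N (s - j)) k x y"
    by (rule ex_dual_basis[OF subspc_component[of j] subspc_component[of "s - j"]
          nondegenerate_component]) blast
  show ?thesis
    using hilbert_function_dual_basis[OF subspc_component basis]
      hilbert_function_dual_basis[OF subspc_component
        dual_basis_swap[OF subspc_component subspc_component basis nondeg]] by simp
qed

text \<open>The top degree is \<open>s\<close>: a nonzero element of degree 0 needs a partner of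
  degree \<open>s\<close>, while a component above \<open>s\<close> could only pair with a negative
  degree, where the module is zero.\<close>

lemma symmetric_hilbert_function:
  assumes neg: "\<And>j. j < 0 \<Longrightarrow> component N j = {\<zero>}" and nonzero: "component N 0 \<noteq> {\<zero>}"
  shows "symmetric_hilbert_function N"
proof -
  have zero: "\<zero> \<in> component N j" for j
    using subspc_component by (simp add: subspc_def)
  obtain x where x: "x \<in> component N 0" "x \<noteq> \<zero>"
    using nonzero zero by blast
  then obtain y where y: "y \<in> component N s" "B x y \<noteq> 0"
    using nondegenerate_component[OF x(1)] by auto
  then have "component N s \<noteq> {\<zero>}"
    using x component_carrier by auto
  moreover from this have "0 \<le> s"
    using neg[of s] by force
  moreover have "component N j = {\<zero>}" if "s < j" for j
  proof -
    have "z = \<zero>" if z: "z \<in> component N j" for z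
    proof (rule nondegenerate_component[OF z])
      fix w assume "w \<in> component N (s - j)"
      then have "w = \<zero>"
        using neg[of "s - j"] \<open>s < j\<close> by auto
      then show "B z w = 0"
        using z component_carrier by simp
    qed
    then show ?thesis
      using zero by blast
  qed
  ultimately show ?thesis
    unfolding symmetric_hilbert_function_def
    using neg nonzero hilbert_function_symmetric graded_module_axioms finite_length by blast
qed

end


section \<open>The cokernel as a graded module\<close>

context presentation
begin

abbreviation G :: "('k poly3, 'k poly3 vec) gmodule" where
  "G \<equiv> graded_free n a"

abbreviation M :: "('k poly3, 'k poly3 vec set) gmodule" where
  "M \<equiv> graded_quotient G im"

definition cls :: "'k poly3 vec \<Rightarrow> 'k poly3 vec set" where
  "cls v = im +>\<^bsub>G\<^esub> v"

lemma cls_eq: "cls v = (\<lambda>h. h + v) ` im"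
  by (auto simp: cls_def a_r_coset_def r_coset_def graded_free_def)

lemma im_uminus: "v \<in> im \<Longrightarrow> - v \<in> im"
  using im_smult[of v "- 1"] im_carrier[of v]
  by (simp add: uminus_vec_def smult_vec_def)

lemma cls_eq_iff:
  assumes u: "u \<in> carrier_vec n" and v: "v \<in> carrier_vec n"
  shows "cls u = cls v \<longleftrightarrow> u - v \<in> im"
proof
  assume "cls u = cls v"
  moreover have "u \<in> cls u"
    unfolding cls_eq using im_zero u by (force intro: image_eqI[of _ _ "0\<^sub>v n"])
  ultimately obtain h where "h \<in> im" "u = h + v"
    by (auto simp: cls_eq)
  moreover have "h + v - v = h" if "h \<in> im" for h
    using im_carrier[OF that] v by (intro eq_vecI) auto
  ultimately show "u - v \<in> im"
    by simp
next
  have sub: "cls u \<subseteq> cls v" if uv: "u \<in> carrier_vec n" "v \<in> carrier_vec n" "u - v \<in> im" for u v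
  proof
    fix t assume "t \<in> cls u"
    then obtain h where h: "h \<in> im" "t = h + u"
      by (auto simp: cls_eq)
    have "t = (h + (u - v)) + v"
      using im_carrier[OF h(1)] uv unfolding h(2) by (intro eq_vecI) auto
    then show "t \<in> cls v"
      unfolding cls_eq using im_add[OF h(1) uv(3)] by (rule image_eqI)
  qed
  assume uv: "u - v \<in> im"
  have "v - u = - (u - v)"
    using u v by (intro eq_vecI) auto
  then have "v - u \<in> im"
    using im_uminus[OF uv] by simp
  then show "cls u = cls v"
    using sub[OF u v uv] sub[OF v u] by blast
qed

lemma carrier_M: "carrier M = cls ` carrier_vec n"
  by (auto simp: graded_quotient_def A_RCOSETS_def RCOSETS_def cls_def a_r_coset_def graded_free_def)

lemma zero_M: "\<zero>\<^bsub>M\<^esub> = cls (0\<^sub>v n)"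
proof -
  have "(\<lambda>h. h + 0\<^sub>v n) ` im = (\<lambda>h. h) ` im"
    by (rule image_cong) (auto dest: im_carrier)
  then show ?thesis
    by (simp add: graded_quotient_def cls_eq)
qed

lemma component_M: "component M j = cls ` comp j"
  by (auto simp: graded_quotient_def cls_def graded_free_def comp_def)

lemma add_M:
  assumes u: "u \<in> carrier_vec n" and v: "v \<in> carrier_vec n"
  shows "cls u \<oplus>\<^bsub>M\<^esub> cls v = cls (u + v)"
proof -
  have "cls u \<oplus>\<^bsub>M\<^esub> cls v = {h + h' | h h'. h \<in> cls u \<and> h' \<in> cls v}"
    by (auto simp: graded_quotient_def set_add_def set_mult_def graded_free_def)
  also have "\<dots> = cls (u + v)"
  proof
    show "{h + h' | h h'. h \<in> cls u \<and> h' \<in> cls v} \<subseteq> cls (u + v)"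
    proof clarify
      fix t t' assume "t \<in> cls u" "t' \<in> cls v"
      then obtain h h' where h: "h \<in> im" "h' \<in> im" "t = h + u" "t' = h' + v"
        by (auto simp: cls_eq)
      have "t + t' = (h + h') + (u + v)"
        using im_carrier[OF h(1)] im_carrier[OF h(2)] u v unfolding h(3,4) by (intro eq_vecI) auto
      then show "t + t' \<in> cls (u + v)"
        unfolding cls_eq using im_add[OF h(1,2)] by (rule image_eqI)
    qed
    show "cls (u + v) \<subseteq> {h + h' | h h'. h \<in> cls u \<and> h' \<in> cls v}"
    proof
      fix t assume "t \<in> cls (u + v)"
      then obtain h where h: "h \<in> im" "t = h + (u + v)"
        by (auto simp: cls_eq)
      have "t = (h + u) + (0\<^sub>v n + v)"
        using im_carrier[OF h(1)] u v unfolding h(2) by (intro eq_vecI) auto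
      then show "t \<in> {h + h' | h h'. h \<in> cls u \<and> h' \<in> cls v}"
        using h(1) im_zero unfolding cls_eq by blast
    qed
  qed
  finally show ?thesis .
qed

lemma smult_M:
  assumes u: "u \<in> carrier_vec n"
  shows "p \<odot>\<^bsub>M\<^esub> cls u = cls (p \<cdot>\<^sub>v u)"
proof -
  have "cls (p \<cdot>\<^sub>v t) = cls (p \<cdot>\<^sub>v u)" if t: "t \<in> cls u" for t
  proof -
    obtain h where h: "h \<in> im" "t = h + u"
      using t by (auto simp: cls_eq)
    have "p \<cdot>\<^sub>v t - p \<cdot>\<^sub>v u = p \<cdot>\<^sub>v h"
      using im_carrier[OF h(1)] u unfolding h(2) by (intro eq_vecI) (auto simp: distrib_left)
    then show ?thesis
      using im_smult[OF h(1)] im_carrier[OF h(1)] u h(2) by (subst cls_eq_iff) auto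
  qed
  moreover have "cls u \<noteq> {}"
    using im_zero by (auto simp: cls_eq)
  moreover have "p \<odot>\<^bsub>M\<^esub> cls u = (\<Union>t\<in>cls u. cls (p \<cdot>\<^sub>v t))"
    by (simp add: graded_quotient_def cls_def graded_free_def)
  ultimately show ?thesis
    by simp
qed

lemma cls_in_carrier: "v \<in> carrier_vec n \<Longrightarrow> cls v \<in> carrier M"
  by (simp add: carrier_M)

lemma M_cases:
  assumes "x \<in> carrier M"
  obtains u where "u \<in> carrier_vec n" "x = cls u"
  using assms by (auto simp: carrier_M)

lemma module_M: "module class_ring M"
proof (rule moduleI)
  show "cring (class_ring :: 'k poly3 ring)"
    by (rule class_cring.cring_axioms)
  show "abelian_group M"
  proof (rule abelian_groupI)
    fix x y z assume "x \<in> carrier M" "y \<in> carrier M" "z \<in> carrier M"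
    then obtain u v w where uvw: "u \<in> carrier_vec n" "v \<in> carrier_vec n" "w \<in> carrier_vec n"
      "x = cls u" "y = cls v" "z = cls w"
      by (elim M_cases) blast
    show "x \<oplus>\<^bsub>M\<^esub> y \<in> carrier M" "x \<oplus>\<^bsub>M\<^esub> y \<oplus>\<^bsub>M\<^esub> z = x \<oplus>\<^bsub>M\<^esub> (y \<oplus>\<^bsub>M\<^esub> z)"
      "x \<oplus>\<^bsub>M\<^esub> y = y \<oplus>\<^bsub>M\<^esub> x" "\<zero>\<^bsub>M\<^esub> \<oplus>\<^bsub>M\<^esub> x = x"
      using uvw by (simp_all add: add_M zero_M cls_in_carrier assoc_add_vec[of _ n] comm_add_vec[of u n])
    show "\<exists>y\<in>carrier M. y \<oplus>\<^bsub>M\<^esub> x = \<zero>\<^bsub>M\<^esub>"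
      using uvw by (intro bexI[of _ "cls (- u)"]) (simp_all add: add_M zero_M cls_in_carrier)
  next
    show "\<zero>\<^bsub>M\<^esub> \<in> carrier M"
      by (simp add: zero_M cls_in_carrier)
  qed
next
  fix p q :: "'k poly3" and x y assume "x \<in> carrier M" "y \<in> carrier M"
  then obtain u v where uv: "u \<in> carrier_vec n" "v \<in> carrier_vec n" "x = cls u" "y = cls v"
    by (elim M_cases) blast
  show "p \<odot>\<^bsub>M\<^esub> (x \<oplus>\<^bsub>M\<^esub> y) = p \<odot>\<^bsub>M\<^esub> x \<oplus>\<^bsub>M\<^esub> p \<odot>\<^bsub>M\<^esub> y"
    using uv by (simp add: add_M smult_M smult_add_distrib_vec[of _ n])
next
  fix p q :: "'k poly3" and x assume "x \<in> carrier M"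
  then obtain u where u: "u \<in> carrier_vec n" "x = cls u"
    by (rule M_cases)
  show "p \<odot>\<^bsub>M\<^esub> x \<in> carrier M"
    using u by (simp add: smult_M cls_in_carrier)
  show "(p \<oplus>\<^bsub>class_ring\<^esub> q) \<odot>\<^bsub>M\<^esub> x = p \<odot>\<^bsub>M\<^esub> x \<oplus>\<^bsub>M\<^esub> q \<odot>\<^bsub>M\<^esub> x"
    using u by (simp add: add_M smult_M add_smult_distrib_vec)
  show "(p \<otimes>\<^bsub>class_ring\<^esub> q) \<odot>\<^bsub>M\<^esub> x = p \<odot>\<^bsub>M\<^esub> (q \<odot>\<^bsub>M\<^esub> x)"
    using u by (simp add: smult_M smult_smult_assoc)
  show "\<one>\<^bsub>class_ring\<^esub> \<odot>\<^bsub>M\<^esub> x = x"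
    using u by (simp add: smult_M)
qed

section \<open>The grading of the cokernel\<close>

lemma comp_carrier: "v \<in> comp j \<Longrightarrow> v \<in> carrier_vec n"
  by (simp add: comp_def)

lemma vcomp_comp: "vcomp n a j v \<in> comp j"
  by (simp add: comp_def hcomp_homogeneous)

lemma finsum_cls:
  assumes "finite D" "\<And>j. j \<in> D \<Longrightarrow> f j \<in> carrier_vec n"
  shows "finsum M (\<lambda>j. cls (f j)) D = cls (Matrix.vec n (\<lambda>i. \<Sum>j\<in>D. f j $ i))"
proof -
  interpret module "class_ring :: 'k poly3 ring" M
    by (rule module_M)
  show ?thesis
    using assms
  proof (induct D rule: finite_induct)
    case empty
    have "Matrix.vec n (\<lambda>i. \<Sum>j\<in>{}. f j $ i) = 0\<^sub>v n"
      by (rule eq_vecI) auto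
    then show ?case
      by (simp add: zero_M)
  next
    case (insert j D)
    have "f j + Matrix.vec n (\<lambda>i. \<Sum>j\<in>D. f j $ i) = Matrix.vec n (\<lambda>i. \<Sum>j\<in>insert j D. f j $ i)"
      using insert by (intro eq_vecI) auto
    then show ?case
      using insert by (simp add: finsum_insert cls_in_carrier add_M Pi_def)
  qed
qed

text \<open>The homogeneous components of a representative give a decomposition. It is unique
  because the image of \<open>P\<close> contains all components of its elements
  (\<open>im_vcomp\<close>).\<close>

lemma graded_module_M: "graded_module M"
proof (rule graded_module.intro)
  show "module class_ring M"
    by (rule module_M)
  interpret module "class_ring :: 'k poly3 ring" M
    by (rule module_M)
  have add: "v + w \<in> comp j" if "v \<in> comp j" "w \<in> comp j" for v w j
    using that homogeneous_add unfolding comp_def by fastforce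
  have smult: "p \<cdot>\<^sub>v v \<in> comp (d + j)" if "p \<in> homogeneous d" "v \<in> comp j" for p v d j
    using that homogeneous_mult[of p d] by (fastforce simp: comp_def add_diff_eq[symmetric])
  show "p \<odot>\<^bsub>M\<^esub> x \<in> component M (d + j)" if "p \<in> homogeneous d" "x \<in> component M j" for p d x j
    using that smult comp_carrier by (auto simp: component_M smult_M)
  show "additive_subgroup (component M j) M" for j
  proof (rule additive_subgroup.intro, rule group.subgroupI)
    show "Group.group (add_monoid M)"
      by (rule a_group)
    show "component M j \<subseteq> carrier (add_monoid M)"
      using comp_carrier by (auto simp: component_M carrier_M)
    have "0\<^sub>v n \<in> comp j"
      by (simp add: comp_def)
    then show "component M j \<noteq> {}"
      by (auto simp: component_M)
    show "x \<otimes>\<^bsub>add_monoid M\<^esub> y \<in> component M j" if "x \<in> component M j" "y \<in> component M j" for x y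
      using that add comp_carrier by (auto simp: component_M add_M)
    fix x assume "x \<in> component M j"
    then obtain v where v: "v \<in> comp j" "x = cls v"
      by (auto simp: component_M)
    have "cls (- v) \<oplus>\<^bsub>M\<^esub> cls v = \<zero>\<^bsub>M\<^esub>"
      using comp_carrier[OF v(1)] by (simp add: add_M zero_M)
    then have "\<ominus>\<^bsub>M\<^esub> x = cls (- v)"
      using comp_carrier[OF v(1)] unfolding v(2) by (intro minus_equality) (auto simp: cls_in_carrier)
    moreover have "- v \<in> comp j"
      using v(1) by (auto simp: comp_def homogeneous_uminus)
    ultimately show "inv\<^bsub>add_monoid M\<^esub> x \<in> component M j"
      unfolding a_inv_def[symmetric] by (simp add: component_M)
  qed
  fix x assume "x \<in> carrier M"
  then obtain v where v: "v \<in> carrier_vec n" "x = cls v"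
    by (rule M_cases)
  show "\<exists>!c. (\<forall>j. c j \<in> component M j) \<and> finite {j. c j \<noteq> \<zero>\<^bsub>M\<^esub>} \<and>
      x = finsum M c {j. c j \<noteq> \<zero>\<^bsub>M\<^esub>}"
  proof (rule ex1I[of _ "\<lambda>j. cls (vcomp n a j v)"], intro conjI allI)
    let ?c = "\<lambda>j. cls (vcomp n a j v)"
    \<comment> \<open>The finitely many degrees occurring in the coordinates of \<open>v\<close>,
      shifted by the degrees of the generators.\<close>
    define D where "D = (\<Union>i<n. (\<lambda>d. d + a i) ` degrees (v $ i))"
    have D: "finite D"
      by (simp add: D_def)
    have "hcomp (j - a i) (v $ i) = 0" if "i < n" "j \<notin> D" for i j
      using that by (force simp: hcomp_eq_0_iff D_def)
    then have "vcomp n a j v = 0\<^sub>v n" if "j \<notin> D" for j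
      using that by (intro eq_vecI) auto
    then have supp: "{j. ?c j \<noteq> \<zero>\<^bsub>M\<^esub>} \<subseteq> D"
      by (auto simp: zero_M)
    then show "finite {j. ?c j \<noteq> \<zero>\<^bsub>M\<^esub>}"
      using D by (rule finite_subset)
    show "?c j \<in> component M j" for j
      by (simp add: component_M vcomp_comp)
    have "(\<Sum>j\<in>D. hcomp (j - a i) (v $ i)) = v $ i" if i: "i < n" for i
    proof -
      have "(\<Sum>j\<in>D. hcomp (j - a i) (v $ i)) = (\<Sum>d\<in>(\<lambda>j. j - a i) ` D. hcomp d (v $ i))"
        by (subst sum.reindex) (auto simp: inj_on_def)
      also have "\<dots> = v $ i"
      proof (rule sum_hcomp)
        show "degrees (v $ i) \<subseteq> (\<lambda>j. j - a i) ` D"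
          using i by (force simp: D_def)
      qed (simp add: D)
      finally show ?thesis .
    qed
    then have "Matrix.vec n (\<lambda>i. \<Sum>j\<in>D. vcomp n a j v $ i) = v"
      using v(1) by (intro eq_vecI) auto
    then have "x = finsum M ?c D"
      using finsum_cls[OF D, of "\<lambda>j. vcomp n a j v"] v(2) by simp
    also have "\<dots> = finsum M ?c {j. ?c j \<noteq> \<zero>\<^bsub>M\<^esub>}"
      using D supp by (intro add.finprod_mono_neutral_cong_right) (auto simp: cls_in_carrier)
    finally show "x = finsum M ?c {j. ?c j \<noteq> \<zero>\<^bsub>M\<^esub>}" .
  next
    fix c assume c: "(\<forall>j. c j \<in> component M j) \<and> finite {j. c j \<noteq> \<zero>\<^bsub>M\<^esub>} \<and>
      x = finsum M c {j. c j \<noteq> \<zero>\<^bsub>M\<^esub>}"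
    let ?D = "{j. c j \<noteq> \<zero>\<^bsub>M\<^esub>}"
    have "\<forall>j. \<exists>g. g \<in> comp j \<and> c j = cls g"
      using c by (auto simp: component_M)
    then obtain g where g: "\<And>j. g j \<in> comp j" "\<And>j. c j = cls (g j)"
      by metis
    let ?g = "Matrix.vec n (\<lambda>i. \<Sum>j\<in>?D. g j $ i)"
    have "c = (\<lambda>j. cls (g j))"
      using g(2) by (rule ext)
    then have "finsum M c ?D = finsum M (\<lambda>j. cls (g j)) ?D"
      by (rule arg_cong[where f = "\<lambda>c. finsum M c ?D"])
    also have "\<dots> = cls ?g"
      using c comp_carrier[OF g(1)] by (intro finsum_cls) auto
    finally have "cls v = cls ?g"
      using c v(2) by simp
    then have diff: "v - ?g \<in> im"
      using v(1) by (simp add: cls_eq_iff)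
    have "cls (vcomp n a t v) = c t" for t
    proof -
      have "vcomp n a t (v - ?g) = vcomp n a t v - (if t \<in> ?D then g t else 0\<^sub>v n)"
      proof (rule eq_vecI)
        fix i assume "i < dim_vec (vcomp n a t v - (if t \<in> ?D then g t else 0\<^sub>v n))"
        then have i: "i < n"
          using comp_carrier[OF g(1)[of t]] by (auto split: if_splits)
        have "hcomp (t - a i) (\<Sum>j\<in>?D. g j $ i) = (\<Sum>j\<in>?D. if j = t then g t $ i else 0)"
          unfolding hcomp_sum
        proof (rule sum.cong[OF refl])
          fix j
          have "g j $ i \<in> homogeneous (j - a i)"
            using g(1)[of j] i by (simp add: comp_def)
          then show "hcomp (t - a i) (g j $ i) = (if j = t then g t $ i else 0)"
            by (auto simp: hcomp_of_homogeneous)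
        qed
        also have "\<dots> = (if t \<in> ?D then g t $ i else 0)"
          using c by (simp add: sum.delta')
        finally show "vcomp n a t (v - ?g) $ i = (vcomp n a t v - (if t \<in> ?D then g t else 0\<^sub>v n)) $ i"
          using i v(1) comp_carrier[OF g(1)[of t]] hcomp_add[of "t - a i" "v $ i - (\<Sum>j\<in>?D. g j $ i)" "\<Sum>j\<in>?D. g j $ i"]
          by (auto simp: algebra_simps)
      qed (use comp_carrier[OF g(1)[of t]] in auto)
      then have "vcomp n a t v - (if t \<in> ?D then g t else 0\<^sub>v n) \<in> im"
        using im_vcomp[OF diff, of t] by simp
      then have "cls (vcomp n a t v) = cls (if t \<in> ?D then g t else 0\<^sub>v n)"
        using comp_carrier[OF g(1)[of t]] by (subst cls_eq_iff) auto
      also have "\<dots> = c t"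
        by (auto simp: g(2) zero_M simp flip: g(2))
      finally show ?thesis .
    qed
    then show "c = (\<lambda>j. cls (vcomp n a j v))"
      by auto
  qed
qed

text \<open>The form vanishes if its first argument lies in the image, hence by symmetry also for
  the second, so its value does not depend on the chosen representatives.\<close>

lemma ex_graded_form: "\<exists>B U. graded_form M B s U"
proof -
  obtain \<beta> S where S: "finite S" "S \<subseteq> carrier_vec n"
    and \<beta>_add: "\<And>g g' h. g \<in> carrier_vec n \<Longrightarrow> g' \<in> carrier_vec n \<Longrightarrow> h \<in> carrier_vec n \<Longrightarrow>
      \<beta> (g + g') h = \<beta> g h + \<beta> g' h"
    and \<beta>_smult: "\<And>p g h. g \<in> carrier_vec n \<Longrightarrow> h \<in> carrier_vec n \<Longrightarrow> \<beta> (p \<cdot>\<^sub>v g) h = \<beta> g (p \<cdot>\<^sub>v h)"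
    and \<beta>_Const: "\<And>c g h. g \<in> carrier_vec n \<Longrightarrow> h \<in> carrier_vec n \<Longrightarrow> \<beta> (Const c \<cdot>\<^sub>v g) h = c * \<beta> g h"
    and \<beta>_sym: "\<And>g h. g \<in> carrier_vec n \<Longrightarrow> h \<in> carrier_vec n \<Longrightarrow> \<beta> g h = (\<beta> h g :: 'k)"
    and \<beta>_im: "\<And>g h. g \<in> im \<Longrightarrow> h \<in> carrier_vec n \<Longrightarrow> \<beta> g h = 0"
    and \<beta>_nondeg: "\<And>h. h \<in> carrier_vec n \<Longrightarrow> (\<And>u. u \<in> S \<Longrightarrow> \<beta> u h = 0) \<Longrightarrow> h \<in> im"
    and \<beta>_orth: "\<And>t u g h. g \<in> comp t \<Longrightarrow> h \<in> comp u \<Longrightarrow> t + u \<noteq> s \<Longrightarrow> \<beta> g h = 0"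
    by (rule ex_form) blast
  define rep where "rep x = (SOME v. v \<in> carrier_vec n \<and> cls v = x)" for x
  have rep: "rep (cls v) \<in> carrier_vec n" "cls (rep (cls v)) = cls v" if "v \<in> carrier_vec n" for v
    using someI[of "\<lambda>w. w \<in> carrier_vec n \<and> cls w = cls v" v] that by (auto simp: rep_def)
  have \<beta>_rep: "\<beta> (rep (cls u)) v = \<beta> u v" if u: "u \<in> carrier_vec n" and v: "v \<in> carrier_vec n" for u v
  proof -
    have "rep (cls u) - u \<in> im"
      using rep[OF u] u by (simp flip: cls_eq_iff)
    then have "\<beta> (rep (cls u) - u) v = 0"
      using v by (rule \<beta>_im)
    moreover have "rep (cls u) - u + u = rep (cls u)"
      using rep(1)[OF u] u by (intro eq_vecI) auto
    ultimately show ?thesis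
      using \<beta>_add[of "rep (cls u) - u" u v] rep(1)[OF u] u v by simp
  qed
  define B where "B x y = \<beta> (rep x) (rep y)" for x y
  have B: "B (cls u) (cls v) = \<beta> u v" if "u \<in> carrier_vec n" "v \<in> carrier_vec n" for u v
    using that rep[OF that(2)] by (simp add: B_def \<beta>_rep \<beta>_sym[of u])
  interpret graded_module M
    by (rule graded_module_M)
  have "graded_form M B s (cls ` S)"
  proof
    show "finite (cls ` S)" "cls ` S \<subseteq> carrier M"
      using S by (auto intro: cls_in_carrier)
  next
    fix x y z assume "x \<in> carrier M" "y \<in> carrier M" "z \<in> carrier M"
    then show "B (x \<oplus>\<^bsub>M\<^esub> y) z = B x z + B y z"
      by (elim M_cases) (simp add: add_M B \<beta>_add)
  next
    fix x y and p :: "'k poly3" and c :: 'k assume "x \<in> carrier M" "y \<in> carrier M"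
    then obtain u v where uv: "u \<in> carrier_vec n" "v \<in> carrier_vec n" "x = cls u" "y = cls v"
      by (elim M_cases) blast
    show "B (p \<odot>\<^bsub>M\<^esub> x) y = B x (p \<odot>\<^bsub>M\<^esub> y)"
      using uv by (simp add: smult_M B \<beta>_smult)
    show "B (Const c \<odot>\<^bsub>M\<^esub> x) y = c * B x y"
      using uv by (simp add: smult_M B \<beta>_Const)
    show "B x y = B y x"
      using uv by (simp add: B \<beta>_sym)
  next
    fix y assume "y \<in> carrier M" and zero: "\<And>u. u \<in> cls ` S \<Longrightarrow> B u y = 0"
    then obtain v where v: "v \<in> carrier_vec n" "y = cls v"
      by (elim M_cases)
    have "v \<in> im"
    proof (rule \<beta>_nondeg[OF v(1)])
      fix u assume "u \<in> S"
      then show "\<beta> u v = 0"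
        using zero[of "cls u"] S v by (auto simp: B)
    qed
    moreover have "v - 0\<^sub>v n = v"
      using v(1) by (intro eq_vecI) auto
    ultimately show "y = \<zero>\<^bsub>M\<^esub>"
      using v by (simp add: zero_M cls_eq_iff)
  next
    fix x y i j assume "x \<in> component M i" "y \<in> component M j" "i + j \<noteq> s"
    then show "B x y = 0"
      using \<beta>_orth comp_carrier by (auto simp: component_M B)
  qed
  then show ?thesis
    by blast
qed

section \<open>The lowest degree of the cokernel\<close>

lemma component_M_neg:
  assumes nonneg: "\<And>i. i < n \<Longrightarrow> 0 \<le> a i" and j: "j < 0"
  shows "component M j = {\<zero>\<^bsub>M\<^esub>}"
proof -
  have "v = 0\<^sub>v n" if v: "v \<in> comp j" for v
  proof (rule eq_vecI)
    fix i assume "i < dim_vec (0\<^sub>v n :: 'k poly3 vec)"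
    then have i: "i < n" by simp
    then have "v $ i \<in> homogeneous (j - a i)"
      using v by (simp add: comp_def)
    moreover have "int d \<noteq> j - a i" for d
      using nonneg[OF i] j by linarith
    ultimately have "Poly_Mapping.keys (v $ i) = {}"
      by (auto simp: homogeneous_def)
    then show "v $ i = 0\<^sub>v n $ i"
      using i by simp
  qed (use v comp_carrier in auto)
  moreover have "0\<^sub>v n \<in> comp j"
    by (simp add: comp_def)
  ultimately have "comp j = {0\<^sub>v n}"
    by blast
  then show ?thesis
    by (simp add: component_M zero_M)
qed

text \<open>The first generator has degree 0 and is not in the image: the entries of
  \<open>P\<close> are zero or of positive degree, so coordinate 0 of an element of the image has no
  constant term.\<close>

lemma component_M_zero:
  assumes a0: "a 0 = 0"
    and min: "\<And>i j. i < n \<Longrightarrow> j < n + 2 \<Longrightarrow> P $$ (i, j) = 0 \<or> (\<exists>d>0. P $$ (i, j) \<in> homogeneous d)"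
  shows "component M 0 \<noteq> {\<zero>\<^bsub>M\<^esub>}"
proof
  let ?e = "unit_vec n 0"
  assume eq: "component M 0 = {\<zero>\<^bsub>M\<^esub>}"
  have "?e \<in> comp 0"
    using n_pos a0 homogeneous_one by (auto simp: comp_def index_unit_vec)
  then have "cls ?e = cls (0\<^sub>v n)"
    using eq by (auto simp: component_M zero_M)
  then have "?e - 0\<^sub>v n \<in> im"
    by (subst (asm) cls_eq_iff) auto
  then obtain w where w: "w \<in> carrier_vec (n + 2)" "?e - 0\<^sub>v n = P *\<^sub>v w"
    by (auto simp: im_def)
  have "hcomp 0 (P $$ (0, j) * w $ j) = 0" if j: "j < n + 2" for j
  proof (cases "P $$ (0, j) = 0")
    case False
    then obtain d where d: "0 < d" "P $$ (0, j) \<in> homogeneous d"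
      using min[OF n_pos j] by auto
    have "hcomp (0 - d) (w $ j) = 0"
      using d(1) by (auto simp: hcomp_eq_0_iff degrees_def)
    then show ?thesis
      by (simp add: hcomp_homogeneous_mult[OF d(2)])
  qed simp
  then have "hcomp 0 ((P *\<^sub>v w) $ 0) = 0"
    using n_pos w(1) carrier_matD[OF P] by (simp add: scalar_prod_def hcomp_sum)
  moreover have "hcomp 0 ((P *\<^sub>v w) $ 0) = 1"
    using n_pos hcomp_of_homogeneous[OF homogeneous_one, of 0] by (simp flip: w(2))
  ultimately show False
    by simp
qed

end

theorem proposition3p9:
  fixes n :: nat
    and a b :: "nat \<Rightarrow> int"
    and \<phi> :: "'k::alg_closed_field poly3 mat"
    and F G :: "('k poly3, 'k poly3 vec) gmodule"
    and M :: "('k poly3, 'k poly3 vec set) gmodule"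
  defines "F \<equiv> graded_free (n + 2) b"
    and "G \<equiv> graded_free n a"
    and "M \<equiv> graded_coker F G (\<lambda>w. \<phi> *\<^sub>v w)"
  assumes "n > 0"
    and "mono_on {..<n} a"
    and "mono_on {..<n + 2} b"
    and "\<phi> \<in> carrier_mat n (n + 2)"
    and "graded_hom F G (\<lambda>w. \<phi> *\<^sub>v w)"
    and "\<And>i j. i < n \<Longrightarrow> j < n + 2 \<Longrightarrow> \<phi> $$ (i, j) = 0 \<or> (\<exists>d>0. \<phi> $$ (i, j) \<in> homogeneous d)"
    and "codim class_ring (maximal_minors_ideal \<phi>) = 3"
    and "a 0 = 0"
    and "CHAR('k) \<noteq> 2"
  shows "symmetrically_gorenstein M \<and> symmetric_hilbert_function M"
proof -
  interpret presentation n a b \<phi>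
  proof
    fix i j assume ij: "i < n" "j < n + 2"
    \<comment> \<open>The degrees of the entries are read off from the images of the generators of
      \<open>F\<close>, which have degree \<open>b j\<close>.\<close>
    have "unit_vec (n + 2) j \<in> component F (b j)"
      using homogeneous_one ij by (auto simp: F_def graded_free_def)
    then have "\<phi> *\<^sub>v unit_vec (n + 2) j \<in> component G (b j)"
      using \<open>graded_hom F G _\<close> by (auto simp: graded_hom_def)
    then have "(\<phi> *\<^sub>v unit_vec (n + 2) j) $ i \<in> homogeneous (b j - a i)"
      using ij by (simp add: G_def graded_free_def)
    then show "\<phi> $$ (i, j) \<in> homogeneous (b j - a i)"
      using ij \<open>\<phi> \<in> carrier_mat n (n + 2)\<close> by simp
  qed fact+
  have M: "M = graded_quotient (graded_free n a) im"
    by (simp add: M_def graded_coker_def im_def F_def G_def graded_free_def)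
  obtain B U where "graded_form M B s U"
    using ex_graded_form unfolding M by blast
  then interpret graded_form M B s U .
  \<comment> \<open>By monotonicity \<open>a 0 = 0\<close> is the least generator degree, so
    \<open>M\<close> lives in nonnegative degrees.\<close>
  have "0 \<le> a i" if "i < n" for i
    using monotone_onD[OF \<open>mono_on {..<n} a\<close>, of 0 i] \<open>a 0 = 0\<close> that by simp
  then show ?thesis
    using symmetrically_gorenstein symmetric_hilbert_function component_M_neg component_M_zero assms
    unfolding M by blast
qed

end
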